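(* Let $S^1=\mathbb R/\mathbb Z$ and $I=[0,1]$. For every real $\alpha>0$ and every real $k\ge 1+\alpha$ there is a nonempty set $\mathcal U$ of $C^k$ maps of the annulus $S^1\times I$ to itself which send the boundary to the boundary, open (in the $C^k$ topology) in the space of all such maps, such that every $g\in\mathcal U$ has two disjoint attractors $A$ and $B$ whose basins of attraction $\mathcal B(A)$ and $\mathcal B(B)$ are intermingled and whose union $\mathcal B(A)\cup\mathcal B(B)$ has full $2$-dimensional Lebesgue measure in $S^1\times I$.
   Context: Let $M$ be a smooth compact $n$-dimensional manifold (possibly with boundary) and $g:M\to M$ a continuous map. The $\omega$-limit set of $\mathbf x\in M$ is $\omega(\mathbf x)=\bigcap_{k}\overline{\bigcup_{l\ge k}\{g^l(\mathbf x)\}}$. A compact set $A\subset M$ is an attractor of $g$ if $\{\mathbf x\in M:\omega(\mathbf x)=A\}$ has positive $n$-dimensional Lebesgue measure. The basin of attraction of $A$ is $\mathcal B(A)=\{\mathbf x\in M:\omega(\mathbf x)\subset A\}$. Basins are called intermingled if any open set which intersects one of the basins in a set of positive measure also intersects each of the other basins in a set of positive measure. For non-integer $k=r+\beta$ with $r$ an integer and $0<\beta<1$, $C^k$ means $C^r$ with $\beta$-Hölder $r$-th derivatives. The maps are not required to be invertible. *)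

theory Defs
  imports "HOL-Analysis.Analysis"
begin

section \<open>Limit sets, attractors and basins\<close>

text \<open>The phase space is the space of a Borel measure \<open>\<mu>\<close> and is assumed to be closed in the
  ambient type, so that closures may be taken in the type.\<close>

definition omega_limit :: "('a::topological_space \<Rightarrow> 'a) \<Rightarrow> 'a \<Rightarrow> 'a set" where
  "omega_limit g x = (\<Inter>k::nat. closure (\<Union>l\<in>{k..}. {(g ^^ l) x}))"

definition attractor :: "'a::topological_space measure \<Rightarrow> ('a \<Rightarrow> 'a) \<Rightarrow> 'a set \<Rightarrow> bool" where
  "attractor \<mu> g A \<longleftrightarrow>
     compact A \<and> A \<subseteq> space \<mu> \<and> emeasure \<mu> {x \<in> space \<mu>. omega_limit g x = A} > 0"

definition basin :: "'a::topological_space measure \<Rightarrow> ('a \<Rightarrow> 'a) \<Rightarrow> 'a set \<Rightarrow> 'a set" where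
  "basin \<mu> g A = {x \<in> space \<mu>. omega_limit g x \<subseteq> A}"

definition intermingled :: "'a::topological_space measure \<Rightarrow> 'a set set \<Rightarrow> bool" where
  "intermingled \<mu> \<B> \<longleftrightarrow>
     (\<forall>W. openin (top_of_set (space \<mu>)) W \<longrightarrow>
        (\<forall>P\<in>\<B>. \<forall>Q\<in>\<B>. emeasure \<mu> (W \<inter> P) > 0 \<longrightarrow> emeasure \<mu> (W \<inter> Q) > 0))"


section \<open>The annulus\<close>

quotient_type circle = real / "\<lambda>x y::real. x - y \<in> \<int>"
proof (rule equivpI)
  show "reflp (\<lambda>x y::real. x - y \<in> \<int>)"
    by (simp add: reflp_def)
  show "symp (\<lambda>x y::real. x - y \<in> \<int>)"
    by (rule sympI) (metis Ints_minus minus_diff_eq)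
  show "transp (\<lambda>x y::real. x - y \<in> \<int>)"
  proof (rule transpI)
    fix x y z :: real
    assume "x - y \<in> \<int>" "y - z \<in> \<int>"
    then have "(x - y) + (y - z) \<in> \<int>" by (rule Ints_add)
    then show "x - z \<in> \<int>" by simp
  qed
qed

text \<open>The quotient topology.\<close>

instantiation circle :: topological_space
begin

definition open_circle :: "circle set \<Rightarrow> bool" where
  "open_circle U \<longleftrightarrow> open (abs_circle -` U)"

instance
  by standard (auto simp: open_circle_def vimage_Union)

end

definition annulus :: "(circle \<times> real) set" where
  "annulus = UNIV \<times> {0..1}"

definition annulus_boundary :: "(circle \<times> real) set" where
  "annulus_boundary = UNIV \<times> {0, 1}"

definition strip :: "(real \<times> real) set" where
  "strip = UNIV \<times> {0..1}"

definition covering :: "real \<times> real \<Rightarrow> circle \<times> real" where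
  "covering z = (abs_circle (fst z), snd z)"

text \<open>Two-dimensional Lebesgue measure on the Borel subsets of the annulus, transported from the
  fundamental domain \<open>[0,1) \<times> [0,1]\<close>, which \<open>covering\<close> maps bijectively onto the annulus.\<close>

definition annulus_measure :: "(circle \<times> real) measure" where
  "annulus_measure = distr (lebesgue_on ({0..<1} \<times> {0..1})) (restrict_space borel annulus) covering"

lemma continuous_on_abs_circle: "continuous_on UNIV abs_circle"
  unfolding continuous_on_open_vimage[OF open_UNIV] by (simp add: open_circle_def)

lemma continuous_on_covering: "continuous_on UNIV covering"
  unfolding covering_def
  by (intro continuous_on_Pair continuous_on_snd continuous_on_id
        continuous_on_compose2[OF continuous_on_abs_circle continuous_on_fst]) auto

lemma measurable_covering:
  "covering \<in> lebesgue_on ({0..<1} \<times> {0..1}) \<rightarrow>\<^sub>M restrict_space borel annulus"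
proof (rule measurable_restrict_space2)
  show "covering \<in> space (lebesgue_on ({0..<1} \<times> {0..1})) \<rightarrow> annulus"
    by (auto simp: space_restrict_space covering_def annulus_def)
  have "covering \<in> borel \<rightarrow>\<^sub>M borel"
    by (rule borel_measurable_continuous_onI[OF continuous_on_covering])
  then show "covering \<in> lebesgue_on ({0..<1} \<times> {0..1}) \<rightarrow>\<^sub>M borel"
    by (intro measurable_restrict_space1 measurable_completion) simp
qed

lemma space_annulus_measure: "space annulus_measure = annulus"
  by (simp add: annulus_measure_def space_restrict_space)

lemma emeasure_annulus_measure:
  assumes "E \<in> sets borel" "E \<subseteq> annulus"
  shows "emeasure annulus_measure E = emeasure lebesgue {z \<in> {0..<1} \<times> {0..1}. covering z \<in> E}"
proof -
  have box: "({0..<1} \<times> {0..1} :: (real \<times> real) set) \<in> sets lebesgue"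
    by (intro sets_completionI_sets) (simp add: borel_Times)
  have "E \<in> sets (restrict_space borel annulus)"
    using assms by (auto simp: sets_restrict_space)
  then have "emeasure annulus_measure E =
      emeasure (lebesgue_on ({0..<1} \<times> {0..1})) (covering -` E \<inter> ({0..<1} \<times> {0..1}))"
    unfolding annulus_measure_def
    by (subst emeasure_distr[OF measurable_covering]) (auto simp: space_restrict_space)
  also have "\<dots> = emeasure lebesgue (covering -` E \<inter> ({0..<1} \<times> {0..1}))"
    using box by (subst emeasure_restrict_space) auto
  also have "covering -` E \<inter> ({0..<1} \<times> {0..1}) = {z \<in> {0..<1} \<times> {0..1}. covering z \<in> E}"
    by auto
  finally show ?thesis .
qed


section \<open>Functions of class \<open>C\<^sup>k\<close>\<close>

text \<open>All derivatives are taken within \<open>S\<close>, hence are one-sided at boundary points. They are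
  meaningful for sets such as \<^term>\<open>strip\<close>, on which derivatives within the set are unique.\<close>

primrec continuously_differentiable ::
  "nat \<Rightarrow> 'a set \<Rightarrow> ('a::real_normed_vector \<Rightarrow> 'b::real_normed_vector) \<Rightarrow> bool" where
  "continuously_differentiable 0 S f \<longleftrightarrow> continuous_on S f"
| "continuously_differentiable (Suc r) S f \<longleftrightarrow>
     (\<forall>z\<in>S. f differentiable (at z within S)) \<and>
     (\<forall>v. continuously_differentiable r S (\<lambda>z. frechet_derivative f (at z within S) v))"

primrec iterated_derivative ::
  "'a set \<Rightarrow> 'a list \<Rightarrow> ('a::real_normed_vector \<Rightarrow> 'b::real_normed_vector) \<Rightarrow> 'a \<Rightarrow> 'b" where
  "iterated_derivative S [] f = f"
| "iterated_derivative S (v # vs) f =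
     iterated_derivative S vs (\<lambda>z. frechet_derivative f (at z within S) v)"

definition partial_indices :: "nat \<Rightarrow> 'a::euclidean_space list set" where
  "partial_indices r = {vs. set vs \<subseteq> Basis \<and> length vs = r}"

definition hoelder_on ::
  "real \<Rightarrow> 'a set \<Rightarrow> ('a::metric_space \<Rightarrow> 'b::metric_space) \<Rightarrow> bool" where
  "hoelder_on \<beta> S f \<longleftrightarrow> (\<exists>C. \<forall>p\<in>S. \<forall>q\<in>S. dist (f p) (f q) \<le> C * dist p q powr \<beta>)"

definition hoelder_seminorm ::
  "real \<Rightarrow> 'a set \<Rightarrow> ('a::metric_space \<Rightarrow> 'b::metric_space) \<Rightarrow> ennreal" where
  "hoelder_seminorm \<beta> S f =
     (SUP (p, q) \<in> {(p, q). p \<in> S \<and> q \<in> S \<and> p \<noteq> q}. ennreal (dist (f p) (f q) / dist p q powr \<beta>))"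

definition Ck_on ::
  "real \<Rightarrow> 'a set \<Rightarrow> ('a::euclidean_space \<Rightarrow> 'b::real_normed_vector) \<Rightarrow> bool" where
  "Ck_on k S f \<longleftrightarrow>
     continuously_differentiable (nat \<lfloor>k\<rfloor>) S f \<and>
     (k \<notin> \<int> \<longrightarrow>
       (\<forall>vs\<in>partial_indices (nat \<lfloor>k\<rfloor>). hoelder_on (frac k) S (iterated_derivative S vs f)))"

definition Ck_norm ::
  "real \<Rightarrow> 'a set \<Rightarrow> ('a::euclidean_space \<Rightarrow> 'b::real_normed_vector) \<Rightarrow> ennreal" where
  "Ck_norm k S f =
     (SUP vs \<in> (\<Union>i\<in>{..nat \<lfloor>k\<rfloor>}. partial_indices i).
        SUP z\<in>S. ennreal (norm (iterated_derivative S vs f z))) +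
     (if k \<in> \<int> then 0
      else SUP vs \<in> partial_indices (nat \<lfloor>k\<rfloor>).
        hoelder_seminorm (frac k) S (iterated_derivative S vs f))"


section \<open>The space of \<open>C\<^sup>k\<close> maps of the annulus\<close>

text \<open>Smoothness is tested on lifts: \<^term>\<open>covering\<close> is a local diffeomorphism of the simply
  connected \<^term>\<open>strip\<close> onto the annulus, so every continuous map of the annulus has a lift.
  For \<open>k \<ge> 1\<close> the derivatives of a lift that enter the Hoelder conditions are periodic, so that
  Hoelder bounds on the whole strip and on a fundamental domain amount to the same.\<close>

definition is_lift :: "(real \<times> real \<Rightarrow> real \<times> real) \<Rightarrow> (circle \<times> real \<Rightarrow> circle \<times> real) \<Rightarrow> bool" where
  "is_lift G g \<longleftrightarrow> continuous_on strip G \<and> (\<forall>z\<in>strip. covering (G z) = g (covering z))"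

definition Ck_boundary_maps :: "real \<Rightarrow> (circle \<times> real \<Rightarrow> circle \<times> real) set" where
  "Ck_boundary_maps k =
     {g \<in> annulus \<rightarrow>\<^sub>E annulus.
        g ` annulus_boundary \<subseteq> annulus_boundary \<and> (\<exists>G. is_lift G g \<and> Ck_on k strip G)}"

text \<open>Lifts of maps of different degrees are at infinite distance; lifts of maps of equal degree
  differ by a periodic function, and two lifts of one map by an integer translation of the first
  coordinate.\<close>

definition Ck_dist ::
  "real \<Rightarrow> (circle \<times> real \<Rightarrow> circle \<times> real) \<Rightarrow> (circle \<times> real \<Rightarrow> circle \<times> real) \<Rightarrow> ennreal" where
  "Ck_dist k g h =
     (INF (G, H) \<in> {(G, H). is_lift G g \<and> is_lift H h}. Ck_norm k strip (\<lambda>z. G z - H z))"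

definition Ck_open :: "real \<Rightarrow> (circle \<times> real \<Rightarrow> circle \<times> real) set \<Rightarrow> bool" where
  "Ck_open k U \<longleftrightarrow>
     U \<subseteq> Ck_boundary_maps k \<and>
     (\<forall>g\<in>U. \<exists>\<epsilon>>0. \<forall>h\<in>Ck_boundary_maps k. Ck_dist k g h < \<epsilon> \<longrightarrow> h \<in> U)"

definition Ck_topology :: "real \<Rightarrow> (circle \<times> real \<Rightarrow> circle \<times> real) topology" where
  "Ck_topology k = topology (Ck_open k)"

lemma istopology_Ck_open: "istopology (Ck_open k)"
  unfolding istopology_def
proof (intro conjI allI impI)
  fix U V assume UV: "Ck_open k U" "Ck_open k V"
  show "Ck_open k (U \<inter> V)"
    unfolding Ck_open_def
  proof (intro conjI ballI)
    show "U \<inter> V \<subseteq> Ck_boundary_maps k"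
      using UV by (auto simp: Ck_open_def)
    fix g assume g: "g \<in> U \<inter> V"
    obtain d where "d > 0" "\<forall>h\<in>Ck_boundary_maps k. Ck_dist k g h < d \<longrightarrow> h \<in> U"
      using UV(1) g unfolding Ck_open_def by blast
    moreover obtain e where "e > 0" "\<forall>h\<in>Ck_boundary_maps k. Ck_dist k g h < e \<longrightarrow> h \<in> V"
      using UV(2) g unfolding Ck_open_def by blast
    ultimately show "\<exists>\<epsilon>>0. \<forall>h\<in>Ck_boundary_maps k. Ck_dist k g h < \<epsilon> \<longrightarrow> h \<in> U \<inter> V"
      by (intro exI[of _ "min d e"]) simp
  qed
next
  fix \<K> assume K: "\<forall>K\<in>\<K>. Ck_open k K"
  show "Ck_open k (\<Union>\<K>)"
    unfolding Ck_open_def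
  proof (intro conjI ballI)
    show "\<Union>\<K> \<subseteq> Ck_boundary_maps k"
      using K unfolding Ck_open_def by blast
    fix g assume "g \<in> \<Union>\<K>"
    then obtain K where "K \<in> \<K>" "g \<in> K" by blast
    moreover from this obtain e where
      "e > 0" "\<forall>h\<in>Ck_boundary_maps k. Ck_dist k g h < e \<longrightarrow> h \<in> K"
      using K unfolding Ck_open_def by blast
    ultimately show "\<exists>\<epsilon>>0. \<forall>h\<in>Ck_boundary_maps k. Ck_dist k g h < \<epsilon> \<longrightarrow> h \<in> \<Union>\<K>"
      by blast
  qed
qed

lemma openin_Ck_topology: "openin (Ck_topology k) U \<longleftrightarrow> Ck_open k U"
  by (simp add: Ck_topology_def topology_inverse'[OF istopology_Ck_open])

end

theory Submission
  imports Defs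
begin

text \<open>The open set is a ball around Kan's map
  \<open>(x, t) \<mapsto> (N x, t + t (1 - t) cos (2\<pi>x) / 8)\<close>, and the attractors of every map in the ball are the two
  boundary circles. Near each circle the height of a point is multiplied by a factor that is below
  one over half of the circle and above one over the other half; by concavity of the logarithm the
  contraction prevails on average, so that both circles attract a set of positive measure. A point
  at any height can nevertheless be pushed close to either circle by letting its angle
  stay for a while where the cosine has the right sign, and therefore the basins are intermingled.

  The proof looks at one horizontal segment at a time and returns to two dimensions by Fubini. Let
  \<open>(X n x, T n x)\<close> be the \<open>n\<close>-th image of the point \<open>x\<close> of the segment. The segment is stretched
  along nearly horizontal curves, and what matters are the subintervals on which \<open>X n\<close> makes exactly
  one turn of the circle. As \<open>k > 1\<close>, the first derivatives of the map are Hoelder continuous with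
  some exponent \<open>\<beta>\<close>, with a bound that is uniform over the ball; the logarithms of \<open>T n\<close>, of
  \<open>1 - T n\<close> and of the derivative of \<open>X n\<close> are sums of Hoelder functions along the orbit, the older
  terms of which are damped by powers of \<open>N powr \<beta>\<close>. Since \<open>N\<close> is chosen after \<open>\<beta>\<close>, these logarithms
  are almost constant over one turn (\<open>ln_D_variation\<close>, \<open>ln_T_variation\<close>), and integrals over a turn
  may be computed as if \<open>X n\<close> were uniformly distributed.

  This is applied to \<open>W = sqrt (t (1 - t))\<close>. For Kan's map with an amplitude \<open>c\<close> instead of \<open>1/8\<close>,
  the factor by which \<open>W\<close> changes in one step has the average \<open>1 - c\<^sup>2/16\<close> over a turn, up to higher
  order in \<open>c\<close>, at every height: the second order
  terms \<open>- c\<^sup>2 t (1 - t) / 4\<close> and \<open>- c\<^sup>2 (1 - 2 t)\<^sup>2 / 16\<close> add up to a constant. So the integral of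
  \<open>W\<close> over a turn contracts by a fixed factor (\<open>W_contracts\<close>). Almost everywhere \<open>W\<close> is thus summable along
  the orbit, and because a step changes the height by at most \<open>W / 4\<close>, the heights converge, to \<open>0\<close>
  or \<open>1\<close> (\<open>AE_T_limit\<close>): together the basins have full measure. Moreover the mean total change of height
  of a one-turn piece that lies close to a circle is small, so that a set of positive measure
  converges to that circle (\<open>not_AE_limit_far\<close>), and every segment contains a piece that is carried
  close to the circle of our choice (\<open>one_turn_near_boundary\<close>). The same averaging argument, for the
  product of \<open>1 - f\<close> along the orbit with a bump function \<open>f\<close>, shows that almost every orbit
  visits every arc infinitely often (\<open>AE_visits_arc\<close>); the limit set is then the whole circle.

  What remains concerns the \<open>C\<^sup>k\<close> topology: balls are open because lifts of a map are unique up to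
  integer translations (\<open>Ck_ball_open\<close>), Kan's map is smooth, and closeness in the \<open>C\<^sup>k\<close> norm gives the
  uniform bounds on first derivatives and their Hoelder constants (\<open>near_kan_if_Ck_close\<close>).\<close>


section \<open>Maps close to Kan's map\<close>

text \<open>All that the dynamical part uses of a lift \<open>(F, G)\<close>: it stretches angles by about \<open>N\<close>, both boundary
  lines are invariant, and the derivatives satisfy a Hoelder condition along directions of slope at
  most one. Only \<open>Gt\<close>, which decides about attraction, has to be very close to Kan's map. Nothing
  ties \<open>F\<close> itself to \<open>N x\<close>, which makes the conditions insensitive to integer translations of the
  lift. The bound \<open>10\<^sup>7\<close> leaves room for the numerical margins in the contraction of \<open>W\<close>; as \<open>\<beta>\<close> may be small, it is a condition on \<open>N powr \<beta>\<close>.\<close>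

locale near_kan =
  fixes F G Fx Ft Gx Gt :: "real \<Rightarrow> real \<Rightarrow> real" and N \<beta> :: real
  assumes exponent: "0 < \<beta>" "\<beta> \<le> 1"
    and N_pos: "0 < N" and expansion: "10000000 \<le> (N / 2) powr \<beta>"
    and F_deriv: "\<And>x t. 0 \<le> t \<Longrightarrow> t \<le> 1 \<Longrightarrow>
      ((\<lambda>z. F (fst z) (snd z)) has_derivative (\<lambda>v. Fx x t * fst v + Ft x t * snd v))
        (at (x, t) within strip)"
    and G_deriv: "\<And>x t. 0 \<le> t \<Longrightarrow> t \<le> 1 \<Longrightarrow>
      ((\<lambda>z. G (fst z) (snd z)) has_derivative (\<lambda>v. Gx x t * fst v + Gt x t * snd v))
        (at (x, t) within strip)"
    and Fx_near: "\<And>x t. 0 \<le> t \<Longrightarrow> t \<le> 1 \<Longrightarrow> \<bar>Fx x t - N\<bar> \<le> 1"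
    and Ft_small: "\<And>x t. 0 \<le> t \<Longrightarrow> t \<le> 1 \<Longrightarrow> \<bar>Ft x t\<bar> \<le> 1"
    and Gx_small: "\<And>x t. 0 \<le> t \<Longrightarrow> t \<le> 1 \<Longrightarrow> \<bar>Gx x t\<bar> \<le> 1"
    and Gt_near: "\<And>x t. 0 \<le> t \<Longrightarrow> t \<le> 1 \<Longrightarrow>
      \<bar>Gt x t - (1 + (1 - 2 * t) * cos (2 * pi * x) / 8)\<bar> \<le> 1 / 200000"
    and G_0: "\<And>x. G x 0 = 0" and G_1: "\<And>x. G x 1 = 1"
    and hoelder: "\<And>P x t x' t'. P \<in> {Fx, Ft, Gx, Gt} \<Longrightarrow> 0 \<le> t \<Longrightarrow> t \<le> 1 \<Longrightarrow> 0 \<le> t' \<Longrightarrow> t' \<le> 1 \<Longrightarrow>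
      \<bar>t - t'\<bar> \<le> \<bar>x - x'\<bar> \<Longrightarrow> \<bar>x - x'\<bar> \<le> 1 \<Longrightarrow> \<bar>P x t - P x' t'\<bar> \<le> 3 * \<bar>x - x'\<bar> powr \<beta>"
begin

lemma N_large: "N \<ge> 20000000"
proof -
  have "1 \<le> N / 2"
  proof (rule ccontr)
    assume "\<not> 1 \<le> N / 2"
    then have "N / 2 < 1" by simp
    then have "(N / 2) powr \<beta> \<le> 1"
      using exponent N_pos powr_mono2[of \<beta> "N / 2" 1] by simp
    with expansion show False by simp
  qed
  then have "(N / 2) powr \<beta> \<le> (N / 2) powr 1"
    using exponent by (intro powr_mono) auto
  with expansion \<open>1 \<le> N / 2\<close> show ?thesis by simp
qed

lemma G_deriv_t:
  assumes "0 \<le> t" "t \<le> 1"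
  shows "(G x has_real_derivative Gt x t) (at t within {0..1})"
proof -
  have g: "((\<lambda>s. (x, s)) has_derivative (\<lambda>h. (0, h))) (at t within {0..1})"
    by (auto intro!: derivative_eq_intros)
  have "((\<lambda>s. G (fst (x, s)) (snd (x, s))) has_derivative
      (\<lambda>h. Gx x t * fst (0, h) + Gt x t * snd (0::real, h))) (at t within {0..1})"
    using has_derivative_in_compose[OF g, of "\<lambda>z. G (fst z) (snd z)"
        "\<lambda>v. Gx x t * fst v + Gt x t * snd v"]
      has_derivative_subset[OF G_deriv[OF assms], of "Pair x ` {0..1}"]
    by (auto simp: strip_def)
  then show ?thesis by (simp add: has_field_derivative_def)
qed

text \<open>The analogue of \<open>cos (2 \<pi> x) / 8\<close>. Dividing by \<open>t (1 - t)\<close> shows in one formula that \<open>t\<close> and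
  \<open>1 - t\<close> change by the factors \<open>1 + (1 - t) b\<close> and \<open>1 - t b\<close> (\<open>G_bias\<close>).\<close>

definition bias :: "real \<Rightarrow> real \<Rightarrow> real" where
  "bias x t = (G x t - t) / (t * (1 - t))"

text \<open>The difference to Kan's map vanishes at both ends of the fibre and has a small derivative in
  \<open>t\<close>; so it is small compared with \<open>min t (1 - t)\<close>, hence compared with \<open>t (1 - t)\<close>.\<close>

lemma bias_near:
  assumes t: "0 < t" "t < 1"
  shows "\<bar>bias x t - cos (2 * pi * x) / 8\<bar> \<le> 1 / 100000"
proof -
  let ?e = "1 / 200000 :: real"
  define E where "E s = G x s - (s + s * (1 - s) * (cos (2 * pi * x) / 8))" for s
  define E' where "E' s = Gt x s - (1 + (1 - 2 * s) * cos (2 * pi * x) / 8)" for s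
  have dE: "(E has_real_derivative E' s) (at s within {0..1})" if "0 \<le> s" "s \<le> 1" for s
    unfolding E_def E'_def
    by (rule derivative_eq_intros G_deriv_t that refl)+ (simp add: algebra_simps)
  have lip: "\<bar>E s - E s'\<bar> \<le> ?e * \<bar>s - s'\<bar>" if "s \<in> {0..1}" "s' \<in> {0..1}" for s s'
    using field_differentiable_bound[of "{0..1}" E E' ?e s' s] dE Gt_near that
    by (auto simp: E'_def abs_minus_commute)
  have E01: "E 0 = 0" "E 1 = 0" by (simp_all add: E_def G_0 G_1)
  have "\<bar>E t\<bar> \<le> ?e * t" "\<bar>E t\<bar> \<le> ?e * (1 - t)"
    using lip[of t 0] lip[of t 1] t E01 by auto
  have "\<bar>E t\<bar> \<le> 2 * ?e * (t * (1 - t))"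
  proof (cases "t \<le> 1 / 2")
    case True
    then have "t * (1 / 2) \<le> t * (1 - t)" using t by (intro mult_left_mono) auto
    with \<open>\<bar>E t\<bar> \<le> ?e * t\<close> show ?thesis by linarith
  next
    case False
    then have "(1 / 2) * (1 - t) \<le> t * (1 - t)" using t by (intro mult_right_mono) auto
    with \<open>\<bar>E t\<bar> \<le> ?e * (1 - t)\<close> show ?thesis by linarith
  qed
  moreover have "bias x t - cos (2 * pi * x) / 8 = E t / (t * (1 - t))"
    using t by (simp add: bias_def E_def field_simps)
  moreover have "0 < t * (1 - t)" using t by simp
  ultimately show ?thesis by (simp only: abs_divide abs_of_pos pos_divide_le_eq)
qed

lemma bias_le: "0 < t \<Longrightarrow> t < 1 \<Longrightarrow> \<bar>bias x t\<bar> \<le> 1 / 4"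
  using bias_near[of t x] abs_cos_le_one[of "2 * pi * x"] by linarith

lemma G_bias:
  assumes "0 < t" "t < 1"
  shows "G x t = t * (1 + (1 - t) * bias x t)" "1 - G x t = (1 - t) * (1 - t * bias x t)"
  using assms by (simp_all add: bias_def field_simps)

lemma bias_factors:
  assumes "0 < t" "t < 1"
  shows "3 / 4 \<le> 1 + (1 - t) * bias x t" "3 / 4 \<le> 1 - t * bias x t"
proof -
  have "\<bar>(1 - t) * bias x t\<bar> \<le> 1 * (1 / 4)" "\<bar>t * bias x t\<bar> \<le> 1 * (1 / 4)"
    unfolding abs_mult using bias_le[OF assms, of x] assms by (intro mult_mono; auto)+
  then show "3 / 4 \<le> 1 + (1 - t) * bias x t" "3 / 4 \<le> 1 - t * bias x t" by linarith+
qed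

lemma G_in:
  assumes "0 < t" "t < 1"
  shows "0 < G x t" "G x t < 1"
proof -
  show "0 < G x t" using G_bias(1)[OF assms, of x] bias_factors(1)[OF assms, of x] assms by simp
  have "0 < 1 - G x t" using G_bias(2)[OF assms, of x] bias_factors(2)[OF assms, of x] assms
    by (metis diff_gt_0_iff_gt less_le_trans mult_pos_pos zero_less_divide_iff zero_less_numeral)
  then show "G x t < 1" by simp
qed

lemma quotient_ge:
  assumes t: "0 < t" "t < 1" and c: "c = 0 \<or> c = 1"
  shows "3 / 4 \<le> (G x t - c) / (t - c)"
proof -
  have "(G x t - c) / (t - c) = (if c = 0 then 1 + (1 - t) * bias x t else 1 - t * bias x t)"
    using t c by (auto simp: bias_def field_simps)
  then show ?thesis using bias_factors[OF t, of x] by simp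
qed

text \<open>The factor by which the distance to the boundary circle at height \<open>c\<close> changes inherits the Hoelder
  condition of \<open>Gt\<close>, with the same constant, because it is the mean of \<open>Gt\<close> over the fibre between
  \<open>c\<close> and \<open>t\<close>.\<close>

lemma quotient_hoelder:
  assumes t: "0 < t" "t < 1" "0 < t'" "t' < 1" and d: "\<bar>t - t'\<bar> \<le> \<bar>x - x'\<bar>" "\<bar>x - x'\<bar> \<le> 1"
    and c: "c = 0 \<or> c = 1"
  shows "\<bar>(G x t - c) / (t - c) - (G x' t' - c) / (t' - c)\<bar> \<le> 3 * \<bar>x - x'\<bar> powr \<beta>"
proof -
  let ?C = "3 * \<bar>x - x'\<bar> powr \<beta>"
  define path where "path r s = (1 - s) * c + s * r" for r s :: real
  \<comment> \<open>\<open>u\<close> starts at zero, since \<open>G x c = c\<close>, and its derivative is a difference of values of \<open>Gt\<close>.\<close>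
  define u where "u s = (G x (path t s) - c) / (t - c) - (G x' (path t' s) - c) / (t' - c)" for s
  define u' where "u' s = Gt x (path t s) - Gt x' (path t' s)" for s
  have path_in: "path r s \<in> {0..1}" if "0 < r" "r < 1" "s \<in> {0..1}" for r s
    using that c convex_bound_le[of c 1 r "1 - s" s] by (auto simp: path_def)
  have deriv: "((\<lambda>s. (G y (path r s) - c) / (r - c)) has_real_derivative Gt y (path r s)) (at s within {0..1})"
    if "0 < r" "r < 1" "s \<in> {0..1}" for y r s
  proof -
    have "(G y has_real_derivative Gt y (path r s)) (at (path r s) within path r ` {0..1})"
      using path_in that by (intro DERIV_subset[OF G_deriv_t]) auto
    moreover have "(path r has_real_derivative r - c) (at s within {0..1})"
      unfolding path_def by (auto intro!: derivative_eq_intros)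
    ultimately have "((\<lambda>s. G y (path r s)) has_real_derivative Gt y (path r s) * (r - c)) (at s within {0..1})"
      by (rule DERIV_image_chain[unfolded o_def])
    from DERIV_cdivide[OF DERIV_diff[OF this DERIV_const[of c]], of "r - c"] show ?thesis
      using that c by auto
  qed
  have "(u has_real_derivative u' s) (at s within {0..1})" if "s \<in> {0..1}" for s
    unfolding u_def u'_def using t that by (intro DERIV_diff deriv) auto
  moreover have "\<bar>u' s\<bar> \<le> ?C" if s: "s \<in> {0..1}" for s
  proof -
    have "path t s - path t' s = s * (t - t')" by (simp add: path_def algebra_simps)
    then have "\<bar>path t s - path t' s\<bar> = s * \<bar>t - t'\<bar>" using s by (simp add: abs_mult)
    also have "\<dots> \<le> 1 * \<bar>t - t'\<bar>" using s by (intro mult_right_mono) auto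
    finally show ?thesis
      unfolding u'_def using path_in[of t s] path_in[of t' s] s t d by (intro hoelder) auto
  qed
  ultimately have "\<bar>u 1 - u 0\<bar> \<le> ?C * \<bar>1 - 0\<bar>"
    using field_differentiable_bound[of "{0..1}" u u' ?C 0 1] by auto
  moreover have "u 0 = 0" using c by (auto simp: u_def path_def G_0 G_1)
  moreover have "u 1 = (G x t - c) / (t - c) - (G x' t' - c) / (t' - c)" by (simp add: u_def path_def)
  ultimately show ?thesis by simp
qed

end

section \<open>Distortion along horizontal lines\<close>

lemma abs_ln_diff_le:
  fixes a b m :: real
  assumes "0 < m" "m \<le> a" "m \<le> b"
  shows "\<bar>ln a - ln b\<bar> \<le> \<bar>a - b\<bar> / m"
proof -
  have aux: "ln p - ln q \<le> \<bar>p - q\<bar> / m" if "m \<le> p" "m \<le> q" for p q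
  proof -
    have "ln p - ln q \<le> (p - q) / q" using that assms(1) by (intro ln_diff_le) auto
    also have "\<dots> \<le> \<bar>p - q\<bar> / m" using that assms(1) by (intro frac_le) auto
    finally show ?thesis .
  qed
  show ?thesis using aux[of a b] aux[of b a] assms by (auto simp: abs_if)
qed

lemma le_mult_of_quotient:
  fixes l d c m C p :: real
  assumes "l \<le> d / m" "d \<le> c * p" "0 \<le> p" "0 < m" "c / m \<le> C"
  shows "l \<le> C * p"
proof -
  have "l \<le> c / m * p" using assms(1) divide_right_mono[OF assms(2), of m] assms(4) by simp
  also have "\<dots> \<le> C * p" using assms by (intro mult_right_mono)
  finally show ?thesis .
qed

text \<open>The forward images of the line at height \<open>t\<^sub>0\<close>, parametrised by the initial angle \<open>x\<close>. The
  functions \<open>D n\<close> and \<open>slope n\<close> are defined by recursion along the orbit; \<open>derivs\<close> identifies them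
  with the derivative of \<open>X n\<close> and the slope of the image curve.\<close>

locale horizontal_line = near_kan +
  fixes t\<^sub>0 :: real
  assumes height: "0 < t\<^sub>0" "t\<^sub>0 < 1"
begin

primrec orbit :: "nat \<Rightarrow> real \<Rightarrow> real \<times> real" where
  "orbit 0 x = (x, t\<^sub>0)"
| "orbit (Suc n) x = (F (fst (orbit n x)) (snd (orbit n x)), G (fst (orbit n x)) (snd (orbit n x)))"

definition X :: "nat \<Rightarrow> real \<Rightarrow> real" where "X n x = fst (orbit n x)"
definition T :: "nat \<Rightarrow> real \<Rightarrow> real" where "T n x = snd (orbit n x)"

lemma X_T_simps [simp]:
  "X 0 x = x" "T 0 x = t\<^sub>0"
  "X (Suc n) x = F (X n x) (T n x)" "T (Suc n) x = G (X n x) (T n x)"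
  by (simp_all add: X_def T_def)

primrec slope :: "nat \<Rightarrow> real \<Rightarrow> real" where
  "slope 0 x = 0"
| "slope (Suc n) x = (Gx (X n x) (T n x) + Gt (X n x) (T n x) * slope n x) /
     (Fx (X n x) (T n x) + Ft (X n x) (T n x) * slope n x)"

definition stretch :: "nat \<Rightarrow> real \<Rightarrow> real" where
  "stretch n x = Fx (X n x) (T n x) + Ft (X n x) (T n x) * slope n x"

definition tilt :: "nat \<Rightarrow> real \<Rightarrow> real" where
  "tilt n x = Gx (X n x) (T n x) + Gt (X n x) (T n x) * slope n x"

primrec D :: "nat \<Rightarrow> real \<Rightarrow> real" where
  "D 0 x = 1"
| "D (Suc n) x = D n x * stretch n x"

abbreviation gap :: "nat \<Rightarrow> real \<Rightarrow> real \<Rightarrow> real" where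
  "gap n x x' \<equiv> \<bar>X n x - X n x'\<bar>"

lemma slope_Suc: "slope (Suc n) x = tilt n x / stretch n x"
  by (simp add: stretch_def tilt_def)

declare slope.simps(2) [simp del]

lemma T_in: "0 < T n x" "T n x < 1"
  by (induction n) (auto simp: height G_in)

lemma T_in': "0 \<le> T n x" "T n x \<le> 1"
  using T_in[of n x] by auto

lemma Gt_le: "0 \<le> t \<Longrightarrow> t \<le> 1 \<Longrightarrow> \<bar>Gt x t\<bar> \<le> 6 / 5"
proof -
  assume t: "0 \<le> t" "t \<le> 1"
  have "\<bar>(1 - 2 * t) * cos (2 * pi * x)\<bar> \<le> 1 * 1"
    unfolding abs_mult using t by (intro mult_mono) (auto simp: abs_if)
  then show ?thesis using Gt_near[OF t, of x] by linarith
qed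

lemma stretch_ge_aux: "\<bar>slope n x\<bar> \<le> 1 \<Longrightarrow> N - 2 \<le> stretch n x"
proof -
  assume "\<bar>slope n x\<bar> \<le> 1"
  then have "\<bar>Ft (X n x) (T n x) * slope n x\<bar> \<le> 1 * 1"
    unfolding abs_mult using Ft_small[OF T_in'] by (intro mult_mono) auto
  then show ?thesis using Fx_near[OF T_in', of "X n x" n x] unfolding stretch_def by linarith
qed

lemma tilt_le_aux: "\<bar>slope n x\<bar> \<le> 1 \<Longrightarrow> \<bar>tilt n x\<bar> \<le> 11 / 5"
proof -
  assume "\<bar>slope n x\<bar> \<le> 1"
  then have "\<bar>Gt (X n x) (T n x) * slope n x\<bar> \<le> 6 / 5 * 1"
    unfolding abs_mult using Gt_le[OF T_in'] by (intro mult_mono) auto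
  then show ?thesis using Gx_small[OF T_in', of "X n x" n x] unfolding tilt_def by linarith
qed

lemma slope_le: "\<bar>slope n x\<bar> \<le> 1"
proof (induction n)
  case (Suc n)
  have "\<bar>tilt n x\<bar> \<le> stretch n x" "0 < stretch n x"
    using stretch_ge_aux[OF Suc] tilt_le_aux[OF Suc] N_large by linarith+
  then show ?case by (simp add: slope_Suc abs_divide)
qed simp

lemma stretch_ge: "N - 2 \<le> stretch n x" by (rule stretch_ge_aux[OF slope_le])
lemma stretch_pos: "0 < stretch n x" using stretch_ge[of n x] N_large by linarith

lemma D_pos: "0 < D n x"
  by (induction n) (auto simp: stretch_pos)

lemma derivs: "(X n has_real_derivative D n x) (at x)"
  "(T n has_real_derivative slope n x * D n x) (at x)"
proof (induction n)
  case 0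
  { case 1 show ?case by (simp add: X_T_simps(1)[abs_def] DERIV_ident) next
    case 2 show ?case by (simp add: X_T_simps(2)[abs_def]) }
next
  case (Suc n)
  let ?c = "\<lambda>x. (X n x, T n x)"
  have c: "(?c has_derivative (\<lambda>h. (D n x * h, slope n x * D n x * h))) (at x)"
    using Suc by (auto intro!: has_derivative_Pair simp: has_field_derivative_def)
  have sub: "range ?c \<subseteq> strip" using T_in' by (auto simp: strip_def)
  { case 1
    have "((\<lambda>x. F (fst (?c x)) (snd (?c x))) has_derivative
      (\<lambda>h. Fx (X n x) (T n x) * fst (D n x * h, slope n x * D n x * h)
         + Ft (X n x) (T n x) * snd (D n x * h, slope n x * D n x * h))) (at x)"
      by (rule has_derivative_in_compose[OF c has_derivative_subset[OF F_deriv[OF T_in'] sub]])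
    then show ?case
      unfolding has_field_derivative_def X_T_simps(3)[abs_def] fst_conv snd_conv
      by (rule has_derivative_eq_rhs) (simp add: fun_eq_iff stretch_def algebra_simps)
  next
    case 2
    have "((\<lambda>x. G (fst (?c x)) (snd (?c x))) has_derivative
      (\<lambda>h. Gx (X n x) (T n x) * fst (D n x * h, slope n x * D n x * h)
         + Gt (X n x) (T n x) * snd (D n x * h, slope n x * D n x * h))) (at x)"
      by (rule has_derivative_in_compose[OF c has_derivative_subset[OF G_deriv[OF T_in'] sub]])
    moreover have "slope (Suc n) x * D (Suc n) x = tilt n x * D n x"
      using stretch_pos[of n x] by (simp add: slope_Suc)
    ultimately show ?case
      unfolding has_field_derivative_def X_T_simps(4)[abs_def] fst_conv snd_conv
      by (elim has_derivative_eq_rhs) (simp add: fun_eq_iff tilt_def algebra_simps) }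
qed

lemma X_cont: "continuous_on A (X n)" and T_cont: "continuous_on A (T n)"
  by (rule DERIV_continuous_on, rule has_field_derivative_at_within, rule derivs)+

lemma X_expands: "x \<le> x' \<Longrightarrow> N / 2 * (X n x' - X n x) \<le> X (Suc n) x' - X (Suc n) x"
proof -
  assume x: "x \<le> x'"
  have "X (Suc n) x - N / 2 * X n x \<le> X (Suc n) x' - N / 2 * X n x'"
  proof (rule DERIV_nonneg_imp_nondecreasing[OF x])
    fix y
    have "((\<lambda>x. X (Suc n) x - N / 2 * X n x) has_real_derivative D (Suc n) y - N / 2 * D n y) (at y)"
      by (intro DERIV_diff DERIV_cmult derivs)
    moreover have "N / 2 * D n y \<le> stretch n y * D n y"
      using stretch_ge[of n y] N_large D_pos[of n y] by (intro mult_right_mono) auto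
    then have "0 \<le> D (Suc n) y - N / 2 * D n y" by (simp add: mult.commute)
    ultimately show "\<exists>d. ((\<lambda>x. X (Suc n) x - N / 2 * X n x) has_real_derivative d) (at y) \<and> 0 \<le> d"
      by blast
  qed
  then show ?thesis by (simp add: algebra_simps)
qed

lemma X_strict_mono: "x < x' \<Longrightarrow> X n x < X n x'"
  by (rule DERIV_pos_imp_increasing) (use derivs D_pos in blast)+

lemma X_le_iff: "X n x \<le> X n x' \<longleftrightarrow> x \<le> x'"
  using X_strict_mono[of x x' n] X_strict_mono[of x' x n]
  by (cases x x' rule: linorder_cases) auto

lemma X_expands_abs: "N / 2 * gap n x x' \<le> gap (Suc n) x x'"
proof (cases "x \<le> x'")
  case True
  then show ?thesis using X_expands[OF True, of n] X_le_iff[of n x x'] X_le_iff[of "Suc n" x x']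
    by (auto simp: abs_if simp del: X_T_simps)
next
  case False
  then have "x' \<le> x" by simp
  then show ?thesis using X_expands[of x' x n] X_le_iff[of n x' x] X_le_iff[of "Suc n" x' x]
    by (auto simp: abs_if simp del: X_T_simps)
qed

lemma X_expands_iterated:
  assumes "x \<le> x'" "m \<le> n"
  shows "(N / 2) ^ (n - m) * (X m x' - X m x) \<le> X n x' - X n x"
  using assms(2)
proof (induction n rule: dec_induct)
  case (step n)
  have "(N / 2) ^ (Suc n - m) * (X m x' - X m x) = N / 2 * ((N / 2) ^ (n - m) * (X m x' - X m x))"
    using step by (simp add: Suc_diff_le)
  also have "\<dots> \<le> N / 2 * (X n x' - X n x)"
    using step N_pos by (intro mult_left_mono) auto
  also have "\<dots> \<le> X (Suc n) x' - X (Suc n) x" by (rule X_expands[OF assms(1)])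
  finally show ?case .
qed simp

lemma T_lipschitz: "\<bar>T n x - T n x'\<bar> \<le> gap n x x'"
proof -
  have aux: "\<bar>T n x - T n x'\<bar> \<le> X n x' - X n x" if x: "x \<le> x'" for x x'
  proof -
    have *: "X n x + s * T n x \<le> X n x' + s * T n x'" if s: "\<bar>s\<bar> \<le> 1" for s
    proof (rule DERIV_nonneg_imp_nondecreasing[OF x])
      fix y
      have "((\<lambda>x. X n x + s * T n x) has_real_derivative D n y + s * (slope n y * D n y)) (at y)"
        by (intro DERIV_add DERIV_cmult derivs)
      moreover have "\<bar>s * slope n y\<bar> \<le> 1 * 1"
        unfolding abs_mult using s slope_le by (intro mult_mono) auto
      then have "0 \<le> (1 + s * slope n y) * D n y" using D_pos[of n y] by (intro mult_nonneg_nonneg) auto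
      then have "0 \<le> D n y + s * (slope n y * D n y)" by (simp add: algebra_simps)
      ultimately show "\<exists>d. ((\<lambda>x. X n x + s * T n x) has_real_derivative d) (at y) \<and> 0 \<le> d"
        by blast
    qed
    show ?thesis using *[of 1] *[of "-1"] by auto
  qed
  show ?thesis using aux[of x x'] aux[of x' x] by (cases "x \<le> x'") auto
qed

lemma scale_powr: "gap n x x' powr \<beta> \<le> gap (Suc n) x x' powr \<beta> / 10000000"
proof -
  have "10000000 * gap n x x' powr \<beta> \<le> (N / 2) powr \<beta> * gap n x x' powr \<beta>"
    using expansion by (intro mult_right_mono) auto
  also have "\<dots> = (N / 2 * gap n x x') powr \<beta>"
    using N_pos by (subst powr_mult) auto
  also have "\<dots> \<le> gap (Suc n) x x' powr \<beta>"
    using X_expands_abs exponent N_pos by (intro powr_mono2) auto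
  finally show ?thesis by simp
qed

lemma close_Suc: "gap (Suc n) x x' \<le> 1 \<Longrightarrow> gap n x x' \<le> 1"
proof -
  assume c: "gap (Suc n) x x' \<le> 1"
  have "1 * gap n x x' \<le> N / 2 * gap n x x'"
    using N_large by (intro mult_right_mono) auto
  also note X_expands_abs
  also note c
  finally show ?thesis by simp
qed

lemma partial_hoelder:
  assumes "P \<in> {Fx, Ft, Gx, Gt}" "gap n x x' \<le> 1"
  shows "\<bar>P (X n x) (T n x) - P (X n x') (T n x')\<bar> \<le> 3 * gap n x x' powr \<beta>"
  by (rule hoelder[OF assms(1) T_in' T_in' T_lipschitz assms(2)])

lemma linear_in_slope_hoelder:
  assumes P: "P \<in> {Fx, Ft, Gx, Gt}" "Q \<in> {Fx, Ft, Gx, Gt}" and c: "gap n x x' \<le> 1"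
    and Q: "\<bar>Q (X n x') (T n x')\<bar> \<le> 6 / 5"
    and s: "\<bar>slope n x - slope n x'\<bar> \<le> gap n x x' powr \<beta>"
  shows "\<bar>(P (X n x) (T n x) + Q (X n x) (T n x) * slope n x)
      - (P (X n x') (T n x') + Q (X n x') (T n x') * slope n x')\<bar>
    \<le> 36 / 5 * gap n x x' powr \<beta>" (is "_ \<le> _ * ?p")
proof -
  have "(P (X n x) (T n x) + Q (X n x) (T n x) * slope n x)
      - (P (X n x') (T n x') + Q (X n x') (T n x') * slope n x')
    = (P (X n x) (T n x) - P (X n x') (T n x'))
      + (Q (X n x) (T n x) - Q (X n x') (T n x')) * slope n x
      + Q (X n x') (T n x') * (slope n x - slope n x')" by (simp add: algebra_simps)
  moreover have "\<bar>(Q (X n x) (T n x) - Q (X n x') (T n x')) * slope n x\<bar> \<le> (3 * ?p) * 1"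
    unfolding abs_mult using partial_hoelder[OF P(2) c] slope_le by (intro mult_mono) auto
  moreover have "\<bar>Q (X n x') (T n x') * (slope n x - slope n x')\<bar> \<le> 6 / 5 * ?p"
    unfolding abs_mult using Q s by (intro mult_mono) auto
  ultimately show ?thesis using partial_hoelder[OF P(1) c] by linarith
qed

text \<open>The slope at the next step is a quotient whose numerator has bounded coefficients, while the
  denominator is about \<open>N\<close>; the resulting gain absorbs all new contributions.\<close>

lemma slope_hoelder:
  "gap n x x' \<le> 1 \<Longrightarrow> \<bar>slope n x - slope n x'\<bar> \<le> gap n x x' powr \<beta>"
proof (induction n)
  case (Suc n)
  let ?p = "gap n x x' powr \<beta>"
  note c = close_Suc[OF Suc.prems]
  have Ft: "\<bar>Ft (X n x') (T n x')\<bar> \<le> 6 / 5" using Ft_small[OF T_in', of "X n x'" n x'] by linarith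
  have A: "\<bar>tilt n x - tilt n x'\<bar> \<le> 36 / 5 * ?p"
    unfolding tilt_def by (rule linear_in_slope_hoelder[where P = Gx and Q = Gt, OF _ _ c Gt_le[OF T_in'[of n x']] Suc.IH[OF c]]) auto
  have B: "\<bar>stretch n x - stretch n x'\<bar> \<le> 36 / 5 * ?p"
    unfolding stretch_def by (rule linear_in_slope_hoelder[where P = Fx and Q = Ft, OF _ _ c Ft Suc.IH[OF c]]) auto
  have pos: "100 \<le> stretch n x" "100 \<le> stretch n x'"
    using stretch_ge[of n x] stretch_ge[of n x'] N_large by linarith+
  have "slope (Suc n) x - slope (Suc n) x'
      = (tilt n x - tilt n x') / stretch n x - slope (Suc n) x' * (stretch n x - stretch n x') / stretch n x"
    using pos by (simp add: slope_Suc field_simps)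
  moreover have "\<bar>(tilt n x - tilt n x') / stretch n x\<bar> \<le> (36 / 5 * ?p) / 100"
    unfolding abs_divide using A pos by (intro frac_le) auto
  moreover have "\<bar>slope (Suc n) x' * (stretch n x - stretch n x') / stretch n x\<bar> \<le> (1 * (36 / 5 * ?p)) / 100"
    unfolding abs_divide abs_mult using B pos slope_le[of "Suc n" x']
    by (intro frac_le mult_mono) auto
  ultimately have "\<bar>slope (Suc n) x - slope (Suc n) x'\<bar> \<le> ?p"
    using powr_ge_zero[of "gap n x x'" \<beta>] by linarith
  also have "\<dots> \<le> gap (Suc n) x x' powr \<beta>"
    using scale_powr[of n x x'] powr_ge_zero[of "gap (Suc n) x x'" \<beta>] by linarith
  finally show ?case .
qed simp

text \<open>A sum along the orbit of functions with Hoelder constant \<open>C\<close> has, as a function of the last angle,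
  a Hoelder constant of about \<open>C\<close> times a geometric series in \<open>10\<^sup>-\<^sup>7\<close> without its leading term: even
  the most recent summand is measured at distances that have been stretched once since. Here lies the
  smallness on which the averaging argument depends.\<close>

lemma cocycle_hoelder:
  assumes L: "\<And>x. L 0 x = L\<^sub>0" "\<And>n x. L (Suc n) x = L n x + l n x"
    and l: "\<And>n x x'. gap n x x' \<le> 1 \<Longrightarrow> \<bar>l n x - l n x'\<bar> \<le> C * gap n x x' powr \<beta>"
    and C: "0 \<le> C"
  shows "gap n x x' \<le> 1 \<Longrightarrow> \<bar>L n x - L n x'\<bar> \<le> C / 5000000 * gap n x x' powr \<beta>"
proof (induction n)
  case 0
  then show ?case using C by (simp add: L(1))
next
  case (Suc n)
  let ?p = "gap n x x' powr \<beta>"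
  note c = close_Suc[OF Suc.prems]
  have "\<bar>L (Suc n) x - L (Suc n) x'\<bar> \<le> \<bar>L n x - L n x'\<bar> + \<bar>l n x - l n x'\<bar>"
    by (simp add: L(2))
  also have "\<dots> \<le> C / 5000000 * ?p + C * ?p" by (intro add_mono Suc.IH l c)
  also have "\<dots> \<le> (2 * C) * ?p" using C by (simp add: mult_right_mono)
  also have "\<dots> \<le> (2 * C) * (gap (Suc n) x x' powr \<beta> / 10000000)"
    by (rule mult_left_mono[OF scale_powr]) (use C in auto)
  finally show ?case by simp
qed

lemma cocycle_variation:
  assumes L: "\<And>x. L 0 x = L\<^sub>0" "\<And>n x. L (Suc n) x = L n x + l n x"
    and l: "\<And>n x x'. gap n x x' \<le> 1 \<Longrightarrow> \<bar>l n x - l n x'\<bar> \<le> C * gap n x x' powr \<beta>"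
    and C: "0 \<le> C" and c: "gap n x x' \<le> 1"
  shows "\<bar>L n x - L n x'\<bar> \<le> C / 5000000"
proof -
  have "\<bar>L n x - L n x'\<bar> \<le> C / 5000000 * gap n x x' powr \<beta>"
    by (rule cocycle_hoelder[where L\<^sub>0 = L\<^sub>0, OF L l C c])
  also have "\<dots> \<le> C / 5000000 * 1 powr \<beta>"
    using C c exponent by (intro mult_left_mono powr_mono2) auto
  finally show ?thesis by simp
qed

lemma ln_D_variation:
  assumes "gap n x x' \<le> 1"
  shows "\<bar>ln (D n x) - ln (D n x')\<bar> \<le> 1 / 1000000"
proof -
  have "\<bar>ln (D n x) - ln (D n x')\<bar> \<le> 5 / 5000000"
  proof (rule cocycle_variation[where L = "\<lambda>n x. ln (D n x)" and L\<^sub>0 = 0 and l = "\<lambda>n x. ln (stretch n x)"])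
    fix n x x' assume c: "gap n x x' \<le> 1"
    let ?p = "gap n x x' powr \<beta>"
    have Ft: "\<bar>Ft (X n x') (T n x')\<bar> \<le> 6 / 5" using Ft_small[OF T_in', of "X n x'" n x'] by linarith
    have B: "\<bar>stretch n x - stretch n x'\<bar> \<le> 36 / 5 * ?p"
      unfolding stretch_def by (rule linear_in_slope_hoelder[where P = Fx and Q = Ft, OF _ _ c Ft slope_hoelder[OF c]]) auto
    have A: "\<bar>ln (stretch n x) - ln (stretch n x')\<bar> \<le> \<bar>stretch n x - stretch n x'\<bar> / 2"
      by (rule abs_ln_diff_le) (use stretch_ge[of n x] stretch_ge[of n x'] N_large in linarith)+
    show "\<bar>ln (stretch n x) - ln (stretch n x')\<bar> \<le> 5 * ?p"
      by (rule le_mult_of_quotient[OF A B]) auto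
  qed (use assms in \<open>auto simp: ln_mult D_pos stretch_pos less_imp_neq[symmetric] simp del: X_T_simps\<close>)
  then show ?thesis by simp
qed

lemma ln_T_variation:
  assumes c: "c = 0 \<or> c = 1" and close: "gap n x x' \<le> 1"
  shows "\<bar>ln \<bar>T n x - c\<bar> - ln \<bar>T n x' - c\<bar>\<bar> \<le> 1 / 1000000"
proof -
  let ?q = "\<lambda>n x. (G (X n x) (T n x) - c) / (T n x - c)"
  have "\<bar>ln \<bar>T n x - c\<bar> - ln \<bar>T n x' - c\<bar>\<bar> \<le> 5 / 5000000"
  proof (rule cocycle_variation[where L = "\<lambda>n x. ln \<bar>T n x - c\<bar>" and L\<^sub>0 = "ln \<bar>t\<^sub>0 - c\<bar>" and l = "\<lambda>n x. ln (?q n x)"])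
    fix n x
    have T: "T n x - c \<noteq> 0" using T_in[of n x] c by auto
    have q: "0 < ?q n x" using quotient_ge[OF T_in[of n x] c, of "X n x"] by linarith
    have "T (Suc n) x - c = (T n x - c) * ?q n x" using T by simp
    then have eq: "\<bar>T (Suc n) x - c\<bar> = \<bar>T n x - c\<bar> * ?q n x" using q by (simp only: abs_mult abs_of_pos)
    show "ln \<bar>T (Suc n) x - c\<bar> = ln \<bar>T n x - c\<bar> + ln (?q n x)"
      unfolding eq by (rule ln_mult_pos[OF _ q]) (use T in simp)
  next
    fix n x x' assume "gap n x x' \<le> 1"
    from le_mult_of_quotient[OF abs_ln_diff_le[OF _ quotient_ge[OF T_in c] quotient_ge[OF T_in c]]
        quotient_hoelder[OF T_in T_in T_lipschitz this c], of 5]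
    show "\<bar>ln (?q n x) - ln (?q n x')\<bar> \<le> 5 * gap n x x' powr \<beta>" by simp
  qed (use close in auto)
  then show ?thesis by simp
qed

end

section \<open>Averaging over one turn\<close>

lemma sqrt_one_plus_le:
  fixes u :: real
  assumes "\<bar>u\<bar> \<le> 2 / 5"
  shows "sqrt (1 + u) \<le> 1 + u / 2 - u\<^sup>2 / 10"
proof (rule real_le_lsqrt)
  have "u\<^sup>2 \<le> (2 / 5)\<^sup>2" using assms by (metis abs_ge_zero power2_abs power_mono)
  then show "0 \<le> 1 + u / 2 - u\<^sup>2 / 10" using assms by (simp add: power2_eq_square)
  have "(1 + u / 2 - u\<^sup>2 / 10)\<^sup>2 - (1 + u) = u\<^sup>2 * ((1 / 20 - u / 10) + u\<^sup>2 / 100)"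
    by (simp add: power2_eq_square field_simps)
  moreover have "0 \<le> u\<^sup>2 * ((1 / 20 - u / 10) + u\<^sup>2 / 100)"
    using assms by (intro mult_nonneg_nonneg add_nonneg_nonneg) auto
  ultimately show "1 + u \<le> (1 + u / 2 - u\<^sup>2 / 10)\<^sup>2" by linarith
qed

text \<open>With \<open>p = 1 - 2 t\<close>, \<open>q = t (1 - t) = (1 - p\<^sup>2) / 4\<close> and \<open>v = p - q b\<close> the radicand is \<open>1 + b v\<close>. The term
  of first order in \<open>b\<close> is kept, since it averages out; the loss of second order comes from \<open>- q b\<^sup>2\<close>
  when \<open>t\<close> is in the middle, and from the concavity of the square root when \<open>t\<close> is near the
  ends.\<close>

lemma sqrt_product_le:
  fixes t b :: real
  assumes t: "0 < t" "t < 1" and b: "\<bar>b\<bar> \<le> 1 / 4"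
  shows "sqrt ((1 + (1 - t) * b) * (1 - t * b)) \<le> 1 + (1 - 2 * t) * b / 2 - b\<^sup>2 / 20"
proof -
  define p where "p = 1 - 2 * t"
  define q where "q = t * (1 - t)"
  define v where "v = p - q * b"
  have q: "0 \<le> q" "q = (1 - p\<^sup>2) / 4" using t
    by (auto simp: p_def q_def power2_eq_square field_simps)
  then have q': "q \<le> 1 / 4" using zero_le_power2[of p] by simp
  have p: "\<bar>p\<bar> \<le> 1" using t by (auto simp: p_def)
  have qb: "\<bar>q * b\<bar> \<le> 1 / 4 * (1 / 4)" unfolding abs_mult using q(1) q' b by (intro mult_mono) auto
  have "\<bar>p * (q * b)\<bar> \<le> 1 * (1 / 16)" unfolding abs_mult[of p] using p qb by (intro mult_mono) auto
  then have "p\<^sup>2 - 1 / 8 \<le> v\<^sup>2"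
    using zero_le_power2[of "q * b"] unfolding v_def power2_diff mult.assoc[of 2] by linarith
  moreover have "p\<^sup>2 \<le> 1" using p by (simp add: abs_square_le_1)
  ultimately have "1 / 20 \<le> q / 2 + v\<^sup>2 / 10" using q(2) by (simp add: field_simps)
  then have "b\<^sup>2 * (1 / 20) \<le> b\<^sup>2 * (q / 2 + v\<^sup>2 / 10)" by (intro mult_left_mono) auto
  then have main: "1 + (b * v) / 2 - (b * v)\<^sup>2 / 10 \<le> 1 + p * b / 2 - b\<^sup>2 / 20"
  proof -
    assume "b\<^sup>2 * (1 / 20) \<le> b\<^sup>2 * (q / 2 + v\<^sup>2 / 10)"
    moreover have "b\<^sup>2 * (q / 2 + v\<^sup>2 / 10) = q * b\<^sup>2 / 2 + (b * v)\<^sup>2 / 10"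
      by (simp add: power_mult_distrib algebra_simps)
    moreover have "b * v / 2 = p * b / 2 - q * b\<^sup>2 / 2"
      by (simp add: v_def power2_eq_square field_simps)
    ultimately show ?thesis by linarith
  qed
  have "\<bar>v\<bar> \<le> 8 / 5" using p qb unfolding v_def by linarith
  then have "\<bar>b * v\<bar> \<le> 1 / 4 * (8 / 5)" unfolding abs_mult using b by (intro mult_mono) auto
  then have "sqrt (1 + b * v) \<le> 1 + (b * v) / 2 - (b * v)\<^sup>2 / 10" by (intro sqrt_one_plus_le) auto
  moreover have "(1 + (1 - t) * b) * (1 - t * b) = 1 + b * v"
    by (simp add: v_def p_def q_def power2_eq_square algebra_simps)
  ultimately show ?thesis using main by (simp add: p_def)
qed

lemma exp_minus_one_le: "0 \<le> x \<Longrightarrow> x \<le> 1 \<Longrightarrow> exp x - 1 \<le> 2 * (x::real)"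
  using exp_bound[of x] by (smt (verit) mult_left_le_one_le power2_eq_square)

lemma integral_cos_period:
  assumes "j \<noteq> (0::nat)"
  shows "integral {a..a + 1} (\<lambda>y. cos (2 * pi * real j * y)) = 0"
proof -
  let ?P = "\<lambda>y. sin (2 * pi * real j * y) / (2 * pi * real j)"
  have "((\<lambda>y. cos (2 * pi * real j * y)) has_integral ?P (a + 1) - ?P a) {a..a + 1}"
  proof (rule fundamental_theorem_of_calculus)
    fix y
    have "(?P has_real_derivative cos (2 * pi * real j * y)) (at y within {a..a + 1})"
      using assms by (auto intro!: derivative_eq_intros)
    then show "(?P has_vector_derivative cos (2 * pi * real j * y)) (at y within {a..a + 1})"
      by (simp add: has_real_derivative_iff_has_vector_derivative)
  qed simp
  moreover have "sin (2 * pi * real j * (a + 1)) = sin (2 * pi * real j * a)"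
  proof -
    have "2 * pi * real j * (a + 1) = 2 * pi * real j * a + 2 * real j * pi" by (simp add: algebra_simps)
    then show ?thesis by (simp only: sin_add sin_2npi cos_2npi mult_1_right mult_zero_right add_0_right)
  qed
  ultimately show ?thesis by (auto dest: integral_unique)
qed

context horizontal_line
begin

text \<open>Pieces of the line whose \<open>n\<close>-th image covers a full circle of angles exactly once.\<close>

definition one_turn :: "nat \<Rightarrow> real \<Rightarrow> real \<Rightarrow> bool" where
  "one_turn n p q \<longleftrightarrow> p < q \<and> X n q = X n p + 1"

lemma one_turn_close: "one_turn n p q \<Longrightarrow> x \<in> {p..q} \<Longrightarrow> x' \<in> {p..q} \<Longrightarrow> gap n x x' \<le> 1"
  using X_le_iff[of n p x] X_le_iff[of n p x'] X_le_iff[of n x q] X_le_iff[of n x' q]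
  by (auto simp: one_turn_def)

text \<open>\<open>D n\<close> is the weight under which \<open>X n\<close> is uniformly distributed over a turn.\<close>

lemma one_turn_substitution:
  assumes u: "one_turn n p q" and f: "continuous_on UNIV f"
  shows "((\<lambda>x. D n x * f (X n x)) has_integral integral {X n p..X n p + 1} f) {p..q}"
proof -
  have "((\<lambda>x. D n x *\<^sub>R f (X n x)) has_integral integral {X n p..X n q} f) {p..q}"
  proof (rule has_integral_substitution)
    show "X n ` {p..q} \<subseteq> {X n p..X n q}" using X_le_iff by auto
    show "(X n has_real_derivative D n x) (at x within {p..q})" for x
      by (rule has_field_derivative_at_within[OF derivs(1)])
  qed (use u in \<open>auto simp: one_turn_def intro: continuous_on_subset[OF f]\<close>)
  then show ?thesis using u by (simp add: one_turn_def)
qed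

lemma one_turn_weight_bounds:
  assumes w: "\<And>x. x \<in> {p..q} \<Longrightarrow> 0 < w x"
    and var: "\<And>x x'. x \<in> {p..q} \<Longrightarrow> x' \<in> {p..q} \<Longrightarrow> \<bar>ln (w x / D n x) - ln (w x' / D n x')\<bar> \<le> \<kappa>"
    and x: "x \<in> {p..q}"
  shows "exp (- \<kappa>) * (w p / D n p) * D n x \<le> w x" "w x \<le> exp \<kappa> * (w p / D n p) * D n x"
proof -
  have p: "p \<in> {p..q}" using x by auto
  have wp: "0 < w p / D n p" and wx: "0 < w x / D n x" using w[OF p] w[OF x] D_pos by simp_all
  have "ln (w x / D n x) \<le> \<kappa> + ln (w p / D n p)" "- \<kappa> + ln (w p / D n p) \<le> ln (w x / D n x)"
    using var[OF p x] by auto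
  then have "exp (ln (w x / D n x)) \<le> exp (\<kappa> + ln (w p / D n p))"
    "exp (- \<kappa> + ln (w p / D n p)) \<le> exp (ln (w x / D n x))" by (simp_all only: exp_le_cancel_iff)
  then have "w x / D n x \<le> exp \<kappa> * (w p / D n p)" "exp (- \<kappa>) * (w p / D n p) \<le> w x / D n x"
    by (simp_all only: exp_add exp_ln[OF wx] exp_ln[OF wp])
  then show "exp (- \<kappa>) * (w p / D n p) * D n x \<le> w x" "w x \<le> exp \<kappa> * (w p / D n p) * D n x"
    using D_pos[of n x] by (simp_all only: pos_le_divide_eq pos_divide_le_eq)
qed

text \<open>A weight that differs from a multiple of \<open>D n\<close> by a factor within \<open>exp (\<plusminus> \<kappa>)\<close> integrates a function
  of mean zero to almost zero.\<close>

lemma one_turn_average_zero: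
  assumes u: "one_turn n p q" and w: "continuous_on {p..q} w" "\<And>x. x \<in> {p..q} \<Longrightarrow> 0 < w x"
    and var: "\<And>x x'. x \<in> {p..q} \<Longrightarrow> x' \<in> {p..q} \<Longrightarrow> \<bar>ln (w x / D n x) - ln (w x' / D n x')\<bar> \<le> \<kappa>"
    and \<kappa>: "0 \<le> \<kappa>" "\<kappa> \<le> 1"
    and f: "continuous_on UNIV f" "\<And>y. \<bar>f y\<bar> \<le> 1" "integral {X n p..X n p + 1} f = 0"
  shows "\<bar>integral {p..q} (\<lambda>x. w x * f (X n x))\<bar> \<le> 2 * \<kappa> * integral {p..q} w"
proof -
  have pq: "p \<le> q" using u by (auto simp: one_turn_def)
  define m where "m = w p / D n p"
  have m: "0 < m" using w(2)[of p] D_pos pq by (simp add: m_def)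
  have fX: "continuous_on {p..q} (\<lambda>x. f (X n x))"
    by (rule continuous_on_compose2[OF f(1) X_cont]) auto
  have "((\<lambda>x. w x * f (X n x) - m * (D n x * f (X n x))) has_integral
      integral {p..q} (\<lambda>x. w x * f (X n x)) - m * 0) {p..q}"
    using one_turn_substitution[OF u f(1)] f(3)
    by (intro has_integral_diff has_integral_mult_right integrable_integral
        integrable_continuous_real continuous_intros w fX) auto
  then have hi: "((\<lambda>x. (w x - m * D n x) * f (X n x)) has_integral
      integral {p..q} (\<lambda>x. w x * f (X n x))) {p..q}"
    by (simp add: algebra_simps)
  have "\<bar>(w x - m * D n x) * f (X n x)\<bar> \<le> 2 * \<kappa> * w x" if x: "x \<in> {p..q}" for x
  proof -
    note b = one_turn_weight_bounds[OF w(2) var x, folded m_def]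
    have "m * D n x \<le> exp \<kappa> * w x"
      using mult_left_mono[OF b(1), of "exp \<kappa>"] by (simp flip: mult.assoc exp_add)
    moreover have "exp (- \<kappa>) * w x \<le> m * D n x"
      using mult_left_mono[OF b(2), of "exp (- \<kappa>)"] by (simp flip: mult.assoc exp_add)
    moreover have "(exp \<kappa> - 1) * w x \<le> 2 * \<kappa> * w x" "(1 - exp (- \<kappa>)) * w x \<le> 2 * \<kappa> * w x"
      using exp_minus_one_le[OF \<kappa>] exp_ge_add_one_self[of "- \<kappa>"] \<kappa> w(2)[OF x] by (intro mult_right_mono; simp)+
    ultimately have "\<bar>w x - m * D n x\<bar> \<le> w x * (2 * \<kappa>)"
      unfolding left_diff_distrib mult.commute[of "w x"] by linarith
    then have "\<bar>w x - m * D n x\<bar> * \<bar>f (X n x)\<bar> \<le> w x * (2 * \<kappa>) * 1"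
      using f(2) w(2)[OF x] \<kappa> by (intro mult_mono) auto
    then show ?thesis by (simp add: abs_mult mult.commute mult.left_commute)
  qed
  then have "norm (integral {p..q} (\<lambda>x. (w x - m * D n x) * f (X n x))) \<le> integral {p..q} (\<lambda>x. 2 * \<kappa> * w x)"
    by (intro integral_norm_bound_integral has_integral_integrable[OF hi]
        integrable_continuous_real continuous_intros w(1)) auto
  then show ?thesis using integral_unique[OF hi] by simp
qed

lemma one_turn_average_lower:
  assumes u: "one_turn n p q" and w: "continuous_on {p..q} w" "\<And>x. x \<in> {p..q} \<Longrightarrow> 0 < w x"
    and var: "\<And>x x'. x \<in> {p..q} \<Longrightarrow> x' \<in> {p..q} \<Longrightarrow> \<bar>ln (w x / D n x) - ln (w x' / D n x')\<bar> \<le> \<kappa>"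
    and f: "continuous_on UNIV f" "\<And>y. 0 \<le> f y"
  shows "exp (- 2 * \<kappa>) * integral {X n p..X n p + 1} f * integral {p..q} w
    \<le> integral {p..q} (\<lambda>x. w x * f (X n x))"
proof -
  have pq: "p \<le> q" using u by (auto simp: one_turn_def)
  define m where "m = w p / D n p"
  have m: "0 < m" using w(2)[of p] D_pos pq by (simp add: m_def)
  have fX: "continuous_on {p..q} (\<lambda>x. f (X n x))"
    by (rule continuous_on_compose2[OF f(1) X_cont]) auto
  have bounds: "exp (- \<kappa>) * m * D n x \<le> w x" "w x \<le> exp \<kappa> * m * D n x" if "x \<in> {p..q}" for x
    unfolding m_def by (rule one_turn_weight_bounds[OF w(2) var that]; assumption)+
  let ?c = "integral {X n p..X n p + 1} f"
  have one: "((\<lambda>x. D n x * 1) has_integral 1) {p..q}"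
    using one_turn_substitution[OF u, of "\<lambda>_. 1"] by simp
  have "integral {p..q} w \<le> exp \<kappa> * m * 1"
    using bounds(2)
    by (intro has_integral_le[OF integrable_integral[OF integrable_continuous_real[OF w(1)]]
          has_integral_mult_right[OF one, of "exp \<kappa> * m"]]) auto
  moreover have "0 \<le> ?c" by (intro integral_nonneg integrable_continuous_real continuous_on_subset[OF f(1)] f(2)) auto
  ultimately have "exp (- 2 * \<kappa>) * ?c * integral {p..q} w \<le> exp (- 2 * \<kappa>) * ?c * (exp \<kappa> * m * 1)"
    by (intro mult_left_mono) auto
  also have "\<dots> = exp (- \<kappa>) * m * ?c" by (simp add: mult_exp_exp mult.commute mult.left_commute)
  also have "\<dots> \<le> integral {p..q} (\<lambda>x. w x * f (X n x))"
  proof (rule has_integral_le[OF has_integral_mult_right[OF one_turn_substitution[OF u f(1)], of "exp (- \<kappa>) * m"]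
        integrable_integral[OF integrable_continuous_real]])
    show "continuous_on {p..q} (\<lambda>x. w x * f (X n x))" by (intro continuous_intros w fX)
    fix x assume "x \<in> {p..q}"
    from mult_right_mono[OF bounds(1)[OF this] f(2)[of "X n x"]]
    show "exp (- \<kappa>) * m * (D n x * f (X n x)) \<le> w x * f (X n x)" by (simp add: mult.assoc)
  qed
  finally show ?thesis .
qed

text \<open>The Lyapunov function \<open>sqrt (t (1 - t))\<close>, which vanishes on the two circles only, along the orbit.\<close>

definition W :: "nat \<Rightarrow> real \<Rightarrow> real" where
  "W n x = sqrt (T n x * (1 - T n x))"

lemma W_pos: "0 < W n x"
  using T_in[of n x] by (simp add: W_def)

lemma W_le: "W n x \<le> 1"
proof -
  have "T n x * (1 - T n x) \<le> 1 * 1" using T_in[of n x] by (intro mult_mono) auto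
  then show ?thesis by (simp add: W_def)
qed

lemma W_cont: "continuous_on A (W n)"
  unfolding W_def by (intro continuous_intros T_cont)

lemma ln_W: "ln (W n x) = (ln (T n x) + ln (1 - T n x)) / 2"
  using T_in[of n x] by (simp add: W_def ln_sqrt ln_mult)

lemma W_Suc_le:
  "W (Suc n) x \<le> W n x * (1 + (1 - 2 * T n x) * bias (X n x) (T n x) / 2 - (bias (X n x) (T n x))\<^sup>2 / 20)"
proof -
  let ?t = "T n x" and ?b = "bias (X n x) (T n x)"
  have "W (Suc n) x = sqrt ((?t * (1 + (1 - ?t) * ?b)) * ((1 - ?t) * (1 - ?t * ?b)))"
    unfolding W_def X_T_simps(4) by (subst G_bias(2)[OF T_in], subst G_bias(1)[OF T_in]) simp
  also have "\<dots> = W n x * sqrt ((1 + (1 - ?t) * ?b) * (1 - ?t * ?b))"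
    by (simp add: W_def real_sqrt_mult)
  also have "\<dots> \<le> W n x * (1 + (1 - 2 * ?t) * ?b / 2 - ?b\<^sup>2 / 20)"
    using sqrt_product_le[OF T_in bias_le[OF T_in]] W_pos[of n x] by (intro mult_left_mono) auto
  finally show ?thesis .
qed

lemma W_Suc_le_cos:
  "W (Suc n) x \<le> (1 - 189 / 1000000) * W n x
     + (W n x * (1 - T n x) * cos (2 * pi * X n x) - W n x * T n x * cos (2 * pi * X n x)) / 16
     - W n x * cos (4 * pi * X n x) / 5120"
proof -
  let ?t = "T n x" and ?b = "bias (X n x) (T n x)" and ?c = "cos (2 * pi * X n x)"
  define e where "e = ?b - ?c / 8"
  have e: "\<bar>e\<bar> \<le> 1 / 100000" unfolding e_def by (rule bias_near[OF T_in])
  have b: "?b = ?c / 8 + e" by (simp add: e_def)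
  have "\<bar>(1 - 2 * ?t) * e\<bar> \<le> 1 * (1 / 100000)"
    unfolding abs_mult using T_in[of n x] e by (intro mult_mono) auto
  moreover have "(1 - 2 * ?t) * ?b / 2 = (1 - 2 * ?t) * ?c / 16 + (1 - 2 * ?t) * e / 2"
    unfolding b by (simp add: field_simps)
  ultimately have "(1 - 2 * ?t) * ?b / 2 \<le> (1 - 2 * ?t) * ?c / 16 + 1 / 200000"
    by linarith
  \<comment> \<open>\<open>(a + e)\<^sup>2 \<ge> a\<^sup>2 / 2 - e\<^sup>2\<close> with \<open>a = cos / 8\<close>: half of the square survives the perturbation.\<close>
  moreover have "?c\<^sup>2 / 128 - e\<^sup>2 \<le> ?b\<^sup>2"
  proof -
    have "0 \<le> (?c / 8 + 2 * e)\<^sup>2" by simp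
    then show ?thesis unfolding b by (simp add: power2_eq_square algebra_simps)
  qed
  moreover have "e\<^sup>2 \<le> (1 / 100000)\<^sup>2" using e by (metis abs_ge_zero power2_abs power_mono)
  moreover have "?c\<^sup>2 = (1 + cos (4 * pi * X n x)) / 2"
    using cos_double_cos[of "2 * pi * X n x"] by (simp add: mult.assoc)
  ultimately have "1 + (1 - 2 * ?t) * ?b / 2 - ?b\<^sup>2 / 20
    \<le> (1 - 189 / 1000000) + (1 - 2 * ?t) * ?c / 16 - cos (4 * pi * X n x) / 5120"
    by (simp add: power2_eq_square)
  from order_trans[OF W_Suc_le mult_left_mono[OF this]] W_pos[of n x]
  have "W (Suc n) x \<le> W n x * ((1 - 189 / 1000000) + (1 - 2 * ?t) * ?c / 16 - cos (4 * pi * X n x) / 5120)"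
    by auto
  then show ?thesis by (simp add: algebra_simps del: X_T_simps)
qed

text \<open>Integration of \<open>W_Suc_le_cos\<close> over one turn. The weights \<open>W (1 - T)\<close>, \<open>W T\<close> and \<open>W\<close> are nearly
  proportional to \<open>D n\<close>, so that the three oscillating terms contribute almost nothing.\<close>

lemma W_contracts:
  assumes u: "one_turn n p q"
  shows "integral {p..q} (W (Suc n)) \<le> (1 - 1 / 10000) * integral {p..q} (W n)"
proof -
  let ?c1 = "\<lambda>y. cos (2 * pi * y)" and ?c2 = "\<lambda>y. cos (4 * pi * y)"
  let ?w1 = "\<lambda>x. W n x * (1 - T n x)" and ?w2 = "\<lambda>x. W n x * T n x"
  let ?k = "3 / 1000000 :: real"
  let ?I = "integral {p..q}"
  have c1: "integral {a..a + 1} ?c1 = 0" for a using integral_cos_period[of 1 a] by simp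
  have c2: "integral {a..a + 1} ?c2 = 0" for a using integral_cos_period[of 2 a] by simp
  have cont: "continuous_on {p..q} (W n)" "continuous_on {p..q} ?w1" "continuous_on {p..q} ?w2"
    by (intro continuous_intros W_cont T_cont)+
  have ccont: "continuous_on {p..q} (\<lambda>x. ?c1 (X n x))" "continuous_on {p..q} (\<lambda>x. ?c2 (X n x))"
    by (intro continuous_intros X_cont)+
  have pos: "0 < ?w1 x" "0 < ?w2 x" for x
    using W_pos T_in by auto
  have var: "\<bar>ln (W n x / D n x) - ln (W n x' / D n x')\<bar> \<le> ?k"
    "\<bar>ln (?w1 x / D n x) - ln (?w1 x' / D n x')\<bar> \<le> ?k"
    "\<bar>ln (?w2 x / D n x) - ln (?w2 x' / D n x')\<bar> \<le> ?k"
    if "x \<in> {p..q}" "x' \<in> {p..q}" for x x'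
  proof -
    note c = one_turn_close[OF u that]
    have lnT: "\<bar>ln (T n x) - ln (T n x')\<bar> \<le> 1 / 1000000"
      "\<bar>ln (1 - T n x) - ln (1 - T n x')\<bar> \<le> 1 / 1000000"
      using ln_T_variation[OF _ c, of 0] ln_T_variation[OF _ c, of 1] T_in[of n x] T_in[of n x'] by simp_all
    have eq: "ln (W n x / D n x) = ln (W n x) - ln (D n x)"
      "ln (?w1 x / D n x) = ln (W n x) + ln (1 - T n x) - ln (D n x)"
      "ln (?w2 x / D n x) = ln (W n x) + ln (T n x) - ln (D n x)" for x
      using W_pos[of n x] T_in[of n x] D_pos[of n x] by (simp_all add: ln_div ln_mult)
    show "\<bar>ln (W n x / D n x) - ln (W n x' / D n x')\<bar> \<le> ?k"
      "\<bar>ln (?w1 x / D n x) - ln (?w1 x' / D n x')\<bar> \<le> ?k"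
      "\<bar>ln (?w2 x / D n x) - ln (?w2 x' / D n x')\<bar> \<le> ?k"
      unfolding eq ln_W using ln_D_variation[OF c] lnT by argo+
  qed
  have A1: "\<bar>?I (\<lambda>x. ?w1 x * ?c1 (X n x))\<bar> \<le> 2 * ?k * ?I ?w1"
    by (rule one_turn_average_zero[OF u cont(2) pos(1) var(2)]) (auto intro!: continuous_intros simp: c1)
  have A2: "\<bar>?I (\<lambda>x. ?w2 x * ?c1 (X n x))\<bar> \<le> 2 * ?k * ?I ?w2"
    by (rule one_turn_average_zero[OF u cont(3) pos(2) var(3)]) (auto intro!: continuous_intros simp: c1)
  have A3: "\<bar>?I (\<lambda>x. W n x * ?c2 (X n x))\<bar> \<le> 2 * ?k * ?I (W n)"
    by (rule one_turn_average_zero[OF u cont(1) W_pos var(1)]) (auto intro!: continuous_intros simp: c2)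
  have int: "(\<lambda>x. W n x) integrable_on {p..q}" "?w1 integrable_on {p..q}" "?w2 integrable_on {p..q}"
    "(\<lambda>x. ?w1 x * ?c1 (X n x)) integrable_on {p..q}" "(\<lambda>x. ?w2 x * ?c1 (X n x)) integrable_on {p..q}"
    "(\<lambda>x. W n x * ?c2 (X n x)) integrable_on {p..q}"
    by (intro integrable_continuous_real continuous_intros cont ccont)+
  have "?I ?w1 + ?I ?w2 = ?I (\<lambda>x. ?w1 x + ?w2 x)"
    by (rule integral_add[symmetric]) (rule int)+
  also have "(\<lambda>x. ?w1 x + ?w2 x) = W n" by (auto simp: algebra_simps)
  finally have sum: "?I ?w1 + ?I ?w2 = ?I (W n)" .
  have "?I (W (Suc n)) \<le> (1 - 189 / 1000000) * ?I (W n)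
     + (?I (\<lambda>x. ?w1 x * ?c1 (X n x)) - ?I (\<lambda>x. ?w2 x * ?c1 (X n x))) / 16
     - ?I (\<lambda>x. W n x * ?c2 (X n x)) / 5120"
    by (rule has_integral_le[OF integrable_integral[OF integrable_continuous_real[OF W_cont]] _ W_Suc_le_cos])
       (intro has_integral_add has_integral_diff has_integral_mult_right has_integral_divide
          integrable_integral int)
  moreover have "0 \<le> ?I (W n)" using W_pos int by (intro integral_nonneg) (auto intro: less_imp_le)
  ultimately show ?thesis using A1 A2 A3 sum by argo
qed

end

section \<open>Convergence of heights to the boundary\<close>

lemma AE_summable_of_bounded_integrals:
  fixes f :: "nat \<Rightarrow> real \<Rightarrow> real"
  assumes cont: "\<And>i. continuous_on {p..q} (f i)" and nonneg: "\<And>i x. 0 \<le> f i x"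
    and bound: "\<And>M. (\<Sum>i<M. integral {p..q} (f i)) \<le> C"
  shows "AE x in lborel. x \<in> {p..q} \<longrightarrow> summable (\<lambda>i. f i x)"
proof -
  let ?f = "\<lambda>i x. indicator {p..q} x * f i x"
  have meas [measurable]: "?f i \<in> borel_measurable borel" for i
    using borel_measurable_continuous_on_indicator[OF _ cont[of i]] by simp
  have eq: "(\<integral>\<^sup>+x. ennreal (?f i x) \<partial>lborel) = ennreal (integral {p..q} (f i))" for i
    by (rule nn_integral_has_integral_lebesgue[OF nonneg integrable_integral[OF integrable_continuous_real[OF cont]]])
  have "(\<integral>\<^sup>+x. (\<Sum>i. ennreal (?f i x)) \<partial>lborel) = (\<Sum>i. ennreal (integral {p..q} (f i)))"
    by (subst nn_integral_suminf) (auto simp: eq)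
  also have "\<dots> \<le> ennreal C"
  proof (rule suminf_le_const[OF summableI])
    fix M
    have "(\<Sum>i<M. ennreal (integral {p..q} (f i))) = ennreal (\<Sum>i<M. integral {p..q} (f i))"
      by (intro sum_ennreal integral_nonneg integrable_continuous_real cont nonneg)
    also have "\<dots> \<le> ennreal C" by (intro ennreal_leI bound)
    finally show "(\<Sum>i<M. ennreal (integral {p..q} (f i))) \<le> ennreal C" .
  qed
  finally have "(\<integral>\<^sup>+x. (\<Sum>i. ennreal (?f i x)) \<partial>lborel) \<noteq> \<infinity>"
    by (auto simp: top_unique)
  then have "AE x in lborel. (\<Sum>i. ennreal (?f i x)) \<noteq> \<infinity>"
    by (intro nn_integral_PInf_AE) auto
  then show ?thesis
  proof eventually_elim
    case (elim x)
    have "summable (\<lambda>i. ?f i x)"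
      by (rule summable_suminf_not_top) (use elim nonneg in auto)
    then show ?case by auto
  qed
qed

lemma sum_le_of_recursion:
  fixes a r :: "nat \<Rightarrow> real"
  assumes "\<And>i. a (Suc i) \<le> \<theta> * a i + r i" "\<And>i. 0 \<le> a i" 
  shows "(1 - \<theta>) * (\<Sum>i<M. a i) \<le> a 0 + (\<Sum>i<M. r i)"
proof -
  have "a M + (1 - \<theta>) * (\<Sum>i<M. a i) \<le> a 0 + (\<Sum>i<M. r i)"
  proof (induction M)
    case (Suc M)
    then show ?case using assms(1)[of M] by (simp add: algebra_simps)
  qed simp
  then show ?thesis using assms(2)[of M] by linarith
qed

text \<open>An interval of length one contains the right or the left half of the arc of radius \<open>r\<close> around
  some translate of \<open>c\<close>.\<close>

lemma arc_in_period:
  fixes a c r :: real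
  assumes "0 \<le> r" "r \<le> 1 / 2"
  obtains u and j :: int where "a \<le> u" "u + r \<le> a + 1"
    "\<And>y. u \<le> y \<Longrightarrow> y \<le> u + r \<Longrightarrow> \<bar>y - (c + of_int j)\<bar> \<le> r"
proof -
  define j where "j = \<lceil>a - c\<rceil>"
  have j: "a \<le> c + of_int j" "c + of_int j < a + 1" unfolding j_def by linarith+
  show thesis
  proof (cases "c + of_int j + r \<le> a + 1")
    case True
    show thesis by (rule that[of "c + of_int j" j]) (use j True assms in auto)
  next
    case False
    show thesis by (rule that[of "c + of_int j - r" j]) (use j False assms in auto)
  qed
qed

lemma cos_dist_integer: "cos (2 * pi * \<bar>y - (c + of_int j)\<bar>) = cos (2 * pi * (y - c))"
proof -
  have "2 * pi * \<bar>y - (c + of_int j)\<bar> = \<bar>2 * pi * (y - (c + of_int j))\<bar>"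
    by (simp add: abs_mult)
  then have "cos (2 * pi * \<bar>y - (c + of_int j)\<bar>) = cos (2 * pi * (y - (c + of_int j)))"
    by (simp only: cos_abs_real)
  also have "2 * pi * (y - (c + of_int j)) = 2 * pi * (y - c) - 2 * pi * of_int j"
    by (simp add: algebra_simps)
  finally show ?thesis
    by (simp only: cos_diff cos_int_2pin sin_int_2pin mult_1_right mult_zero_right add_0_right)
qed

context horizontal_line
begin

lemma interval_value:
  assumes "a \<le> b" "X n a \<le> y" "y \<le> X n b"
  obtains x where "a \<le> x" "x \<le> b" "X n x = y"
  using IVT'[of "X n" a y b] assms X_cont by auto

text \<open>If \<open>X m\<close> makes one turn over \<open>{p..q}\<close>, small distortion makes its derivative comparable to
  \<open>1 / (q - p)\<close> throughout; afterwards distances grow by \<open>N / 2\<close> in each step.\<close>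

lemma subinterval_length:
  assumes u: "one_turn m p q" and mn: "m \<le> n" and ab: "p \<le> a" "a \<le> b" "b \<le> q"
    and len: "X n b - X n a \<le> 1"
  shows "b - a \<le> 2 * (q - p) / 10000000 ^ (n - m)"
proof (cases "a = b")
  case True
  then show ?thesis using u by (simp add: one_turn_def)
next
  case False
  then have "a < b" using ab by simp
  have "p < q" using u by (simp add: one_turn_def)
  obtain \<xi> where \<xi>: "p < \<xi>" "\<xi> < q" "X m q - X m p = (q - p) * D m \<xi>"
    using MVT2[OF \<open>p < q\<close> derivs(1)] by blast
  obtain \<eta> where \<eta>: "a < \<eta>" "\<eta> < b" "X m b - X m a = (b - a) * D m \<eta>"
    using MVT2[OF \<open>a < b\<close> derivs(1)] by blast
  have "\<bar>ln (D m \<xi>) - ln (D m \<eta>)\<bar> \<le> 1 / 1000000"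
    by (rule ln_D_variation[OF one_turn_close[OF u]]) (use \<xi> \<eta> ab in auto)
  then have "ln (D m \<xi>) \<le> 1 / 1000000 + ln (D m \<eta>)" by linarith
  then have "exp (ln (D m \<xi>)) \<le> exp (1 / 1000000 + ln (D m \<eta>))" by simp
  then have "D m \<xi> \<le> exp (1 / 1000000) * D m \<eta>" by (simp only: exp_add exp_ln[OF D_pos])
  also have "\<dots> \<le> 2 * D m \<eta>"
    using exp_minus_one_le[of "1 / 1000000"] D_pos[of m \<eta>] by (intro mult_right_mono) auto
  finally have D: "D m \<xi> \<le> 2 * D m \<eta>" .
  have "10000000 ^ (n - m) * (X m b - X m a) \<le> (N / 2) ^ (n - m) * (X m b - X m a)"
    using N_large \<eta>(3) D_pos[of m \<eta>] \<open>a < b\<close> by (intro mult_right_mono power_mono) auto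
  also have "\<dots> \<le> 1"
    using X_expands_iterated[OF ab(2) mn] len by linarith
  finally have "10000000 ^ (n - m) * (b - a) * D m \<eta> \<le> 1" by (simp add: \<eta>(3) mult.assoc)
  also have "1 = (q - p) * D m \<xi>" using u \<xi>(3) by (simp add: one_turn_def)
  also have "\<dots> \<le> (q - p) * (2 * D m \<eta>)" using D \<open>p < q\<close> by (intro mult_left_mono) auto
  finally have "(10000000 ^ (n - m) * (b - a)) * D m \<eta> \<le> (2 * (q - p)) * D m \<eta>"
    by (simp add: algebra_simps)
  then have "10000000 ^ (n - m) * (b - a) \<le> 2 * (q - p)"
    using D_pos[of m \<eta>] by (rule mult_right_le_imp_le)
  then show ?thesis by (simp add: field_simps)
qed

text \<open>Cut the interval from the left into pieces of one turn. Only the incomplete last piece escapes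
  the contraction, and its contribution is at most its length \<open>R\<close>.\<close>

lemma integral_contracts_up_to_remainder:
  assumes V: "\<And>n A. continuous_on A (V n)" "\<And>n x. 0 \<le> V n x" "\<And>n x. V n x \<le> 1"
    and contr: "\<And>p q. one_turn n p q \<Longrightarrow> integral {p..q} (V (Suc n)) \<le> \<theta> * integral {p..q} (V n)"
    and \<theta>: "0 \<le> \<theta>"
    and short: "\<And>a' b'. a \<le> a' \<Longrightarrow> a' \<le> b' \<Longrightarrow> b' \<le> b \<Longrightarrow> X n b' - X n a' \<le> 1 \<Longrightarrow> b' - a' \<le> R"
    and ab: "a \<le> b"
  shows "integral {a..b} (V (Suc n)) \<le> \<theta> * integral {a..b} (V n) + R"
proof -
  have int: "V n integrable_on {c..d}" for n c d by (rule integrable_continuous_real[OF V(1)])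
  have "integral {c..b} (V (Suc n)) \<le> \<theta> * integral {c..b} (V n) + R"
    if "a \<le> c" "c \<le> b" "X n b - X n c \<le> real j" for j c
    using that
  proof (induction j arbitrary: c)
    case 0
    then have "X n b \<le> X n c" by simp
    then have "b = c" using 0 X_le_iff by (meson antisym)
    then show ?case using short[of b b] ab by simp
  next
    case (Suc j)
    show ?case
    proof (cases "X n b - X n c \<le> 1")
      case True
      have "integral {c..b} (V (Suc n)) \<le> integral {c..b} (\<lambda>_. 1)"
        by (intro integral_le int) (auto simp: V(3))
      also have "\<dots> \<le> R" using short[of c b] Suc.prems True by simp
      finally show ?thesis
        using mult_nonneg_nonneg[OF \<theta> integral_nonneg[OF int[of n c b]]] V(2) by simp
    next
      case False
      then obtain d where d: "c \<le> d" "d \<le> b" "X n d = X n c + 1"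
        using interval_value[of c b n "X n c + 1"] Suc.prems by auto
      then have u: "one_turn n c d" unfolding one_turn_def by (cases "c = d") auto
      have "integral {c..b} (V (Suc n)) = integral {c..d} (V (Suc n)) + integral {d..b} (V (Suc n))"
        by (rule Henstock_Kurzweil_Integration.integral_combine[symmetric]) (use d int in auto)
      also have "\<dots> \<le> \<theta> * integral {c..d} (V n) + (\<theta> * integral {d..b} (V n) + R)"
        using d Suc.prems by (intro add_mono contr[OF u] Suc.IH) auto
      also have "\<dots> = \<theta> * (integral {c..d} (V n) + integral {d..b} (V n)) + R"
        by (simp add: algebra_simps)
      also have "integral {c..d} (V n) + integral {d..b} (V n) = integral {c..b} (V n)"
        by (rule Henstock_Kurzweil_Integration.integral_combine) (use d int in auto)
      finally show ?thesis .
    qed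
  qed
  from this[of a "nat \<lceil>X n b - X n a\<rceil>"] ab show ?thesis
    by (simp add: real_nat_ceiling_ge)
qed

text \<open>The \<open>n\<close>-th image of a piece of one turn at time \<open>m\<close> need not have integer length, since its two
  ends lie at different heights. The incomplete turns cost a geometric series with ratio
  \<open>10\<^sup>-\<^sup>7\<close>; there is none at time \<open>m\<close> itself, and so the error is tiny compared with \<open>q - p\<close>.\<close>

lemma sum_integrals_le:
  assumes u: "one_turn m p q"
    and V: "\<And>n A. continuous_on A (V n)" "\<And>n x. 0 \<le> V n x" "\<And>n x. V n x \<le> 1"
    and contr: "\<And>n p q. one_turn n p q \<Longrightarrow> integral {p..q} (V (Suc n)) \<le> \<theta> * integral {p..q} (V n)"
    and \<theta>: "0 \<le> \<theta>"
  shows "(1 - \<theta>) * (\<Sum>i<M. integral {p..q} (V (m + i))) \<le> integral {p..q} (V m) + (q - p) / 1000000"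
proof -
  have pq: "p < q" using u by (simp add: one_turn_def)
  \<comment> \<open>Bounds for the lengths of the incomplete last turns.\<close>
  define r where "r i = (if i = 0 then 0 else 2 * (q - p) / 10000000 ^ i)" for i :: nat
  define a where "a i = integral {p..q} (V (m + i))" for i
  have rec: "a (Suc i) \<le> \<theta> * a i + r i" for i
  proof (cases "i = 0")
    case True
    then show ?thesis using contr[OF u] by (simp add: a_def r_def)
  next
    case False
    have "integral {p..q} (V (Suc (m + i))) \<le> \<theta> * integral {p..q} (V (m + i)) + 2 * (q - p) / 10000000 ^ i"
    proof (rule integral_contracts_up_to_remainder[where V = V, OF V contr \<theta>])
      fix a' b' assume "p \<le> a'" "a' \<le> b'" "b' \<le> q" "X (m + i) b' - X (m + i) a' \<le> 1"
      then show "b' - a' \<le> 2 * (q - p) / 10000000 ^ i"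
        using subinterval_length[OF u, of "m + i" a' b'] by simp
    qed (use pq in auto)
    then show ?thesis using False by (simp add: a_def r_def)
  qed
  have a0: "0 \<le> a i" for i
    unfolding a_def by (intro integral_nonneg integrable_continuous_real V)
  have "(\<Sum>i<M. r i) \<le> (q - p) / 1000000 * (1 - 1 / 2 ^ M)"
  proof (induction M)
    case (Suc M)
    have "r M \<le> (q - p) / 1000000 * (1 / 2 ^ Suc M)"
    proof (cases "M = 0")
      case True
      then show ?thesis using pq by (simp add: r_def)
    next
      case False
      then obtain k where k: "M = Suc k" by (cases M) auto
      have "(2::real) ^ k \<le> 10000000 ^ k" by (intro power_mono) auto
      then have "2 * (q - p) / 10000000 / 10000000 ^ k \<le> (q - p) / 4000000 / 2 ^ k"
        using pq by (rule_tac frac_le) auto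
      then show ?thesis unfolding r_def k by simp
    qed
    then show ?case using Suc by (simp add: algebra_simps)
  qed simp
  also have "\<dots> \<le> (q - p) / 1000000 * 1" using pq by (intro mult_left_mono) auto
  finally have "(\<Sum>i<M. r i) \<le> (q - p) / 1000000" by simp
  then show ?thesis using sum_le_of_recursion[of a \<theta> r M, OF rec a0] unfolding a_def add_0_right by linarith
qed

lemma AE_on_line:
  assumes "\<And>p q. one_turn 0 p q \<Longrightarrow> AE x in lborel. x \<in> {p..q} \<longrightarrow> P x"
  shows "AE x in lborel. P x"
proof -
  have "AE x in lborel. \<forall>j::int. x \<in> {of_int j..of_int j + 1} \<longrightarrow> P x"
    unfolding AE_all_countable by (rule allI, rule assms) (simp add: one_turn_def)
  then show ?thesis
  proof eventually_elim
    case (elim x)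
    have "x \<in> {of_int \<lfloor>x\<rfloor>..of_int \<lfloor>x\<rfloor> + 1}" using floor_correct[of x] by auto
    with elim show ?case by blast
  qed
qed

lemma T_step: "\<bar>T (Suc n) x - T n x\<bar> \<le> W n x / 4"
proof -
  let ?t = "T n x" and ?b = "bias (X n x) (T n x)"
  have "T (Suc n) x - ?t = ?t * (1 - ?t) * ?b" unfolding X_T_simps(4) G_bias(1)[OF T_in] by (simp add: algebra_simps)
  also have "?t * (1 - ?t) = W n x * W n x" using T_in[of n x] by (simp add: W_def)
  finally have "\<bar>T (Suc n) x - ?t\<bar> = W n x * (W n x * \<bar>?b\<bar>)" using W_pos[of n x] by (simp add: abs_mult del: X_T_simps)
  also have "\<dots> \<le> W n x * (1 * (1 / 4))"
    using W_pos[of n x] W_le[of n x] bias_le[OF T_in] by (intro mult_left_mono mult_mono) (auto intro: less_imp_le)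
  finally show ?thesis by simp
qed

lemma sum_W_le:
  assumes "one_turn m p q"
  shows "(\<Sum>i<M. integral {p..q} (W (m + i))) \<le> 10000 * (integral {p..q} (W m) + (q - p) / 1000000)"
proof -
  have "(1 - (1 - 1 / 10000)) * (\<Sum>i<M. integral {p..q} (W (m + i)))
      \<le> integral {p..q} (W m) + (q - p) / 1000000"
    by (rule sum_integrals_le[where V = W, OF assms W_cont less_imp_le[OF W_pos] W_le W_contracts]) auto
  moreover have "1 - (1 - 1 / 10000) = (1 / 10000 :: real)" by simp
  ultimately have "1 / 10000 * (\<Sum>i<M. integral {p..q} (W (m + i)))
      \<le> integral {p..q} (W m) + (q - p) / 1000000" by (simp only:)
  moreover have "S \<le> 10000 * (a + b)" if "1 / 10000 * S \<le> a + b" for S a b :: real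
    using that by simp
  ultimately show ?thesis by blast
qed

lemma AE_T_limit: "AE x in lborel. (\<lambda>n. T n x) \<longlonglongrightarrow> 0 \<or> (\<lambda>n. T n x) \<longlonglongrightarrow> 1"
proof (rule AE_on_line)
  fix p q assume u: "one_turn 0 p q"
  have "AE x in lborel. x \<in> {p..q} \<longrightarrow> summable (\<lambda>i. W i x)"
    by (rule AE_summable_of_bounded_integrals[OF W_cont less_imp_le[OF W_pos]])
       (use sum_W_le[OF u] in simp)
  then show "AE x in lborel. x \<in> {p..q} \<longrightarrow> (\<lambda>n. T n x) \<longlonglongrightarrow> 0 \<or> (\<lambda>n. T n x) \<longlonglongrightarrow> 1"
  proof eventually_elim
    case (elim x)
    show ?case
    proof
      assume "x \<in> {p..q}"
      with elim have W: "summable (\<lambda>i. W i x)" by blast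
      then have "summable (\<lambda>i. W i x / 4)" by (rule summable_divide)
      then have "summable (\<lambda>i. T (Suc i) x - T i x)"
        by (rule summable_comparison_test'[where N = 0]) (use T_step in simp)
      then have "convergent (\<lambda>n. \<Sum>i<n. T (Suc i) x - T i x)" by (simp only: summable_iff_convergent)
      then have "convergent (\<lambda>n. T n x - T 0 x)"
        by (simp only: sum_lessThan_telescope[of "\<lambda>i. T i x"])
      then have "convergent (\<lambda>n. (T n x - T 0 x) + T 0 x)"
        by (intro convergent_add convergent_const)
      then obtain L where L: "(\<lambda>n. T n x) \<longlonglongrightarrow> L" by (auto simp: convergent_def)
      then have "(\<lambda>n. W n x) \<longlonglongrightarrow> sqrt (L * (1 - L))" unfolding W_def by (intro tendsto_intros)
      then have "sqrt (L * (1 - L)) = 0" using summable_LIMSEQ_zero[OF W] by (rule LIMSEQ_unique)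
      then show "(\<lambda>n. T n x) \<longlonglongrightarrow> 0 \<or> (\<lambda>n. T n x) \<longlonglongrightarrow> 1" using L by auto
    qed
  qed
qed

lemma integral_T_change:
  assumes u: "one_turn m p q" and small: "\<And>x. x \<in> {p..q} \<Longrightarrow> W m x \<le> 1 / 1000000"
  shows "\<bar>integral {p..q} (T (m + M)) - integral {p..q} (T m)\<bar> \<le> (q - p) / 100"
proof -
  let ?I = "integral {p..q}"
  have pq: "p < q" using u by (simp add: one_turn_def)
  have int: "T n integrable_on {p..q}" "W n integrable_on {p..q}" for n
    by (intro integrable_continuous_real T_cont W_cont)+
  have step: "\<bar>?I (T (Suc n)) - ?I (T n)\<bar> \<le> ?I (W n) / 4" for n
  proof -
    have d: "((\<lambda>x. T (Suc n) x - T n x) has_integral ?I (T (Suc n)) - ?I (T n)) {p..q}"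
      by (rule has_integral_diff[OF integrable_integral[OF int(1)] integrable_integral[OF int(1)]])
    have w: "((\<lambda>x. W n x / 4) has_integral ?I (W n) / 4) {p..q}"
      by (rule has_integral_divide[OF integrable_integral[OF int(2)]])
    show ?thesis
      by (rule integral_norm_bound_integral[OF has_integral_integrable[OF d] has_integral_integrable[OF w],
            unfolded integral_unique[OF d] integral_unique[OF w] real_norm_def, OF T_step])
  qed
  have "\<bar>?I (T (m + M)) - ?I (T m)\<bar> \<le> (\<Sum>i<M. ?I (W (m + i))) / 4"
  proof (induction M)
    case (Suc M)
    then show ?case using step[of "m + M"]
      unfolding add_Suc_right sum.lessThan_Suc add_divide_distrib by linarith
  qed simp
  also have "\<dots> \<le> 10000 * (?I (W m) + (q - p) / 1000000) / 4"
    by (intro divide_right_mono sum_W_le u) auto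
  also have "?I (W m) \<le> ?I (\<lambda>_. 1 / 1000000)"
    by (intro integral_le int) (use small in auto)
  finally show ?thesis using pq by simp
qed

text \<open>By \<open>integral_T_change\<close> the mean height hardly changes from time \<open>m\<close> on, whereas it would have to move
  by almost one if almost every point converged to the opposite circle.\<close>

lemma not_AE_limit_far:
  assumes u: "one_turn m p q" and L: "L = 0 \<or> L = 1"
    and near: "\<And>x. x \<in> {p..q} \<Longrightarrow> \<bar>T m x - L\<bar> \<le> 1 / 10 ^ 12"
  shows "\<not> (AE x in lborel. x \<in> {p..q} \<longrightarrow> (\<lambda>n. T n x) \<longlonglongrightarrow> 1 - L)"
proof
  assume ae: "AE x in lborel. x \<in> {p..q} \<longrightarrow> (\<lambda>n. T n x) \<longlonglongrightarrow> 1 - L"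
  have pq: "p < q" using u by (simp add: one_turn_def)
  let ?I = "integral {p..q}"
  have "W m x \<le> 1 / 1000000" if "x \<in> {p..q}" for x
  proof -
    have "T m x * (1 - T m x) \<le> 1 / 10 ^ 12"
    proof (cases "L = 0")
      case True
      have "T m x * (1 - T m x) \<le> T m x * 1" using T_in[of m x] by (intro mult_left_mono) auto
      then show ?thesis using near[OF that] True by simp
    next
      case False
      have A: "T m x * (1 - T m x) \<le> 1 * (1 - T m x)" using T_in[of m x] by (intro mult_right_mono) auto
      have B: "1 - T m x \<le> 1 / 10 ^ 12" using near[OF that] False L by (simp add: abs_if split: if_splits)
      show ?thesis by (rule order_trans[OF A[unfolded mult_1_left] B])
    qed
    then show ?thesis unfolding W_def by (intro real_le_lsqrt) (auto simp: power2_eq_square)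
  qed
  note change = integral_T_change[OF u this]
  have int: "T n integrable_on {p..q}" for n by (intro integrable_continuous_real T_cont)
  have d: "((\<lambda>x. T m x - L) has_integral ?I (T m) - (q - p) * L) {p..q}"
    using has_integral_diff[OF integrable_integral[OF int] has_integral_const_real[of L p q]] pq by simp
  have w: "((\<lambda>x. 1 / 10 ^ 12) has_integral (q - p) / 10 ^ 12) {p..q}"
    using has_integral_const_real[of "1 / 10 ^ 12 :: real" p q] pq by simp
  have start: "\<bar>?I (T m) - (q - p) * L\<bar> \<le> (q - p) / 10 ^ 12"
    by (rule integral_norm_bound_integral[OF has_integral_integrable[OF d] has_integral_integrable[OF w],
          unfolded integral_unique[OF d] integral_unique[OF w] real_norm_def, OF near])
  have set_int: "set_integrable lborel {p..q} (T n)" for n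
    by (rule borel_integrable_atLeastAtMost'[OF T_cont])
  have "(\<lambda>n. LINT x:{p..q}|lborel. T n x) \<longlonglongrightarrow> (LINT x:{p..q}|lborel. 1 - L)"
    unfolding set_lebesgue_integral_def
  proof (rule integral_dominated_convergence[where w = "\<lambda>x. indicator {p..q} x"])
    show "AE x in lborel. (\<lambda>n. indicator {p..q} x *\<^sub>R T n x) \<longlonglongrightarrow> indicator {p..q} x *\<^sub>R (1 - L)"
      using ae by eventually_elim (auto simp: indicator_def)
    show "AE x in lborel. norm (indicator {p..q} x *\<^sub>R T n x) \<le> indicator {p..q} x" for n
      using T_in[of n] by (intro AE_I2) (auto simp: indicator_def less_imp_le)
    show "(\<lambda>x. indicator {p..q} x *\<^sub>R T n x) \<in> borel_measurable lborel" for n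
      using set_int[of n] unfolding set_integrable_def by (rule borel_measurable_integrable)
  qed (auto intro!: integrable_real_indicator simp: emeasure_lborel_Icc_eq)
  moreover have "(LINT x:{p..q}|lborel. 1 - L) = (q - p) * (1 - L)"
    using set_borel_integral_eq_integral(2)[OF borel_integrable_atLeastAtMost'[of p q "\<lambda>_. 1 - L"]] pq by simp
  moreover have "(LINT x:{p..q}|lborel. T n x) = ?I (T n)" for n
    by (rule set_borel_integral_eq_integral(2)[OF set_int])
  ultimately have lim: "(\<lambda>n. ?I (T n)) \<longlonglongrightarrow> (q - p) * (1 - L)" by simp
  have "\<bar>?I (T (n + m)) - (q - p) * L\<bar> \<le> (q - p) / 50" for n
  proof -
    have "(q - p) / 10 ^ 12 \<le> (q - p) / 100" using pq by (intro divide_left_mono) auto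
    with start have "\<bar>?I (T m) - (q - p) * L\<bar> \<le> (q - p) / 100" by (rule order_trans)
    moreover have "\<bar>a - c\<bar> \<le> d / 50" if "\<bar>a - b\<bar> \<le> d / 100" "\<bar>b - c\<bar> \<le> d / 100" for a b c d :: real
      using that by linarith
    ultimately show ?thesis using change[of n] by (metis add.commute)
  qed
  moreover have "(\<lambda>n. \<bar>?I (T (n + m)) - (q - p) * L\<bar>) \<longlonglongrightarrow> \<bar>(q - p) * (1 - L) - (q - p) * L\<bar>"
    by (intro tendsto_intros LIMSEQ_ignore_initial_segment lim)
  ultimately have "\<bar>(q - p) * (1 - L) - (q - p) * L\<bar> \<le> (q - p) / 50"
    by (intro LIMSEQ_le_const2) auto
  then show False using pq L by auto
qed

section \<open>Steering and recurrence\<close>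

text \<open>At least a sixth of a turn lies over the part of the circle where the cosine has the prescribed
  sign and absolute value at least one half; its image at the next step makes more than one
  turn.\<close>

lemma one_turn_steer:
  assumes u: "one_turn n p q" and s: "s = 1 \<or> s = - 1"
  obtains p' q' where "p \<le> p'" "q' \<le> q" "one_turn (Suc n) p' q'"
    "\<And>x. x \<in> {p'..q'} \<Longrightarrow> 1 / 2 \<le> s * cos (2 * pi * X n x)"
proof -
  \<comment> \<open>\<open>c\<close> is the angle at which \<open>s * cos\<close> is maximal.\<close>
  define c where "c = (if s = 1 then 0 else 1 / 2 :: real)"
  obtain a and j :: int where a: "X n p \<le> a" "a + 1 / 6 \<le> X n p + 1"
    "\<And>y. a \<le> y \<Longrightarrow> y \<le> a + 1 / 6 \<Longrightarrow> \<bar>y - (c + of_int j)\<bar> \<le> 1 / 6"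
    by (rule arc_in_period[of "1 / 6" "X n p" c]) auto
  have cos: "1 / 2 \<le> s * cos (2 * pi * y)" if "a \<le> y" "y \<le> a + 1 / 6" for y
  proof -
    have z: "2 * pi * \<bar>y - (c + of_int j)\<bar> \<le> pi / 3"
      using mult_left_mono[OF a(3)[OF that], of "2 * pi"] by simp
    have "cos (pi / 3) \<le> cos (2 * pi * \<bar>y - (c + of_int j)\<bar>)"
      using z by (intro cos_monotone_0_pi_le) auto
    then have "1 / 2 \<le> cos (2 * pi * (y - c))" by (simp add: cos_60 cos_dist_integer)
    also have "cos (2 * pi * (y - c)) = s * cos (2 * pi * y)"
      using s by (auto simp: c_def right_diff_distrib cos_diff)
    finally show ?thesis .
  qed
  have pq: "p \<le> q" "X n q = X n p + 1" using u by (auto simp: one_turn_def)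
  obtain p' where p': "p \<le> p'" "p' \<le> q" "X n p' = a"
    using interval_value[of p q n a] pq a by auto
  obtain b where b: "p' \<le> b" "b \<le> q" "X n b = a + 1 / 6"
    using interval_value[of p' q n "a + 1 / 6"] pq a p' by auto
  have "1 \<le> X (Suc n) b - X (Suc n) p'"
    using X_expands[OF b(1), of n] N_large by (simp add: p' b del: X_T_simps)
  then obtain q' where q': "p' \<le> q'" "q' \<le> b" "X (Suc n) q' = X (Suc n) p' + 1"
    using interval_value[of p' b "Suc n" "X (Suc n) p' + 1"] b by (auto simp del: X_T_simps)
  show thesis
  proof (rule that)
    show "p \<le> p'" "q' \<le> q" using p' q' b by auto
    show "one_turn (Suc n) p' q'" using q' unfolding one_turn_def by (cases "p' = q'") (auto simp del: X_T_simps)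
    fix x assume "x \<in> {p'..q'}"
    then have "X n p' \<le> X n x" "X n x \<le> X n b" using q' X_le_iff by auto
    then show "1 / 2 \<le> s * cos (2 * pi * X n x)" by (intro cos) (auto simp: p' b)
  qed
qed

end

lemma cos_lipschitz: "\<bar>cos a - cos b\<bar> \<le> \<bar>a - b\<bar>" for a b :: real
  using field_differentiable_bound[of UNIV cos "\<lambda>x. - sin x" 1 b a] by (auto intro!: derivative_eq_intros)

context horizontal_line
begin

lemma one_turn_in_interval:
  assumes "l < r"
  obtains n p q where "l \<le> p" "q \<le> r" "one_turn n p q"
proof -
  obtain n where n: "1 / (r - l) < 10000000 ^ n"
    using real_arch_pow[of 10000000 "1 / (r - l)"] by auto
  then have "1 \<le> 10000000 ^ n * (r - l)" using assms by (simp add: field_simps)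
  also have "\<dots> \<le> (N / 2) ^ n * (r - l)"
    using N_large assms by (intro mult_right_mono power_mono) auto
  also have "\<dots> \<le> X n r - X n l"
    using X_expands_iterated[of l r 0 n] assms by simp
  finally obtain q where q: "l \<le> q" "q \<le> r" "X n q = X n l + 1"
    using interval_value[of l r n "X n l + 1"] assms by auto
  then show thesis using that[of l q n] unfolding one_turn_def by (cases "l = q") auto
qed

text \<open>Here the cosine of the current angle has the sign that pushes towards the circle \<open>L\<close>.\<close>

lemma distance_shrinks:
  assumes L: "s = - 1 \<and> L = 0 \<or> s = 1 \<and> L = 1" and c: "1 / 2 \<le> s * cos (2 * pi * X n x)"
    and h: "\<bar>T n x - L\<bar> \<le> h"
  shows "\<bar>T (Suc n) x - L\<bar> \<le> \<bar>T n x - L\<bar> * (1 - (1 - h) / 32)"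
proof -
  let ?t = "T n x" and ?b = "bias (X n x) (T n x)"
  note t = T_in[of n x] and t' = T_in[of "Suc n" x]
  have b: "\<bar>?b - cos (2 * pi * X n x) / 8\<bar> \<le> 1 / 100000" by (rule bias_near[OF T_in])
  from L show ?thesis
  proof
    assume *: "s = - 1 \<and> L = 0"
    then have th: "?t \<le> h" using h t by simp
    have "cos (2 * pi * X n x) \<le> - 1 / 2" using c * by simp
    then have "?b \<le> - 1 / 32" using b by linarith
    then have "(1 - ?t) * ?b \<le> (1 - ?t) * (- 1 / 32)" using t by (intro mult_left_mono) auto
    also have "\<dots> \<le> - (1 - h) / 32" using th by (simp add: field_simps)
    finally have "1 + (1 - ?t) * ?b \<le> 1 - (1 - h) / 32" by (simp add: field_simps)
    then have "?t * (1 + (1 - ?t) * ?b) \<le> ?t * (1 - (1 - h) / 32)"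
      using t by (intro mult_left_mono) auto
    then show ?thesis using * t t' unfolding X_T_simps(4) G_bias(1)[OF T_in] by simp
  next
    assume *: "s = 1 \<and> L = 1"
    then have "1 / 2 \<le> cos (2 * pi * X n x)" using c * by simp
    then have "1 / 32 \<le> ?b" using b by linarith
    then have "?t * (1 / 32) \<le> ?t * ?b" using t by (intro mult_left_mono) auto
    moreover have "(1 - h) / 32 \<le> ?t * (1 / 32)" using h t * by simp
    ultimately have "1 - ?t * ?b \<le> 1 - (1 - h) / 32" by linarith
    then have "(1 - ?t) * (1 - ?t * ?b) \<le> (1 - ?t) * (1 - (1 - h) / 32)"
      using t by (intro mult_left_mono) auto
    then have "1 - T (Suc n) x \<le> (1 - ?t) * (1 - (1 - h) / 32)"
      unfolding X_T_simps(4) G_bias(2)[OF T_in] .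
    then show ?thesis using * t t' by (simp del: X_T_simps)
  qed
qed

text \<open>Iterated steering. The distance to the chosen circle shrinks geometrically because it is bounded
  by its initial maximum \<open>h < 1\<close>.\<close>

lemma one_turn_near_boundary:
  assumes "l < r" and L: "L = 0 \<or> L = 1" and "0 < \<eta>"
  obtains m p q where "l \<le> p" "q \<le> r" "one_turn m p q" "\<And>x. x \<in> {p..q} \<Longrightarrow> \<bar>T m x - L\<bar> \<le> \<eta>"
proof -
  define s where "s = (if L = 0 then - 1 else 1 :: real)"
  have sL: "s = - 1 \<and> L = 0 \<or> s = 1 \<and> L = 1" using L by (auto simp: s_def)
  then have s: "s = 1 \<or> s = - 1" by auto
  obtain n p q where n: "l \<le> p" "q \<le> r" "one_turn n p q" using one_turn_in_interval[OF \<open>l < r\<close>] .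
  have "\<exists>z\<in>{p..q}. \<forall>x\<in>{p..q}. \<bar>T n x - L\<bar> \<le> \<bar>T n z - L\<bar>"
    using n(3) by (intro continuous_attains_sup continuous_intros T_cont) (auto simp: one_turn_def)
  then obtain z where z: "\<And>x. x \<in> {p..q} \<Longrightarrow> \<bar>T n x - L\<bar> \<le> \<bar>T n z - L\<bar>" by blast
  define h where "h = \<bar>T n z - L\<bar>"
  have h: "0 \<le> h" "h < 1" using T_in[of n z] L by (auto simp: h_def)
  define \<rho> where "\<rho> = 1 - (1 - h) / 32"
  have \<rho>: "0 < \<rho>" "\<rho> < 1" using h by (auto simp: \<rho>_def)
  have ex: "\<exists>p' q'. p \<le> p' \<and> q' \<le> q \<and> one_turn (n + i) p' q' \<and> (\<forall>x\<in>{p'..q'}. \<bar>T (n + i) x - L\<bar> \<le> h * \<rho> ^ i)" for i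
  proof (induction i)
    case 0
    then show ?case using n(3) z by (intro exI[of _ p] exI[of _ q]) (simp add: h_def)
  next
    case (Suc i)
    then obtain p' q' where 1: "p \<le> p'" "q' \<le> q" "one_turn (n + i) p' q'"
      and close: "\<And>x. x \<in> {p'..q'} \<Longrightarrow> \<bar>T (n + i) x - L\<bar> \<le> h * \<rho> ^ i" by blast
    obtain p'' q'' where 2: "p' \<le> p''" "q'' \<le> q'" "one_turn (Suc (n + i)) p'' q''"
      and cos: "\<And>x. x \<in> {p''..q''} \<Longrightarrow> 1 / 2 \<le> s * cos (2 * pi * X (n + i) x)"
      using one_turn_steer[OF 1(3) s] by metis
    have "\<bar>T (n + Suc i) x - L\<bar> \<le> h * \<rho> ^ Suc i" if x: "x \<in> {p''..q''}" for x
    proof -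
      have le: "\<bar>T (n + i) x - L\<bar> \<le> h * \<rho> ^ i" using close[of x] x 2 by auto
      also have "\<dots> \<le> h * 1" using h \<rho> by (intro mult_left_mono power_le_one) auto
      finally have "\<bar>T (n + i) x - L\<bar> \<le> h" by simp
      from distance_shrinks[OF sL cos[OF x] this]
      have "\<bar>T (n + Suc i) x - L\<bar> \<le> \<bar>T (n + i) x - L\<bar> * \<rho>" by (simp only: \<rho>_def add_Suc_right)
      also have "\<dots> \<le> h * \<rho> ^ i * \<rho>" using \<rho> le by (intro mult_right_mono) auto
      finally show ?thesis by (simp only: power_Suc2 mult.assoc)
    qed
    moreover have "p \<le> p''" "q'' \<le> q" using 1 2 by auto
    moreover have "one_turn (n + Suc i) p'' q''" using 2(3) by (simp only: add_Suc_right)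
    ultimately show ?case by blast
  qed
  obtain i where i: "\<rho> ^ i < \<eta>" using real_arch_pow_inv[OF \<open>0 < \<eta>\<close> \<rho>(2)] by blast
  obtain p' q' where *: "p \<le> p'" "q' \<le> q" "one_turn (n + i) p' q'" "\<forall>x\<in>{p'..q'}. \<bar>T (n + i) x - L\<bar> \<le> h * \<rho> ^ i"
    using ex[of i] by blast
  have "h * \<rho> ^ i \<le> 1 * \<rho> ^ i" using h \<rho> by (intro mult_right_mono) auto
  then have "h * \<rho> ^ i \<le> \<eta>" using i by simp
  then show thesis using * n by (intro that[of p' q' "n + i"]) (auto intro: order_trans)
qed

theorem not_AE_avoids_limit:
  assumes "l < r" and L: "L = 0 \<or> L = 1"
  shows "\<not> (AE x in lborel. x \<in> {l..r} \<longrightarrow> \<not> (\<lambda>n. T n x) \<longlonglongrightarrow> L)"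
proof
  assume ae: "AE x in lborel. x \<in> {l..r} \<longrightarrow> \<not> (\<lambda>n. T n x) \<longlonglongrightarrow> L"
  have pos: "0 < (1 / 10 ^ 12 :: real)" by simp
  obtain m p q where u: "l \<le> p" "q \<le> r" "one_turn m p q"
    and near: "\<And>x. x \<in> {p..q} \<Longrightarrow> \<bar>T m x - L\<bar> \<le> 1 / 10 ^ 12"
    by (rule one_turn_near_boundary[OF assms pos]) (rule that)
  have "AE x in lborel. x \<in> {p..q} \<longrightarrow> (\<lambda>n. T n x) \<longlonglongrightarrow> 1 - L"
    using ae AE_T_limit
  proof eventually_elim
    case (elim x)
    have "x \<in> {p..q} \<Longrightarrow> x \<in> {l..r}" using u by simp
    with elim L show ?case by (metis diff_0_right diff_self)
  qed
  with not_AE_limit_far[OF u(3) L near] show False by blast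
qed

text \<open>Let \<open>f\<close> be a bump function supported by the arc. The product \<open>V n\<close> of \<open>1 - f\<close> along the orbit has a
  logarithm with bounded variation over a turn, so that a definite proportion of its integral is
  lost at each step. Hence it tends to zero almost everywhere, which means that the arc is visited
  infinitely often.\<close>

theorem AE_visits_arc:
  assumes \<kappa>: "0 \<le> \<kappa>" "\<kappa> < 1"
  shows "AE x in lborel. \<exists>\<^sub>\<infinity>n. \<kappa> < cos (2 * pi * (X n x - c))"
proof -
  define f where "f y = max 0 (cos (2 * pi * (y - c)) - \<kappa>) / 2" for y
  define V where "V n x = (\<Prod>i<n. 1 - f (X i x))" for n x
  have f: "0 \<le> f y" "f y \<le> 1 / 2" for y
  proof -
    have "max 0 (cos (2 * pi * (y - c)) - \<kappa>) \<le> 1"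
      using \<kappa> cos_le_one[of "2 * pi * (y - c)"] by (intro max.boundedI) linarith+
    then show "0 \<le> f y" "f y \<le> 1 / 2" by (simp_all add: f_def)
  qed
  have f_less: "f y < 1" for y using f(2)[of y] by linarith
  have f_cont: "continuous_on UNIV f" unfolding f_def by (intro continuous_intros) auto
  have f_lip: "\<bar>f y - f z\<bar> \<le> 7 / 2 * \<bar>y - z\<bar>" for y z
  proof -
    have "\<bar>f y - f z\<bar> \<le> \<bar>cos (2 * pi * (y - c)) - cos (2 * pi * (z - c))\<bar> / 2"
      unfolding f_def by (simp add: max_def abs_if)
    also have "\<bar>cos (2 * pi * (y - c)) - cos (2 * pi * (z - c))\<bar> \<le> 2 * pi * \<bar>y - z\<bar>"
    proof -
      note cos_lipschitz[of "2 * pi * (y - c)" "2 * pi * (z - c)"]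
      also have "2 * pi * (y - c) - 2 * pi * (z - c) = 2 * pi * (y - z)" by (simp add: algebra_simps)
      finally show ?thesis by (simp add: abs_mult)
    qed
    also have "2 * pi * \<bar>y - z\<bar> \<le> 7 * \<bar>y - z\<bar>" using pi_less_4 pi_approx by (intro mult_right_mono) auto
    finally show ?thesis by simp
  qed
  have V_Suc: "V (Suc n) x = V n x * (1 - f (X n x))" for n x by (simp add: V_def)
  have V_pos: "0 < V n x" for n x
    unfolding V_def by (intro prod_pos) (use f_less in auto)
  have V_le: "V n x \<le> 1" for n x unfolding V_def by (intro prod_le_1) (use f_less f(1) in \<open>auto simp: less_imp_le\<close>)
  have fX_cont: "continuous_on A (\<lambda>x. f (X n x))" for n A
    by (rule continuous_on_compose2[OF f_cont X_cont]) auto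
  have V_cont: "continuous_on A (V n)" for n A
    unfolding V_def by (intro continuous_intros fX_cont)
  have ln_V: "\<bar>ln (V n x) - ln (V n x')\<bar> \<le> 7 / 5000000" if "gap n x x' \<le> 1" for n x x'
  proof (rule cocycle_variation[where L = "\<lambda>n x. ln (V n x)" and L\<^sub>0 = 0 and l = "\<lambda>n x. ln (1 - f (X n x))", OF _ _ _ _ that])
    show "ln (V (Suc n) x) = ln (V n x) + ln (1 - f (X n x))" for n x
      unfolding V_Suc using f(2)[of "X n x"] V_pos by (intro ln_mult_pos) auto
    fix n x x' assume c: "gap n x x' \<le> 1"
    have "\<bar>ln (1 - f (X n x)) - ln (1 - f (X n x'))\<bar> \<le> \<bar>(1 - f (X n x)) - (1 - f (X n x'))\<bar> / (1 / 2)"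
      by (rule abs_ln_diff_le) (use f(2)[of "X n x"] f(2)[of "X n x'"] in linarith)+
    also have "\<dots> \<le> 7 * gap n x x'" using f_lip[of "X n x" "X n x'"]
      by (simp add: abs_minus_commute)
    also have "gap n x x' \<le> gap n x x' powr \<beta>"
    proof (cases "X n x = X n x'")
      case False
      then have "gap n x x' powr 1 \<le> gap n x x' powr \<beta>"
        using exponent c by (intro powr_mono') auto
      then show ?thesis using False by simp
    qed simp
    finally show "\<bar>ln (1 - f (X n x)) - ln (1 - f (X n x'))\<bar> \<le> 7 * gap n x x' powr \<beta>" by simp
  qed (auto simp: V_def)
  \<comment> \<open>On the arc of radius \<open>r\<close> the cosine exceeds \<open>\<kappa>\<close> by at least \<open>(1 - \<kappa>) / 2\<close>.\<close>
  define r where "r = arccos ((1 + \<kappa>) / 2) / (2 * pi)"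
  have r: "0 < r" "r \<le> 1 / 2" "cos (2 * pi * r) = (1 + \<kappa>) / 2"
    using \<kappa> arccos_lt_bounded[of "(1 + \<kappa>) / 2"] by (auto simp: r_def field_simps)
  define c\<^sub>0 where "c\<^sub>0 = r * ((1 - \<kappa>) / 4)"
  have c\<^sub>0: "0 < c\<^sub>0" using r \<kappa> by (simp add: c\<^sub>0_def)
  have mass: "c\<^sub>0 \<le> integral {a..a + 1} f" for a
  proof -
    obtain u and j :: int where u: "a \<le> u" "u + r \<le> a + 1"
      "\<And>y. u \<le> y \<Longrightarrow> y \<le> u + r \<Longrightarrow> \<bar>y - (c + of_int j)\<bar> \<le> r"
      using arc_in_period[of r a c] r by auto
    have "c\<^sub>0 = integral {u..u + r} (\<lambda>_. (1 - \<kappa>) / 4)" using r by (simp add: c\<^sub>0_def)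
    also have "\<dots> \<le> integral {u..u + r} f"
    proof (rule integral_le)
      fix y assume "y \<in> {u..u + r}"
      then have "\<bar>y - (c + of_int j)\<bar> \<le> r" by (intro u) auto
      then have "cos (2 * pi * r) \<le> cos (2 * pi * \<bar>y - (c + of_int j)\<bar>)"
        using r by (intro cos_monotone_0_pi_le) (auto simp: field_simps)
      then show "(1 - \<kappa>) / 4 \<le> f y" unfolding r(3) cos_dist_integer f_def by (simp add: max_def field_simps)
    qed (auto intro!: integrable_continuous_real continuous_on_subset[OF f_cont])
    also have "\<dots> \<le> integral {a..a + 1} f"
      using u f(1) by (intro integral_subset_le integrable_continuous_real continuous_on_subset[OF f_cont]) auto
    finally show ?thesis .
  qed
  \<comment> \<open>One is a generous bound for the variation of \<open>ln (V n / D n)\<close> over a turn, whence \<open>exp (- 2)\<close>.\<close>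
  define \<delta> where "\<delta> = min 1 (exp (- 2) * c\<^sub>0)"
  have \<delta>: "0 < \<delta>" "\<delta> \<le> 1" using c\<^sub>0 by (auto simp: \<delta>_def)
  have contr: "integral {p..q} (V (Suc n)) \<le> (1 - \<delta>) * integral {p..q} (V n)" if u: "one_turn n p q" for n p q
  proof -
    have var: "\<bar>ln (V n x / D n x) - ln (V n x' / D n x')\<bar> \<le> 1" if "x \<in> {p..q}" "x' \<in> {p..q}" for x x'
      using ln_V[OF one_turn_close[OF u that]] ln_D_variation[OF one_turn_close[OF u that]]
      unfolding ln_divide_pos[OF V_pos D_pos] by argo
    have V0: "0 \<le> integral {p..q} (V n)"
      by (intro integral_nonneg integrable_continuous_real V_cont less_imp_le[OF V_pos])
    have "\<delta> * integral {p..q} (V n) \<le> exp (- 2) * c\<^sub>0 * integral {p..q} (V n)"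
      using V0 by (intro mult_right_mono) (auto simp: \<delta>_def)
    also have "\<dots> \<le> exp (- 2 * 1) * integral {X n p..X n p + 1} f * integral {p..q} (V n)"
      using V0 mass by (intro mult_right_mono mult_left_mono) auto
    also have "\<dots> \<le> integral {p..q} (\<lambda>x. V n x * f (X n x))"
      by (rule one_turn_average_lower[OF u V_cont V_pos var f_cont f(1)])
    finally have lower: "\<delta> * integral {p..q} (V n) \<le> integral {p..q} (\<lambda>x. V n x * f (X n x))" .
    have "((\<lambda>x. V n x - V n x * f (X n x)) has_integral
        integral {p..q} (V n) - integral {p..q} (\<lambda>x. V n x * f (X n x))) {p..q}"
      by (intro has_integral_diff integrable_integral integrable_continuous_real continuous_intros V_cont fX_cont)
    moreover have "(\<lambda>x. V n x - V n x * f (X n x)) = V (Suc n)" by (auto simp: V_Suc algebra_simps)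
    ultimately have "integral {p..q} (V (Suc n)) = integral {p..q} (V n) - integral {p..q} (\<lambda>x. V n x * f (X n x))"
      by (metis integral_unique)
    then show ?thesis using lower by (simp add: algebra_simps)
  qed
  show ?thesis
  proof (rule AE_on_line)
    fix p q assume u: "one_turn 0 p q"
    have "(\<Sum>i<M. integral {p..q} (V i)) \<le> (integral {p..q} (V 0) + (q - p) / 1000000) / \<delta>" for M
    proof -
      have "(1 - (1 - \<delta>)) * (\<Sum>i<M. integral {p..q} (V (0 + i))) \<le> integral {p..q} (V 0) + (q - p) / 1000000"
        by (rule sum_integrals_le[where V = V, OF u V_cont less_imp_le[OF V_pos] V_le contr]) (use \<delta> in auto)
      then show ?thesis using \<delta> by (simp add: field_simps)
    qed
    then have "AE x in lborel. x \<in> {p..q} \<longrightarrow> summable (\<lambda>i. V i x)"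
      by (rule AE_summable_of_bounded_integrals[OF V_cont less_imp_le[OF V_pos]])
    then show "AE x in lborel. x \<in> {p..q} \<longrightarrow> (\<exists>\<^sub>\<infinity>n. \<kappa> < cos (2 * pi * (X n x - c)))"
    proof eventually_elim
      case (elim x)
      show ?case
      proof (intro impI, rule ccontr)
        assume "x \<in> {p..q}"
        with elim have lim: "(\<lambda>i. V i x) \<longlonglongrightarrow> 0" using summable_LIMSEQ_zero by blast
        assume "\<not> (\<exists>\<^sub>\<infinity>n. \<kappa> < cos (2 * pi * (X n x - c)))"
        then obtain n\<^sub>0 where n\<^sub>0: "\<And>n. n \<ge> n\<^sub>0 \<Longrightarrow> cos (2 * pi * (X n x - c)) \<le> \<kappa>"
          by (auto simp: INFM_nat_le not_less)
        have "V (n\<^sub>0 + i) x = V n\<^sub>0 x" for i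
        proof (induction i)
          case (Suc i)
          have "f (X (n\<^sub>0 + i) x) = 0" using n\<^sub>0[of "n\<^sub>0 + i"] by (simp add: f_def)
          then show ?case using Suc by (simp add: V_Suc)
        qed simp
        then have "(\<lambda>i. V (i + n\<^sub>0) x) \<longlonglongrightarrow> V n\<^sub>0 x" by (simp add: add.commute)
        moreover have "(\<lambda>i. V (i + n\<^sub>0) x) \<longlonglongrightarrow> 0" using lim by (rule LIMSEQ_ignore_initial_segment)
        ultimately show False using LIMSEQ_unique V_pos[of n\<^sub>0 x] by fastforce
      qed
    qed
  qed
qed

end

section \<open>The annulus\<close>

lemma abs_circle_eq_iff: "abs_circle x = abs_circle y \<longleftrightarrow> x - y \<in> \<int>"
  by (rule circle.abs_eq_iff)

lemma abs_circle_surj: "\<exists>x. 0 \<le> x \<and> x < 1 \<and> c = abs_circle x"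
proof -
  define y where "y = rep_circle c"
  have y: "c = abs_circle y" unfolding y_def using Quotient_abs_rep[OF Quotient_circle, of c] by simp
  have "y - frac y \<in> \<int>" by (simp add: frac_def)
  then have "c = abs_circle (frac y)" using y abs_circle_eq_iff by simp
  then show ?thesis using frac_ge_0 frac_lt_1 by blast
qed

lemma covering_onto_level: "UNIV \<times> {h} = covering ` ({0..1} \<times> {h})"
proof -
  have "(c, h) \<in> covering ` ({0..1} \<times> {h})" for c
    using abs_circle_surj[of c] by (force simp: covering_def)
  then show ?thesis by (auto simp: covering_def)
qed

lemma compact_level: "compact (UNIV \<times> {h} :: (circle \<times> real) set)"
  unfolding covering_onto_level
  by (intro compact_continuous_image continuous_on_subset[OF continuous_on_covering] compact_Times) auto

lemma covering_onto_annulus: "annulus = covering ` ({0..1} \<times> {0..1})"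
proof -
  have "(c, h) \<in> covering ` ({0..1} \<times> {0..1})" if "0 \<le> h" "h \<le> 1" for c h
    using abs_circle_surj[of c] that by (force simp: covering_def)
  then show ?thesis by (auto simp: covering_def annulus_def)
qed

lemma compact_annulus: "compact annulus"
  unfolding covering_onto_annulus
  by (intro compact_continuous_image continuous_on_subset[OF continuous_on_covering] compact_Times) auto

lemma closed_annulus: "closed annulus"
  unfolding annulus_def by (intro closed_Times) auto

lemma open_abs_circle_image: "open U \<Longrightarrow> open (abs_circle ` U)"
proof -
  assume U: "open U"
  have "abs_circle -` abs_circle ` U = (\<Union>j::int. (+) (of_int j) ` U)"
  proof (intro set_eqI iffI)
    fix x assume "x \<in> abs_circle -` abs_circle ` U"
    then obtain u where "u \<in> U" "x - u \<in> \<int>" by (auto simp: abs_circle_eq_iff)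
    then obtain j where "x = of_int j + u" by (metis Ints_cases diff_eq_eq)
    with \<open>u \<in> U\<close> show "x \<in> (\<Union>j::int. (+) (of_int j) ` U)" by auto
  next
    have "abs_circle (of_int j + u) = abs_circle u" for j :: int and u by (simp add: abs_circle_eq_iff)
    then show "x \<in> abs_circle -` abs_circle ` U" if "x \<in> (\<Union>j::int. (+) (of_int j) ` U)" for x
      using that by auto
  qed
  then show ?thesis unfolding open_circle_def using open_translation[OF U] by auto
qed

lemma open_covering_image:
  assumes "open U"
  shows "open (covering ` U)"
  unfolding open_prod_def
proof
  fix p assume "p \<in> covering ` U"
  then obtain z where z: "z \<in> U" "p = covering z" by blast
  from open_prod_elim[OF assms z(1)] obtain A B where AB: "open A" "open B" "z \<in> A \<times> B" "A \<times> B \<subseteq> U" .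
  have "abs_circle ` A \<times> B \<subseteq> covering ` U" using AB(4) by (force simp: covering_def)
  then show "\<exists>A B. open A \<and> open B \<and> p \<in> A \<times> B \<and> A \<times> B \<subseteq> covering ` U"
    using AB z open_abs_circle_image[OF AB(1)]
    by (intro exI[of _ "abs_circle ` A"] exI[of _ B]) (auto simp: covering_def)
qed

lemma covering_in_annulus_iff: "covering z \<in> annulus \<longleftrightarrow> z \<in> strip"
  by (auto simp: covering_def annulus_def strip_def mem_Times_iff)

text \<open>Preimages of open sets are read off in the strip, because \<open>covering\<close> is open.\<close>

lemma lift_imp_continuous:
  assumes "is_lift H g"
  shows "continuous_on annulus g"
  unfolding continuous_on_open_invariant
proof (intro allI impI)
  fix Q assume Q: "open (Q :: (circle \<times> real) set)"
  have "continuous_on strip (\<lambda>z. covering (H z))"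
    using assms by (intro continuous_on_compose2[OF continuous_on_covering]) (auto simp: is_lift_def)
  then obtain A where A: "open A" "A \<inter> strip = (\<lambda>z. covering (H z)) -` Q \<inter> strip"
    using Q unfolding continuous_on_open_invariant by blast
  have "covering ` A \<inter> annulus = g -` Q \<inter> annulus"
  proof (intro set_eqI iffI)
    fix p assume "p \<in> covering ` A \<inter> annulus"
    then obtain z where z: "z \<in> A" "p = covering z" "p \<in> annulus" by blast
    then have "z \<in> A \<inter> strip" by (simp add: covering_in_annulus_iff)
    then have "covering (H z) \<in> Q" "z \<in> strip" using A(2) by auto
    then show "p \<in> g -` Q \<inter> annulus" using assms z by (auto simp: is_lift_def)
  next
    fix p assume p: "p \<in> g -` Q \<inter> annulus"
    then obtain z where z: "p = covering z" "z \<in> strip"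
      unfolding covering_onto_annulus by (auto simp: strip_def)
    then have "z \<in> A \<inter> strip" using p assms unfolding A(2) by (auto simp: is_lift_def)
    then show "p \<in> covering ` A \<inter> annulus" using z p by auto
  qed
  then show "\<exists>A. open A \<and> A \<inter> annulus = g -` Q \<inter> annulus"
    using open_covering_image[OF A(1)] by blast
qed

text \<open>The superlevel sets of these functions, for rational \<open>b\<close> and levels \<open>1 - 1 / (m + 1)\<close>, are
  countably many arcs that form a basis of the topology of the circle.\<close>

definition circle_cos :: "real \<Rightarrow> circle \<Rightarrow> real" where
  "circle_cos b c = cos (2 * pi * (rep_circle c - b))"

lemma circle_cos_abs: "circle_cos b (abs_circle x) = cos (2 * pi * (x - b))"
proof -
  have "rep_circle (abs_circle x) - x \<in> \<int>"
    using Quotient_rep_abs[OF Quotient_circle, of x] by simp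
  then obtain j where j: "rep_circle (abs_circle x) = x + of_int j"
    by (metis Ints_cases add.commute diff_eq_eq)
  have "2 * pi * (rep_circle (abs_circle x) - b) = 2 * pi * (x - b) + 2 * pi * of_int j"
    by (simp add: j algebra_simps)
  then show ?thesis unfolding circle_cos_def
    by (simp only: cos_add cos_int_2pin sin_int_2pin mult_1_right mult_zero_right diff_zero)
qed

lemma continuous_on_circle_cos: "continuous_on A (circle_cos b)"
proof -
  have "open (circle_cos b -` U)" if U: "open U" for U
  proof -
    have "abs_circle -` circle_cos b -` U = (\<lambda>x. cos (2 * pi * (x - b))) -` U"
      by (auto simp: circle_cos_abs)
    moreover have "open ((\<lambda>x. cos (2 * pi * (x - b))) -` U)"
      by (rule open_vimage[OF U]) (intro continuous_intros)
    ultimately show ?thesis by (simp add: open_circle_def)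
  qed
  then have "continuous_on UNIV (circle_cos b)" by (simp add: continuous_on_open_vimage)
  then show ?thesis by (rule continuous_on_subset) simp
qed

lemma cos_gt_imp_near_int:
  assumes "cos (2 * pi * r) < cos (2 * pi * z)" "0 \<le> r"
  shows "\<exists>j::int. \<bar>z - of_int j\<bar> < r"
proof (rule ccontr)
  let ?j = "round z"
  assume "\<nexists>j::int. \<bar>z - of_int j\<bar> < r"
  then have "r \<le> \<bar>z - of_int ?j\<bar>" by (auto simp: not_less)
  moreover have "\<bar>z - of_int ?j\<bar> \<le> 1 / 2" using of_int_round_abs_le[of z] by (simp add: abs_minus_commute)
  then have "2 * pi * \<bar>z - of_int ?j\<bar> \<le> pi" by (simp add: field_simps)
  ultimately have "cos (2 * pi * \<bar>z - of_int ?j\<bar>) \<le> cos (2 * pi * r)"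
    using assms(2) by (intro cos_monotone_0_pi_le) auto
  then show False using cos_dist_integer[of z 0 ?j] assms(1) by simp
qed

lemma ex_arc_in_open:
  assumes "open U" "c \<in> U"
  obtains b :: rat and m :: nat where "1 - 1 / real (m + 1) < circle_cos (of_rat b) c"
    "\<And>c'. 1 - 1 / real (m + 1) < circle_cos (of_rat b) c' \<Longrightarrow> c' \<in> U"
proof -
  obtain y where y: "c = abs_circle y" using abs_circle_surj by blast
  have "open (abs_circle -` U)" "y \<in> abs_circle -` U" using assms y by (auto simp: open_circle_def)
  then obtain e where e: "0 < e" "\<And>x. \<bar>x - y\<bar> < e \<Longrightarrow> abs_circle x \<in> U"
    unfolding open_dist by (auto simp: dist_real_def)
  define r where "r = min (e / 2) (1 / 4)"
  have r: "0 < r" "r \<le> e / 2" "r \<le> 1 / 4" using e by (auto simp: r_def)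
  have "cos (2 * pi * r) < cos 0" using r by (intro cos_monotone_0_pi) auto
  then obtain m where m: "1 / real (m + 1) < 1 - cos (2 * pi * r)"
    using reals_Archimedean[of "1 - cos (2 * pi * r)"] by (auto simp: inverse_eq_divide)
  let ?\<kappa> = "1 - 1 / real (m + 1)"
  have "open {b. ?\<kappa> < cos (2 * pi * (y - b))}" by (intro open_Collect_less continuous_intros)
  moreover have "y \<in> {b. ?\<kappa> < cos (2 * pi * (y - b))}" by simp
  ultimately have "\<exists>d>0. \<forall>b. dist b y < d \<longrightarrow> b \<in> {b. ?\<kappa> < cos (2 * pi * (y - b))}"
    unfolding open_dist by blast
  then obtain d where d: "0 < d" "\<And>b. \<bar>b - y\<bar> < d \<Longrightarrow> ?\<kappa> < cos (2 * pi * (y - b))"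
    by (auto simp: dist_real_def)
  obtain b where b: "y < of_rat b" "of_rat b < y + min d (e / 2)"
    using of_rat_dense[of y "y + min d (e / 2)"] d e by auto
  show thesis
  proof (rule that[of m b])
    show "?\<kappa> < circle_cos (of_rat b) c" unfolding y circle_cos_abs using b by (intro d) auto
    fix c' assume c': "?\<kappa> < circle_cos (of_rat b) c'"
    obtain x where x: "c' = abs_circle x" using abs_circle_surj by blast
    have "cos (2 * pi * r) < cos (2 * pi * (x - of_rat b))" using c' m unfolding x circle_cos_abs by linarith
    then obtain j where j: "\<bar>x - of_rat b - of_int j\<bar> < r" using cos_gt_imp_near_int r by (metis less_imp_le)
    then have "abs_circle (x - of_int j) \<in> U" using b r by (intro e) auto
    moreover have "abs_circle (x - of_int j) = c'" unfolding x abs_circle_eq_iff by simp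
    ultimately show "c' \<in> U" by simp
  qed
qed

locale annulus_map =
  fixes g :: "circle \<times> real \<Rightarrow> circle \<times> real"
  assumes maps: "g \<in> annulus \<rightarrow> annulus" and cont: "continuous_on annulus g"
begin

lemma iterate_in: "z \<in> annulus \<Longrightarrow> (g ^^ n) z \<in> annulus"
  using maps by (induction n) auto

lemma iterate_cont: "continuous_on annulus (g ^^ n)"
proof (induction n)
  case (Suc n)
  have "continuous_on annulus (\<lambda>z. g ((g ^^ n) z))"
    by (rule continuous_on_compose2[OF cont Suc]) (use iterate_in in auto)
  then show ?case by (simp add: o_def)
qed (simp add: continuous_on_id)

definition attracted :: "real \<Rightarrow> (circle \<times> real) set" where
  "attracted L = {z \<in> annulus. (\<lambda>n. snd ((g ^^ n) z)) \<longlonglongrightarrow> L}"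

definition visits_every_arc :: "(circle \<times> real) set" where
  "visits_every_arc = {z \<in> annulus. \<forall>(b::rat) (m::nat).
     \<exists>\<^sub>\<infinity>n. 1 - 1 / real (m + 1) < circle_cos (of_rat b) (fst ((g ^^ n) z))}"

lemma omega_limit_iff:
  "p \<in> omega_limit g z \<longleftrightarrow> (\<forall>U. open U \<longrightarrow> p \<in> U \<longrightarrow> (\<exists>\<^sub>\<infinity>n. (g ^^ n) z \<in> U))"
proof
  assume p: "p \<in> omega_limit g z"
  show "\<forall>U. open U \<longrightarrow> p \<in> U \<longrightarrow> (\<exists>\<^sub>\<infinity>n. (g ^^ n) z \<in> U)"
  proof (intro allI impI)
    fix U assume U: "open U" "p \<in> U"
    show "\<exists>\<^sub>\<infinity>n. (g ^^ n) z \<in> U"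
      unfolding INFM_nat_le
    proof
      fix k
      have "p \<in> closure (\<Union>l\<in>{k..}. {(g ^^ l) z})" using p by (auto simp: omega_limit_def)
      then show "\<exists>n\<ge>k. (g ^^ n) z \<in> U" using U open_Int_closure_eq_empty[OF U(1)] by fastforce
    qed
  qed
next
  assume *: "\<forall>U. open U \<longrightarrow> p \<in> U \<longrightarrow> (\<exists>\<^sub>\<infinity>n. (g ^^ n) z \<in> U)"
  show "p \<in> omega_limit g z"
    unfolding omega_limit_def
  proof
    fix k
    show "p \<in> closure (\<Union>l\<in>{k..}. {(g ^^ l) z})"
      unfolding closure_iff_nhds_not_empty
    proof (intro allI impI)
      fix A V assume "V \<subseteq> A" "open V" "p \<in> V"
      then obtain n where "n \<ge> k" "(g ^^ n) z \<in> V" using * unfolding INFM_nat_le by blast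
      then show "(\<Union>l\<in>{k..}. {(g ^^ l) z}) \<inter> A \<noteq> {}" using \<open>V \<subseteq> A\<close> by auto
    qed
  qed
qed

text \<open>If the heights stayed away from \<open>L\<close> infinitely often, compactness of the annulus would give a limit
  point off the level.\<close>

lemma omega_limit_subset_level_iff:
  assumes z: "z \<in> annulus"
  shows "omega_limit g z \<subseteq> UNIV \<times> {L} \<longleftrightarrow> (\<lambda>n. snd ((g ^^ n) z)) \<longlonglongrightarrow> L"
proof
  assume lim: "(\<lambda>n. snd ((g ^^ n) z)) \<longlonglongrightarrow> L"
  show "omega_limit g z \<subseteq> UNIV \<times> {L}"
  proof
    fix p assume p: "p \<in> omega_limit g z"
    have "snd p = L"
    proof (rule ccontr)
      assume ne: "snd p \<noteq> L"
      from hausdorff[OF ne] obtain U V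
        where UV: "open U" "open V" "snd p \<in> U" "L \<in> V" "U \<inter> V = {}" by auto
      have "open (UNIV \<times> U :: (circle \<times> real) set)" "p \<in> UNIV \<times> U" using UV by (auto intro: open_Times simp: mem_Times_iff)
      then have "\<exists>\<^sub>\<infinity>n. (g ^^ n) z \<in> UNIV \<times> U" using p unfolding omega_limit_iff by blast
      moreover have "\<forall>\<^sub>\<infinity>n. snd ((g ^^ n) z) \<in> V"
        using topological_tendstoD[OF lim UV(2,4)] by (simp add: cofinite_eq_sequentially)
      ultimately have "\<exists>\<^sub>\<infinity>n. (g ^^ n) z \<in> UNIV \<times> U \<and> snd ((g ^^ n) z) \<in> V"
        by (rule INFM_conjI)
      then show False using UV(5) by (auto simp: mem_Times_iff dest!: INFM_EX)
    qed
    then show "p \<in> UNIV \<times> {L}" by (simp add: mem_Times_iff)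
  qed
next
  assume sub: "omega_limit g z \<subseteq> UNIV \<times> {L}"
  show "(\<lambda>n. snd ((g ^^ n) z)) \<longlonglongrightarrow> L"
  proof (rule ccontr)
    assume "\<not> (\<lambda>n. snd ((g ^^ n) z)) \<longlonglongrightarrow> L"
    then obtain e where e: "0 < e" "\<And>k. \<exists>n\<ge>k. e \<le> dist (snd ((g ^^ n) z)) L"
      unfolding lim_sequentially by (auto simp: not_less)
    define far where "far = {p :: circle \<times> real. e \<le> dist (snd p) L}"
    have far: "closed far" unfolding far_def by (intro closed_Collect_le continuous_intros)
    define K where "K k = closure {(g ^^ n) z | n. k \<le> n \<and> (g ^^ n) z \<in> far}" for k
    have "annulus \<inter> \<Inter> (range K) \<noteq> {}"
    proof (rule compact_imp_fip[OF compact_annulus])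
      fix F' assume F': "finite F'" "F' \<subseteq> range K"
      then obtain I where I: "finite I" "F' = K ` I" using finite_subset_image by metis
      obtain n where n: "n \<ge> Max (insert 0 I)" "(g ^^ n) z \<in> far" using e(2) by (auto simp: far_def)
      have "(g ^^ n) z \<in> K k" if "k \<in> I" for k
      proof -
        have "k \<le> Max (insert 0 I)" using I(1) that by (intro Max_ge) auto
        then show ?thesis unfolding K_def using n by (intro subsetD[OF closure_subset]) auto
      qed
      then show "annulus \<inter> \<Inter> F' \<noteq> {}" using iterate_in[OF z, of n] I by auto
    qed (auto simp: K_def)
    then obtain p where p: "\<And>k. p \<in> K k" by auto
    have "K 0 \<subseteq> far" unfolding K_def by (intro closure_minimal far) auto
    then have "p \<in> far" using p by blast
    moreover have "p \<in> omega_limit g z"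
      unfolding omega_limit_def
    proof
      fix k
      have "K k \<subseteq> closure (\<Union>l\<in>{k..}. {(g ^^ l) z})" unfolding K_def by (intro closure_mono) auto
      then show "p \<in> closure (\<Union>l\<in>{k..}. {(g ^^ l) z})" using p by blast
    qed
    then have "snd p = L" using sub by (auto simp: mem_Times_iff)
    ultimately show False using e(1) by (simp add: far_def)
  qed
qed

lemma basin_level: "basin annulus_measure g (UNIV \<times> {L}) = attracted L"
  unfolding basin_def attracted_def space_annulus_measure
  using omega_limit_subset_level_iff by (intro Collect_cong) blast

text \<open>Together with \<open>basin_level\<close> this describes attractors and basins by countably many conditions on
  continuous functions, from which measurability follows.\<close>

lemma omega_limit_eq_level:
  "{z \<in> annulus. omega_limit g z = UNIV \<times> {L}} = attracted L \<inter> visits_every_arc"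
proof (intro set_eqI iffI)
  fix z assume "z \<in> {z \<in> annulus. omega_limit g z = UNIV \<times> {L}}"
  then have z: "z \<in> annulus" and eq: "omega_limit g z = UNIV \<times> {L}" by auto
  have "\<exists>\<^sub>\<infinity>n. 1 - 1 / real (m + 1) < circle_cos (of_rat b) (fst ((g ^^ n) z))" for b :: rat and m
  proof -
    let ?U = "{c. 1 - 1 / real (m + 1) < circle_cos (of_rat b) c}"
    have "open ?U" by (intro open_Collect_less continuous_on_circle_cos continuous_on_const)
    then have "open (?U \<times> (UNIV :: real set))" by (intro open_Times) auto
    moreover have "(abs_circle (of_rat b), L) \<in> ?U \<times> UNIV" by (simp add: circle_cos_abs)
    moreover have "(abs_circle (of_rat b), L) \<in> omega_limit g z" by (simp add: eq)
    ultimately have "\<exists>\<^sub>\<infinity>n. (g ^^ n) z \<in> ?U \<times> UNIV" unfolding omega_limit_iff by blast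
    then show ?thesis by (simp add: mem_Times_iff)
  qed
  then show "z \<in> attracted L \<inter> visits_every_arc"
    using z eq omega_limit_subset_level_iff[OF z, of L] by (auto simp: attracted_def visits_every_arc_def)
next
  fix z assume "z \<in> attracted L \<inter> visits_every_arc"
  then have z: "z \<in> annulus" and lim: "(\<lambda>n. snd ((g ^^ n) z)) \<longlonglongrightarrow> L"
    and visits: "\<And>(b::rat) (m::nat). \<exists>\<^sub>\<infinity>n. 1 - 1 / real (m + 1) < circle_cos (of_rat b) (fst ((g ^^ n) z))"
    by (auto simp: attracted_def visits_every_arc_def)
  have "(c, L) \<in> omega_limit g z" for c
    unfolding omega_limit_iff
  proof (intro allI impI)
    fix Q assume Q: "open Q" "(c, L) \<in> Q"
    from open_prod_elim[OF Q] obtain U V where UV: "open U" "open V" "(c, L) \<in> U \<times> V" "U \<times> V \<subseteq> Q" .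
    then have "c \<in> U" by simp
    from ex_arc_in_open[OF UV(1) this] obtain b :: rat and m
      where bm: "\<And>c'. 1 - 1 / real (m + 1) < circle_cos (of_rat b) c' \<Longrightarrow> c' \<in> U" by metis
    have "\<forall>\<^sub>\<infinity>n. snd ((g ^^ n) z) \<in> V"
      using topological_tendstoD[OF lim UV(2)] UV(3) by (simp add: cofinite_eq_sequentially)
    with visits[of m b] have "\<exists>\<^sub>\<infinity>n. 1 - 1 / real (m + 1) < circle_cos (of_rat b) (fst ((g ^^ n) z)) \<and> snd ((g ^^ n) z) \<in> V"
      by (rule INFM_conjI)
    then show "\<exists>\<^sub>\<infinity>n. (g ^^ n) z \<in> Q"
      by (rule INFM_mono) (metis bm UV(4) mem_Times_iff subsetD)
  qed
  then show "z \<in> {z \<in> annulus. omega_limit g z = UNIV \<times> {L}}"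
    using z lim omega_limit_subset_level_iff[OF z, of L] by auto
qed

lemma borel_attracted: "attracted L \<in> sets borel"
  and borel_visits_every_arc: "visits_every_arc \<in> sets borel"
proof -
  let ?M = "restrict_space borel annulus :: (circle \<times> real) measure"
  have to_borel: "E \<in> sets borel" if "E \<in> sets ?M" for E
    using that closed_annulus by (auto simp: sets_restrict_space)
  have [measurable]: "(\<lambda>z. snd ((g ^^ n) z)) \<in> borel_measurable ?M" for n
    by (intro borel_measurable_continuous_on_restrict continuous_on_snd iterate_cont)
  have [measurable]: "(\<lambda>z. circle_cos b (fst ((g ^^ n) z))) \<in> borel_measurable ?M" for n b
    by (intro borel_measurable_continuous_on_restrict continuous_on_compose2[OF continuous_on_circle_cos]
        continuous_on_fst iterate_cont) auto
  have sp: "space ?M = annulus" by (simp add: space_restrict_space)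
  have "{z \<in> space ?M. \<forall>i::nat. \<exists>k. \<forall>n\<ge>k. \<bar>snd ((g ^^ n) z) - L\<bar> < 1 / real (Suc i)} \<in> sets ?M"
    by measurable
  also have "{z \<in> space ?M. \<forall>i::nat. \<exists>k. \<forall>n\<ge>k. \<bar>snd ((g ^^ n) z) - L\<bar> < 1 / real (Suc i)} = attracted L"
  proof -
    have "u \<longlonglongrightarrow> L \<longleftrightarrow> (\<forall>i::nat. \<exists>k. \<forall>n\<ge>k. \<bar>u n - L\<bar> < 1 / real (Suc i))" for u :: "nat \<Rightarrow> real"
    proof
      assume "u \<longlonglongrightarrow> L"
      then show "\<forall>i::nat. \<exists>k. \<forall>n\<ge>k. \<bar>u n - L\<bar> < 1 / real (Suc i)"
        by (auto simp: LIMSEQ_iff)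
    next
      assume *: "\<forall>i::nat. \<exists>k. \<forall>n\<ge>k. \<bar>u n - L\<bar> < 1 / real (Suc i)"
      show "u \<longlonglongrightarrow> L"
        unfolding LIMSEQ_iff
      proof (intro allI impI)
        fix r :: real assume "0 < r"
        then obtain i where "1 / real (Suc i) < r" using nat_approx_posE by blast
        moreover obtain k where "\<forall>n\<ge>k. \<bar>u n - L\<bar> < 1 / real (Suc i)" using * by blast
        ultimately show "\<exists>k. \<forall>n\<ge>k. norm (u n - L) < r" by (auto intro: less_trans)
      qed
    qed
    then show ?thesis unfolding attracted_def sp by simp
  qed
  finally show "attracted L \<in> sets borel" by (rule to_borel)
  have "{z \<in> space ?M. \<forall>(b::rat) (m::nat). \<forall>k. \<exists>n\<ge>k. 1 - 1 / real (m + 1) < circle_cos (of_rat b) (fst ((g ^^ n) z))} \<in> sets ?M"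
    by measurable
  then show "visits_every_arc \<in> sets borel"
    unfolding visits_every_arc_def INFM_nat_le by (intro to_borel) (simp only: sp)
qed

end

abbreviation horizontal_section :: "(circle \<times> real) set \<Rightarrow> real \<Rightarrow> real set" where
  "horizontal_section E t \<equiv> {x \<in> {0..<1}. t \<in> {0..1} \<and> covering (x, t) \<in> E}"

text \<open>Fubini's theorem in the fundamental domain.\<close>

lemma emeasure_annulus_sections:
  assumes E: "E \<in> sets borel" "E \<subseteq> annulus"
  shows "emeasure annulus_measure E
    = (\<integral>\<^sup>+t. emeasure lborel (horizontal_section E t) \<partial>lborel)"
    and "(\<lambda>t. emeasure lborel (horizontal_section E t)) \<in> borel_measurable lborel"
    and "horizontal_section E t \<in> sets lborel"
proof -
  let ?P = "{z \<in> {0..<1} \<times> {0..1}. covering z \<in> E}"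
  have "covering \<in> borel \<rightarrow>\<^sub>M borel"
    by (rule borel_measurable_continuous_onI[OF continuous_on_covering])
  then have "covering -` E \<inter> space borel \<in> sets borel" using E(1) by (rule measurable_sets)
  moreover have "({0..<1} \<times> {0..1} :: (real \<times> real) set) \<in> sets borel" by (simp add: borel_Times)
  moreover have "?P = (covering -` E \<inter> space borel) \<inter> ({0..<1} \<times> {0..1})" by auto
  ultimately have P: "?P \<in> sets borel" by (metis sets.Int)
  then have P': "?P \<in> sets (lborel \<Otimes>\<^sub>M lborel)" unfolding lborel_prod by simp
  have sec: "(\<lambda>x. (x, t)) -` ?P = horizontal_section E t" for t by auto
  have "emeasure annulus_measure E = emeasure lborel ?P"
    unfolding emeasure_annulus_measure[OF E] using P by simp
  also have "\<dots> = emeasure (lborel \<Otimes>\<^sub>M lborel) ?P" by (simp add: lborel_prod)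
  also have "\<dots> = (\<integral>\<^sup>+t. emeasure lborel ((\<lambda>x. (x, t)) -` ?P) \<partial>lborel)"
    by (rule lborel_pair.emeasure_pair_measure_alt2[OF P'])
  finally show "emeasure annulus_measure E
    = (\<integral>\<^sup>+t. emeasure lborel (horizontal_section E t) \<partial>lborel)"
    unfolding sec .
  show "(\<lambda>t. emeasure lborel (horizontal_section E t)) \<in> borel_measurable lborel"
    using lborel_pair.measurable_emeasure_Pair2[OF P'] unfolding sec .
  show "horizontal_section E t \<in> sets lborel"
    using sets_Pair2[OF P', of t] unfolding sec .
qed

lemma annulus_null_if_sections_null:
  assumes E: "E \<in> sets borel" "E \<subseteq> annulus"
    and null: "\<And>t. 0 < t \<Longrightarrow> t < 1 \<Longrightarrow> AE x in lborel. covering (x, t) \<notin> E"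
  shows "emeasure annulus_measure E = 0"
proof -
  have "AE t in lborel. t \<noteq> 0" "AE t in lborel. t \<noteq> (1::real)" by (rule AE_lborel_singleton)+
  then have "AE t in lborel. emeasure lborel (horizontal_section E t) = 0"
  proof eventually_elim
    case (elim t)
    show ?case
    proof (cases "t \<in> {0..1}")
      case True
      then have "AE x in lborel. covering (x, t) \<notin> E" using elim by (intro null) auto
      then have "AE x in lborel. x \<notin> horizontal_section E t"
        by eventually_elim auto
      then show ?thesis
        by (subst (asm) AE_iff_measurable[OF emeasure_annulus_sections(3)[OF E, of t]]) auto
    qed auto
  qed
  then show ?thesis
    unfolding emeasure_annulus_sections(1)[OF E] nn_integral_0_iff_AE[OF emeasure_annulus_sections(2)[OF E]] .
qed

lemma annulus_pos_if_sections_pos: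
  assumes E: "E \<in> sets borel" "E \<subseteq> annulus"
    and rect: "0 \<le> l" "r \<le> 1" "0 \<le> a" "a < b" "b \<le> 1"
    and pos: "\<And>t. a < t \<Longrightarrow> t < b \<Longrightarrow> \<not> (AE x in lborel. x \<in> {l..r} \<longrightarrow> covering (x, t) \<notin> E)"
  shows "0 < emeasure annulus_measure E"
proof (rule ccontr)
  assume "\<not> 0 < emeasure annulus_measure E"
  then have "(\<integral>\<^sup>+t. emeasure lborel (horizontal_section E t) \<partial>lborel) = 0"
    using emeasure_annulus_sections(1)[OF E] by simp
  then have "AE t in lborel. emeasure lborel (horizontal_section E t) = 0"
    unfolding nn_integral_0_iff_AE[OF emeasure_annulus_sections(2)[OF E]] .
  then have "AE t in lborel. t \<notin> {a<..<b}"
  proof eventually_elim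
    case (elim t)
    show ?case
    proof
      assume t: "t \<in> {a<..<b}"
      have "AE x in lborel. x \<notin> horizontal_section E t"
        by (rule AE_not_in[OF null_setsI[OF elim emeasure_annulus_sections(3)[OF E]]])
      moreover have "AE x in lborel. x \<noteq> (1::real)" by (rule AE_lborel_singleton)
      ultimately have "AE x in lborel. x \<in> {l..r} \<longrightarrow> covering (x, t) \<notin> E"
        by eventually_elim (use rect t in auto)
      then show False using pos[of t] t by simp
    qed
  qed
  then have "emeasure lborel {a<..<b} = 0"
    by (subst (asm) AE_iff_measurable[where N = "{a<..<b}"]) auto
  then show False using rect by simp
qed

section \<open>Intermingled basins of the boundary circles\<close>

lemma (in horizontal_line) lift_orbit:
  assumes "is_lift (\<lambda>z. (F (fst z) (snd z), G (fst z) (snd z))) g"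
  shows "(g ^^ n) (covering (x, t\<^sub>0)) = covering (X n x, T n x)"
proof (induction n)
  case (Suc n)
  have "(X n x, T n x) \<in> strip" using T_in' by (simp add: strip_def)
  with assms have "covering (F (X n x) (T n x), G (X n x) (T n x)) = g (covering (X n x, T n x))"
    unfolding is_lift_def by (metis fst_conv snd_conv)
  then show ?case using Suc by simp
qed simp

locale intermingling_map = near_kan + annulus_map +
  assumes lift: "is_lift (\<lambda>z. (F (fst z) (snd z), G (fst z) (snd z))) g"
begin

lemma
  assumes t: "0 < t" "t < 1"
  shows AE_section_attracted: "AE x in lborel. covering (x, t) \<in> attracted 0 \<union> attracted 1"
    and AE_section_visits: "AE x in lborel. covering (x, t) \<in> visits_every_arc"
    and not_AE_section_avoids: "l < r \<Longrightarrow> L = 0 \<or> L = 1 \<Longrightarrow>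
      \<not> (AE x in lborel. x \<in> {l..r} \<longrightarrow> covering (x, t) \<notin> attracted L)"
proof -
  interpret horizontal_line F G Fx Ft Gx Gt N \<beta> t by unfold_locales (fact t)+
  have att: "covering (x, t) \<in> attracted L \<longleftrightarrow> (\<lambda>n. T n x) \<longlonglongrightarrow> L" for x L
    using t by (simp add: attracted_def lift_orbit[OF lift] covering_in_annulus_iff strip_def)
       (simp add: covering_def)
  show "AE x in lborel. covering (x, t) \<in> attracted 0 \<union> attracted 1"
    using AE_T_limit by (simp add: att)
  have "AE x in lborel. \<forall>(b::rat) (m::nat). \<exists>\<^sub>\<infinity>n. 1 - 1 / real (m + 1) < cos (2 * pi * (X n x - of_rat b))"
    unfolding AE_all_countable by (intro allI AE_visits_arc) auto
  then show "AE x in lborel. covering (x, t) \<in> visits_every_arc"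
    using t by (simp add: visits_every_arc_def lift_orbit[OF lift] covering_in_annulus_iff strip_def)
       (simp add: covering_def circle_cos_abs)
  show "\<not> (AE x in lborel. x \<in> {l..r} \<longrightarrow> covering (x, t) \<notin> attracted L)" if "l < r" "L = 0 \<or> L = 1"
    using not_AE_avoids_limit[OF that] by (simp add: att)
qed

lemma attracted_sub: "attracted L \<subseteq> annulus" by (auto simp: attracted_def)

lemma attractor_level:
  assumes "L = 0 \<or> L = 1"
  shows "attractor annulus_measure g (UNIV \<times> {L})"
  unfolding attractor_def space_annulus_measure omega_limit_eq_level
proof (intro conjI compact_level)
  show "UNIV \<times> {L} \<subseteq> annulus" using assms by (auto simp: annulus_def)
  show "0 < emeasure annulus_measure (attracted L \<inter> visits_every_arc)"
  proof (rule annulus_pos_if_sections_pos[where l = 0 and r = 1 and a = 0 and b = 1])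
    show "attracted L \<inter> visits_every_arc \<in> sets borel"
      by (intro sets.Int borel_attracted borel_visits_every_arc)
    show "attracted L \<inter> visits_every_arc \<subseteq> annulus" using attracted_sub by auto
    fix t :: real assume t: "0 < t" "t < 1"
    show "\<not> (AE x in lborel. x \<in> {0..1} \<longrightarrow> covering (x, t) \<notin> attracted L \<inter> visits_every_arc)"
    proof
      assume "AE x in lborel. x \<in> {0..1} \<longrightarrow> covering (x, t) \<notin> attracted L \<inter> visits_every_arc"
      with AE_section_visits[OF t] have "AE x in lborel. x \<in> {0..1} \<longrightarrow> covering (x, t) \<notin> attracted L"
        by eventually_elim auto
      then show False using not_AE_section_avoids[OF t, of 0 1 L] assms by simp
    qed
  qed auto
qed

lemma AE_attracted: "AE x in annulus_measure. x \<in> attracted 0 \<union> attracted 1"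
proof (rule AE_I)
  let ?N = "annulus - (attracted 0 \<union> attracted 1)"
  have N: "?N \<in> sets borel" by (intro sets.Diff sets.Un borel_attracted borel_closed closed_annulus)
  show "{x \<in> space annulus_measure. \<not> x \<in> attracted 0 \<union> attracted 1} \<subseteq> ?N"
    by (auto simp: space_annulus_measure)
  show "emeasure annulus_measure ?N = 0"
  proof (rule annulus_null_if_sections_null[OF N])
    fix t :: real assume t: "0 < t" "t < 1"
    show "AE x in lborel. covering (x, t) \<notin> ?N"
      using AE_section_attracted[OF t] by eventually_elim auto
  qed auto
  show "?N \<in> sets annulus_measure"
    unfolding annulus_measure_def sets_distr sets_restrict_space using N by (auto intro!: image_eqI[of _ _ ?N])
qed

lemma open_meets_attracted:
  assumes W: "openin (top_of_set annulus) W" "W \<noteq> {}" and L: "L = 0 \<or> L = 1"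
  shows "0 < emeasure annulus_measure (W \<inter> attracted L)"
proof -
  obtain Q where Q: "open Q" "W = annulus \<inter> Q" using W(1) by (auto simp: openin_open)
  then obtain p where p: "p \<in> annulus" "p \<in> Q" using W(2) by blast
  obtain x where x: "0 \<le> x" "x < 1" "fst p = abs_circle x" using abs_circle_surj by blast
  have h: "0 \<le> snd p" "snd p \<le> 1" using p(1) by (auto simp: annulus_def)
  have "open (covering -` Q)" by (rule open_vimage[OF Q(1) continuous_on_covering])
  moreover have "(x, snd p) \<in> covering -` Q" using p(2) x by (simp add: covering_def flip: x(3))
  ultimately obtain A B where AB: "open A" "open B" "(x, snd p) \<in> A \<times> B" "A \<times> B \<subseteq> covering -` Q"
    by (rule open_prod_elim)
  obtain d where d: "0 < d" "\<And>y. \<bar>y - x\<bar> < d \<Longrightarrow> y \<in> A"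
    using AB(1,3) unfolding open_dist dist_real_def by auto
  obtain e where e: "0 < e" "\<And>y. \<bar>y - snd p\<bar> < e \<Longrightarrow> y \<in> B"
    using AB(2,3) unfolding open_dist dist_real_def by auto
  define r where "r = min 1 (x + d / 2)"
  define a where "a = max 0 (snd p - e)"
  define b where "b = min 1 (snd p + e)"
  have lr: "x < r" "r \<le> 1" "\<And>y. y \<in> {x..r} \<Longrightarrow> y \<in> A" using x d by (auto simp: r_def)
  have ab: "0 \<le> a" "a < b" "b \<le> 1" "\<And>t. a < t \<Longrightarrow> t < b \<Longrightarrow> t \<in> B" using h e by (auto simp: a_def b_def)
  show ?thesis
  proof (rule annulus_pos_if_sections_pos[OF _ _ x(1) lr(2) ab(1-3)])
    show "W \<inter> attracted L \<in> sets borel"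
      unfolding Q(2) by (intro sets.Int borel_attracted borel_open[OF Q(1)] borel_closed closed_annulus)
    show "W \<inter> attracted L \<subseteq> annulus" using attracted_sub by auto
    fix t assume t: "a < t" "t < b"
    show "\<not> (AE x' in lborel. x' \<in> {x..r} \<longrightarrow> covering (x', t) \<notin> W \<inter> attracted L)"
    proof
      assume "AE x' in lborel. x' \<in> {x..r} \<longrightarrow> covering (x', t) \<notin> W \<inter> attracted L"
      then have "AE x' in lborel. x' \<in> {x..r} \<longrightarrow> covering (x', t) \<notin> attracted L"
      proof eventually_elim
        case (elim x')
        show ?case
        proof (intro impI notI)
          assume x': "x' \<in> {x..r}" and att: "covering (x', t) \<in> attracted L"
          have "(x', t) \<in> A \<times> B" using lr(3)[OF x'] ab(4)[OF t] by simp
          then have "covering (x', t) \<in> W" using AB(4) Q(2) att attracted_sub by auto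
          then show False using elim x' att by simp
        qed
      qed
      then show False using not_AE_section_avoids[of t x r L] t ab lr L by simp
    qed
  qed
qed

theorem intermingled_boundary_circles:
  "\<exists>A B. attractor annulus_measure g A \<and> attractor annulus_measure g B \<and> A \<inter> B = {} \<and>
    intermingled annulus_measure {basin annulus_measure g A, basin annulus_measure g B} \<and>
    (AE x in annulus_measure. x \<in> basin annulus_measure g A \<union> basin annulus_measure g B)"
proof (intro exI conjI)
  let ?A = "UNIV \<times> {0} :: (circle \<times> real) set" and ?B = "UNIV \<times> {1} :: (circle \<times> real) set"
  show "attractor annulus_measure g ?A" "attractor annulus_measure g ?B"
    by (rule attractor_level; simp)+
  show "?A \<inter> ?B = {}" by auto
  show "AE x in annulus_measure. x \<in> basin annulus_measure g ?A \<union> basin annulus_measure g ?B"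
    unfolding basin_level by (rule AE_attracted)
  show "intermingled annulus_measure {basin annulus_measure g ?A, basin annulus_measure g ?B}"
    unfolding intermingled_def basin_level space_annulus_measure
  proof (intro allI ballI impI)
    fix W P Q
    assume W: "openin (top_of_set annulus) W" and PQ: "P \<in> {attracted 0, attracted 1}" "Q \<in> {attracted 0, attracted 1}"
      and pos: "0 < emeasure annulus_measure (W \<inter> P)"
    have "W \<noteq> {}" using pos by auto
    then show "0 < emeasure annulus_measure (W \<inter> Q)" using open_meets_attracted[OF W] PQ by auto
  qed
qed

end

section \<open>The \<open>C\<^sup>k\<close> distance\<close>

abbreviation strip_derivative :: "(real \<times> real \<Rightarrow> 'b::real_normed_vector) \<Rightarrow> real \<times> real \<Rightarrow> real \<times> real \<Rightarrow> 'b" where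
  "strip_derivative f z \<equiv> frechet_derivative f (at z within strip)"

lemma frechet_derivative_strip:
  assumes z: "z \<in> strip" and f: "(f has_derivative f') (at z within strip)"
  shows "strip_derivative f z = f'"
proof (rule frechet_derivative_unique_within)
  show "(f has_derivative strip_derivative f z) (at z within strip)"
    using f by (auto simp: differentiable_def frechet_derivative_works[symmetric])
  show "(f has_derivative f') (at z within strip)" by fact
  fix i :: "real \<times> real" and e :: real
  assume i: "i \<in> Basis" and e: "0 < e"
  define d where "d = (if snd z \<le> 1 / 2 then min (e / 2) (1 / 2) else - min (e / 2) (1 / 2))"
  have "0 < \<bar>d\<bar>" "\<bar>d\<bar> < e" using e by (auto simp: d_def)
  moreover have "z + d *\<^sub>R i \<in> strip"
    using z e i by (auto simp: strip_def d_def Basis_prod_def mem_Times_iff min_def)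
  ultimately show "\<exists>d. 0 < \<bar>d\<bar> \<and> \<bar>d\<bar> < e \<and> z + d *\<^sub>R i \<in> strip" by blast
qed

lemma frechet_derivative_strip_works:
  "f differentiable (at z within strip) \<Longrightarrow>
    (f has_derivative strip_derivative f z) (at z within strip)"
  by (simp add: frechet_derivative_works)

lemma has_derivative_cong_on:
  assumes "z \<in> S" "\<And>x. x \<in> S \<Longrightarrow> f x = g x"
  shows "(f has_derivative D) (at z within S) \<longleftrightarrow> (g has_derivative D) (at z within S)"
  by (metis assms has_derivative_transform)

lemma frechet_derivative_cong_on:
  assumes "z \<in> S" "\<And>x. x \<in> S \<Longrightarrow> f x = g x"
  shows "frechet_derivative f (at z within S) = frechet_derivative g (at z within S)"
  unfolding frechet_derivative_def using has_derivative_cong_on[OF assms] by simp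

lemma continuously_differentiable_cong_on:
  assumes "\<And>x. x \<in> S \<Longrightarrow> f x = g x"
  shows "continuously_differentiable r S f \<longleftrightarrow> continuously_differentiable r S g"
  using assms
proof (induction r arbitrary: f g)
  case 0
  then show ?case by (simp cong: continuous_on_cong)
next
  case (Suc r)
  have "f differentiable (at z within S) \<longleftrightarrow> g differentiable (at z within S)" if "z \<in> S" for z
    using has_derivative_cong_on[OF that Suc.prems] by (simp add: differentiable_def)
  moreover have "continuously_differentiable r S (\<lambda>z. frechet_derivative f (at z within S) v) \<longleftrightarrow>
      continuously_differentiable r S (\<lambda>z. frechet_derivative g (at z within S) v)" for v
    by (rule Suc.IH) (simp add: frechet_derivative_cong_on[OF _ Suc.prems])
  ultimately show ?case by simp
qed

lemma iterated_derivative_cong_on: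
  assumes "\<And>x. x \<in> S \<Longrightarrow> f x = g x" "z \<in> S"
  shows "iterated_derivative S vs f z = iterated_derivative S vs g z"
  using assms
proof (induction vs arbitrary: f g)
  case (Cons v vs)
  show ?case
    unfolding iterated_derivative.simps
    by (rule Cons.IH) (simp_all add: frechet_derivative_cong_on[OF _ Cons.prems(1)] Cons.prems(2))
qed simp

lemma frechet_derivative_lincomb:
  assumes "z \<in> strip" "f differentiable (at z within strip)" "g differentiable (at z within strip)"
  shows "((\<lambda>z. a *\<^sub>R f z + b *\<^sub>R g z) has_derivative
      (\<lambda>v. a *\<^sub>R strip_derivative f z v + b *\<^sub>R strip_derivative g z v))
      (at z within strip)"
    and "strip_derivative (\<lambda>z. a *\<^sub>R f z + b *\<^sub>R g z) z v
      = a *\<^sub>R strip_derivative f z v + b *\<^sub>R strip_derivative g z v"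
proof -
  show *: "((\<lambda>z. a *\<^sub>R f z + b *\<^sub>R g z) has_derivative
      (\<lambda>v. a *\<^sub>R strip_derivative f z v + b *\<^sub>R strip_derivative g z v))
      (at z within strip)"
    using assms by (intro has_derivative_add has_derivative_scaleR_right frechet_derivative_strip_works)
  show "strip_derivative (\<lambda>z. a *\<^sub>R f z + b *\<^sub>R g z) z v
      = a *\<^sub>R strip_derivative f z v + b *\<^sub>R strip_derivative g z v"
    using frechet_derivative_strip[OF assms(1) *] by simp
qed

lemma continuously_differentiable_lincomb:
  assumes "continuously_differentiable r strip f" "continuously_differentiable r strip g"
  shows "continuously_differentiable r strip (\<lambda>z. a *\<^sub>R f z + b *\<^sub>R g z)"
  using assms
proof (induction r arbitrary: f g)
  case 0
  then show ?case by (auto intro!: continuous_intros)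
next
  case (Suc r)
  have "continuously_differentiable r strip (\<lambda>z. strip_derivative (\<lambda>z. a *\<^sub>R f z + b *\<^sub>R g z) z v)" for v
  proof (subst continuously_differentiable_cong_on)
    show "strip_derivative (\<lambda>z. a *\<^sub>R f z + b *\<^sub>R g z) z v
      = a *\<^sub>R strip_derivative f z v + b *\<^sub>R strip_derivative g z v"
      if "z \<in> strip" for z using Suc.prems that by (intro frechet_derivative_lincomb) auto
    show "continuously_differentiable r strip (\<lambda>z. a *\<^sub>R strip_derivative f z v
        + b *\<^sub>R strip_derivative g z v)"
      using Suc.prems by (intro Suc.IH) (simp_all only: continuously_differentiable.simps)
  qed
  moreover have "(\<lambda>z. a *\<^sub>R f z + b *\<^sub>R g z) differentiable (at z within strip)" if "z \<in> strip" for z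
    using frechet_derivative_lincomb(1)[of z f g a b] Suc.prems that unfolding differentiable_def[of "\<lambda>z. a *\<^sub>R f z + b *\<^sub>R g z"]
    by auto
  ultimately show ?case by simp
qed

lemma iterated_derivative_lincomb:
  assumes "continuously_differentiable r strip f" "continuously_differentiable r strip g"
    "length vs \<le> r" "z \<in> strip"
  shows "iterated_derivative strip vs (\<lambda>z. a *\<^sub>R f z + b *\<^sub>R g z) z
    = a *\<^sub>R iterated_derivative strip vs f z + b *\<^sub>R iterated_derivative strip vs g z"
  using assms
proof (induction vs arbitrary: f g r)
  case (Cons v vs)
  then obtain r' where r: "r = Suc r'" by (cases r) auto
  have "iterated_derivative strip vs (\<lambda>z. strip_derivative (\<lambda>z. a *\<^sub>R f z + b *\<^sub>R g z) z v) z
    = iterated_derivative strip vs (\<lambda>z. a *\<^sub>R strip_derivative f z v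
        + b *\<^sub>R strip_derivative g z v) z"
    using Cons.prems r by (intro iterated_derivative_cong_on frechet_derivative_lincomb) auto
  also have "\<dots> = a *\<^sub>R iterated_derivative strip vs (\<lambda>z. strip_derivative f z v) z
      + b *\<^sub>R iterated_derivative strip vs (\<lambda>z. strip_derivative g z v) z"
    using Cons.prems unfolding r
    by (intro Cons.IH[of r']) (simp_all only: continuously_differentiable.simps length_Cons Suc_le_mono)
  finally show ?case by simp
qed simp

lemma frechet_derivative_strip_const:
  "z \<in> strip \<Longrightarrow> strip_derivative (\<lambda>z. c) z v = 0"
  by (simp add: frechet_derivative_strip[OF _ has_derivative_const])

lemma continuously_differentiable_const: "continuously_differentiable r strip (\<lambda>z. c)"
proof (induction r arbitrary: c)
  case (Suc r)
  have "continuously_differentiable r strip (\<lambda>z. strip_derivative (\<lambda>z. c) z v)" for v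
    using Suc[of 0] by (subst continuously_differentiable_cong_on[OF frechet_derivative_strip_const])
  then show ?case by simp
qed simp

lemma iterated_derivative_zero: "z \<in> strip \<Longrightarrow> iterated_derivative strip vs (\<lambda>z. 0 :: 'b::real_normed_vector) z = 0"
proof (induction vs)
  case (Cons v vs)
  have "iterated_derivative strip vs (\<lambda>z. strip_derivative (\<lambda>z. 0 :: 'b::real_normed_vector) z v) z
      = iterated_derivative strip vs (\<lambda>z. 0 :: 'b::real_normed_vector) z"
    by (rule iterated_derivative_cong_on[OF frechet_derivative_strip_const Cons.prems])
  then show ?case using Cons by simp
qed simp

lemma Ck_norm_zero: "Ck_norm k strip (\<lambda>z. 0 :: 'b::real_normed_vector) = 0"
proof -
  have seminorm: "hoelder_seminorm b strip (iterated_derivative strip vs (\<lambda>z. 0 :: 'b::real_normed_vector)) \<le> 0" for b vs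
    unfolding hoelder_seminorm_def by (rule SUP_least) (auto simp: iterated_derivative_zero)
  have "Ck_norm k strip (\<lambda>z. 0 :: 'b::real_normed_vector) \<le> 0 + 0"
    unfolding Ck_norm_def
  proof (rule add_mono)
    show "(SUP vs \<in> (\<Union>i\<in>{..nat \<lfloor>k\<rfloor>}. partial_indices i).
        SUP z\<in>strip. ennreal (norm (iterated_derivative strip vs (\<lambda>z. 0 :: 'b::real_normed_vector) z))) \<le> 0"
      by (intro SUP_least) (simp add: iterated_derivative_zero)
    show "(if k \<in> \<int> then 0 else SUP vs \<in> partial_indices (nat \<lfloor>k\<rfloor>).
        hoelder_seminorm (frac k) strip (iterated_derivative strip vs (\<lambda>z. 0 :: 'b::real_normed_vector))) \<le> 0"
      using seminorm by (simp add: SUP_le_iff del: le_zero_eq)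
  qed
  then show ?thesis by simp
qed

lemma Ck_norm_cong_on:
  assumes "\<And>x. x \<in> S \<Longrightarrow> f x = g x"
  shows "Ck_norm k S f = Ck_norm k S g"
proof -
  have it: "iterated_derivative S vs f z = iterated_derivative S vs g z" if "z \<in> S" for vs z
    by (rule iterated_derivative_cong_on[OF assms that])
  have "hoelder_seminorm b S (iterated_derivative S vs f) = hoelder_seminorm b S (iterated_derivative S vs g)" for b vs
    unfolding hoelder_seminorm_def by (intro SUP_cong) (auto simp: it)
  then show ?thesis unfolding Ck_norm_def by (simp add: it cong: SUP_cong)
qed

lemma hoelder_seminorm_add:
  fixes f g h :: "'a::metric_space \<Rightarrow> 'b::real_normed_vector"
  assumes "\<And>z. z \<in> S \<Longrightarrow> h z = f z + g z"
  shows "hoelder_seminorm b S h \<le> hoelder_seminorm b S f + hoelder_seminorm b S g"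
  unfolding hoelder_seminorm_def
proof (rule SUP_least, clarify)
  fix p q assume pq: "p \<in> S" "q \<in> S" "p \<noteq> q"
  let ?A = "{(p, q). p \<in> S \<and> q \<in> S \<and> p \<noteq> q}"
  have "ennreal (dist (h p) (h q) / dist p q powr b)
    \<le> ennreal (dist (f p) (f q) / dist p q powr b + dist (g p) (g q) / dist p q powr b)"
    unfolding assms[OF pq(1)] assms[OF pq(2)] add_divide_distrib[symmetric]
    by (intro ennreal_leI divide_right_mono dist_triangle_add) auto
  also have "\<dots> = ennreal (dist (f p) (f q) / dist p q powr b) + ennreal (dist (g p) (g q) / dist p q powr b)"
    by (intro ennreal_plus) auto
  also have "\<dots> \<le> (SUP (p, q)\<in>?A. ennreal (dist (f p) (f q) / dist p q powr b))
      + (SUP (p, q)\<in>?A. ennreal (dist (g p) (g q) / dist p q powr b))"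
    using pq by (intro add_mono SUP_upper2[of "(p, q)"]) auto
  finally show "ennreal (dist (h p) (h q) / dist p q powr b) \<le> \<dots>" .
qed

lemma Ck_norm_add:
  assumes f: "continuously_differentiable (nat \<lfloor>k\<rfloor>) strip f"
    and g: "continuously_differentiable (nat \<lfloor>k\<rfloor>) strip g"
  shows "Ck_norm k strip (\<lambda>z. f z + g z) \<le> Ck_norm k strip f + Ck_norm k strip g"
proof -
  let ?r = "nat \<lfloor>k\<rfloor>" and ?it = "iterated_derivative strip"
  let ?A = "\<Union>i\<in>{..?r}. partial_indices i :: (real \<times> real) list set"
  let ?s = "\<lambda>f. SUP vs \<in> ?A. SUP z\<in>strip. ennreal (norm (?it vs f z))"
  let ?h = "\<lambda>f. SUP vs \<in> partial_indices ?r. hoelder_seminorm (frac k) strip (?it vs f)"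
  have it: "?it vs (\<lambda>z. f z + g z) z = ?it vs f z + ?it vs g z" if "length vs \<le> ?r" "z \<in> strip" for vs z
    using iterated_derivative_lincomb[OF f g that, of 1 1] by simp
  have 1: "?s (\<lambda>z. f z + g z) \<le> ?s f + ?s g"
  proof (intro SUP_least)
    fix vs and z :: "real \<times> real" assume vs: "vs \<in> ?A" and z: "z \<in> strip"
    have "length vs \<le> ?r" using vs by (auto simp: partial_indices_def)
    then have "ennreal (norm (?it vs (\<lambda>z. f z + g z) z)) \<le> ennreal (norm (?it vs f z) + norm (?it vs g z))"
      using z by (simp only: it) (intro ennreal_leI norm_triangle_ineq)
    also have "\<dots> = ennreal (norm (?it vs f z)) + ennreal (norm (?it vs g z))" by (intro ennreal_plus) auto
    also have "\<dots> \<le> ?s f + ?s g"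
      using vs z by (intro add_mono SUP_upper2[of vs] SUP_upper) auto
    finally show "ennreal (norm (?it vs (\<lambda>z. f z + g z) z)) \<le> ?s f + ?s g" .
  qed
  have 2: "?h (\<lambda>z. f z + g z) \<le> ?h f + ?h g"
  proof (rule SUP_least)
    fix vs :: "(real \<times> real) list" assume vs: "vs \<in> partial_indices ?r"
    have "hoelder_seminorm (frac k) strip (?it vs (\<lambda>z. f z + g z))
      \<le> hoelder_seminorm (frac k) strip (?it vs f) + hoelder_seminorm (frac k) strip (?it vs g)"
      using vs by (intro hoelder_seminorm_add it) (auto simp: partial_indices_def)
    also have "\<dots> \<le> ?h f + ?h g" using vs by (intro add_mono SUP_upper)
    finally show "hoelder_seminorm (frac k) strip (?it vs (\<lambda>z. f z + g z)) \<le> ?h f + ?h g" .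
  qed
  have "(if k \<in> \<int> then 0 else ?h (\<lambda>z. f z + g z)) \<le> (if k \<in> \<int> then 0 else ?h f) + (if k \<in> \<int> then 0 else ?h g)"
    using 2 by simp
  from add_mono[OF 1 this] show ?thesis unfolding Ck_norm_def by (simp add: ac_simps)
qed

lemma lift_translate:
  assumes "is_lift G g"
  shows "is_lift (\<lambda>z. G z - (of_int m, 0)) g"
proof -
  have "covering (p - (of_int m, 0)) = covering p" for p
    by (simp add: covering_def abs_circle_eq_iff)
  then show ?thesis using assms unfolding is_lift_def by (auto intro!: continuous_intros)
qed

lemma convex_strip: "convex strip"
  unfolding strip_def by (intro convex_Times) auto

text \<open>The difference is continuous on the connected strip and takes discrete values.\<close>

lemma lifts_differ_by_integer:
  assumes "is_lift G g" "is_lift H g"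
  obtains m :: int where "\<And>z. z \<in> strip \<Longrightarrow> H z = G z + (of_int m, 0)"
proof -
  have snd: "snd (H z) = snd (G z)" and int: "fst (H z) - fst (G z) \<in> \<int>" if "z \<in> strip" for z
  proof -
    have "covering (H z) = covering (G z)" using assms that by (simp add: is_lift_def)
    then show "snd (H z) = snd (G z)" "fst (H z) - fst (G z) \<in> \<int>"
      by (auto simp: covering_def abs_circle_eq_iff)
  qed
  have "(\<lambda>z. fst (H z) - fst (G z)) constant_on strip"
  proof (rule continuous_discrete_range_constant)
    show "connected strip" by (rule convex_connected[OF convex_strip])
    show "continuous_on strip (\<lambda>z. fst (H z) - fst (G z))"
      using assms by (intro continuous_intros) (auto simp: is_lift_def)
    fix z assume z: "z \<in> strip"
    have "1 \<le> norm ((fst (H y) - fst (G y)) - (fst (H z) - fst (G z)))"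
      if "y \<in> strip" "fst (H y) - fst (G y) \<noteq> fst (H z) - fst (G z)" for y
      using Ints_nonzero_abs_ge1[OF Ints_diff[OF int[OF that(1)] int[OF z]]] that(2) by simp
    then show "\<exists>e>0. \<forall>y. y \<in> strip \<and> fst (H y) - fst (G y) \<noteq> fst (H z) - fst (G z) \<longrightarrow>
        e \<le> norm ((fst (H y) - fst (G y)) - (fst (H z) - fst (G z)))"
      by (intro exI[of _ 1]) auto
  qed
  then obtain c where c: "\<And>z. z \<in> strip \<Longrightarrow> fst (H z) - fst (G z) = c" by (auto simp: constant_on_def)
  have "(0, 0) \<in> strip" by (simp add: strip_def)
  then have "c \<in> \<int>" using c int by metis
  then obtain m where "c = of_int m" by (rule Ints_cases)
  then show thesis using c snd by (intro that[of m]) (auto simp: prod_eq_iff algebra_simps)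
qed

lemma lift_continuously_differentiable:
  assumes "h \<in> Ck_boundary_maps k" "is_lift H h"
  shows "continuously_differentiable (nat \<lfloor>k\<rfloor>) strip H"
proof -
  obtain G where G: "is_lift G h" "Ck_on k strip G" using assms(1) by (auto simp: Ck_boundary_maps_def)
  obtain m :: int where m: "\<And>z. z \<in> strip \<Longrightarrow> H z = G z + (of_int m, 0)"
    using lifts_differ_by_integer[OF G(1) assms(2)] by blast
  have "continuously_differentiable (nat \<lfloor>k\<rfloor>) strip (\<lambda>z. 1 *\<^sub>R G z + 1 *\<^sub>R (of_int m, 0))"
    using G(2) by (intro continuously_differentiable_lincomb continuously_differentiable_const) (simp add: Ck_on_def)
  then show ?thesis by (subst continuously_differentiable_cong_on[OF m]) simp_all
qed

lemma lift_diff_continuously_differentiable: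
  assumes "g \<in> Ck_boundary_maps k" "is_lift G g" "h \<in> Ck_boundary_maps k" "is_lift H h"
  shows "continuously_differentiable (nat \<lfloor>k\<rfloor>) strip (\<lambda>z. G z - H z)"
  using continuously_differentiable_lincomb[OF lift_continuously_differentiable[OF assms(1,2)]
      lift_continuously_differentiable[OF assms(3,4)], of 1 "-1"] by simp

lemma Ck_dist_lessE:
  assumes "Ck_dist k g h < e"
  obtains G H where "is_lift G g" "is_lift H h" "Ck_norm k strip (\<lambda>z. G z - H z) < e"
  using assms unfolding Ck_dist_def by (auto simp: INF_less_iff)

text \<open>The triangle inequality for the distance. Two pairs of lifts are involved, \<open>(G, H\<^sub>1)\<close> and
  \<open>(H\<^sub>2, H')\<close>; translating \<open>H'\<close> by the integer difference of \<open>H\<^sub>2\<close> and \<open>H\<^sub>1\<close> makes them composable.\<close>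

lemma Ck_ball_open:
  assumes g: "g \<in> Ck_boundary_maps k"
  shows "Ck_open k {h \<in> Ck_boundary_maps k. Ck_dist k g h < e}"
  unfolding Ck_open_def
proof (intro conjI ballI)
  fix h assume "h \<in> {h \<in> Ck_boundary_maps k. Ck_dist k g h < e}"
  then have h: "h \<in> Ck_boundary_maps k" and "Ck_dist k g h < e" by auto
  from Ck_dist_lessE[OF this(2)] obtain G H\<^sub>1
    where GH: "is_lift G g" "is_lift H\<^sub>1 h" "Ck_norm k strip (\<lambda>z. G z - H\<^sub>1 z) < e" .
  let ?a = "Ck_norm k strip (\<lambda>z. G z - H\<^sub>1 z)"
  show "\<exists>\<epsilon>>0. \<forall>h'\<in>Ck_boundary_maps k. Ck_dist k h h' < \<epsilon> \<longrightarrow> h' \<in> {h \<in> Ck_boundary_maps k. Ck_dist k g h < e}"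
  proof (intro exI[of _ "e - ?a"] conjI ballI impI)
    show "0 < e - ?a" using GH(3) by (simp add: diff_gt_0_iff_gt_ennreal)
    fix h' assume h': "h' \<in> Ck_boundary_maps k" and "Ck_dist k h h' < e - ?a"
    from Ck_dist_lessE[OF this(2)] obtain H\<^sub>2 H'
      where H: "is_lift H\<^sub>2 h" "is_lift H' h'" "Ck_norm k strip (\<lambda>z. H\<^sub>2 z - H' z) < e - ?a" .
    obtain m :: int where m: "\<And>z. z \<in> strip \<Longrightarrow> H\<^sub>2 z = H\<^sub>1 z + (of_int m, 0)"
      using lifts_differ_by_integer[OF GH(2) H(1)] by blast
    \<comment> \<open>\<open>H' - (m, 0)\<close> is a lift of \<open>h'\<close> as good as \<open>H'\<close>.\<close>
    have "Ck_dist k g h' \<le> Ck_norm k strip (\<lambda>z. G z - (H' z - (of_int m, 0)))"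
      unfolding Ck_dist_def using GH(1) lift_translate[OF H(2)] by (intro INF_lower2[of "(G, _)"]) auto
    also have "\<dots> = Ck_norm k strip (\<lambda>z. (G z - H\<^sub>1 z) + (H\<^sub>2 z - H' z))"
      by (rule Ck_norm_cong_on) (simp add: m)
    also have "\<dots> \<le> ?a + Ck_norm k strip (\<lambda>z. H\<^sub>2 z - H' z)"
      by (intro Ck_norm_add lift_diff_continuously_differentiable[OF g GH(1) h GH(2)]
          lift_diff_continuously_differentiable[OF h H(1) h' H(2)])
    also have "\<dots> < ?a + (e - ?a)"
      using H(3) GH(3) by (subst ennreal_add_left_cancel_less) (auto simp: less_top[symmetric] top_unique)
    also have "\<dots> = e" using GH(3) by (simp add: ennreal_add_diff_cancel_right add_diff_inverse_ennreal less_imp_le)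
    finally show "h' \<in> {h \<in> Ck_boundary_maps k. Ck_dist k g h < e}" using h' by simp
  qed
qed auto

section \<open>Kan's map\<close>

lemma sin_lipschitz: "\<bar>sin a - sin b\<bar> \<le> \<bar>a - b\<bar>" for a b :: real
  using field_differentiable_bound[of UNIV sin cos 1 b a] by (auto intro!: derivative_eq_intros)

lemma linear_on_plane:
  fixes f :: "real \<times> real \<Rightarrow> 'b::real_normed_vector"
  assumes "bounded_linear f"
  shows "f v = fst v *\<^sub>R f (1, 0) + snd v *\<^sub>R f (0, 1)"
proof -
  interpret bounded_linear f by fact
  have "f (fst v *\<^sub>R (1, 0) + snd v *\<^sub>R (0, 1)) = fst v *\<^sub>R f (1, 0) + snd v *\<^sub>R f (0, 1)"
    by (simp only: add scaleR)
  moreover have "fst v *\<^sub>R (1, 0) + snd v *\<^sub>R (0, 1) = v" by (simp add: prod_eq_iff)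
  ultimately show ?thesis by (simp only:)
qed

lemma linear_on_plane_bound:
  fixes f :: "real \<times> real \<Rightarrow> 'b::real_normed_vector"
  assumes f: "bounded_linear f" and C: "norm (f (1, 0)) \<le> C" "norm (f (0, 1)) \<le> C"
  shows "norm (f v) \<le> 2 * C * norm v"
proof -
  have "norm (f v) \<le> norm (fst v *\<^sub>R f (1, 0)) + norm (snd v *\<^sub>R f (0, 1))"
    unfolding linear_on_plane[OF f, of v] by (rule norm_triangle_ineq)
  also have "\<dots> \<le> norm v * C + norm v * C"
    unfolding norm_scaleR using C norm_fst_le[of "fst v" "snd v"] norm_snd_le[of "snd v" "fst v"]
    by (intro add_mono mult_mono) auto
  finally show ?thesis by simp
qed

lemma lipschitz_on_strip:
  fixes f :: "real \<times> real \<Rightarrow> 'b::real_normed_vector"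
  assumes der: "\<And>z. z \<in> strip \<Longrightarrow> (f has_derivative D z) (at z within strip)"
    and C: "\<And>z. z \<in> strip \<Longrightarrow> norm (D z (1, 0)) \<le> C" "\<And>z. z \<in> strip \<Longrightarrow> norm (D z (0, 1)) \<le> C"
    and z: "z \<in> strip" "z' \<in> strip"
  shows "dist (f z) (f z') \<le> 2 * C * dist z z'"
proof -
  have "0 \<le> C" using C(1)[OF z(1)] norm_ge_zero order_trans by blast
  then show ?thesis
    unfolding dist_norm using C z
    by (intro differentiable_bound[OF convex_strip der] onorm_bound linear_on_plane_bound
        has_derivative_bounded_linear[OF der]) auto
qed

text \<open>Trigonometric polynomials in the angle with polynomials in the height as coefficients. The class
  is closed under derivatives, and its members are bounded and Lipschitz on the strip; so all
  partial derivatives are Hoelder continuous. The phase \<open>a\<close> makes sines superfluous.\<close>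

inductive trig_poly :: "(real \<times> real \<Rightarrow> real \<times> real) \<Rightarrow> bool" where
  trig_poly_const: "trig_poly (\<lambda>z. u)"
| trig_poly_add: "trig_poly f \<Longrightarrow> trig_poly g \<Longrightarrow> trig_poly (\<lambda>z. f z + g z)"
| trig_poly_scale: "trig_poly f \<Longrightarrow> trig_poly (\<lambda>z. a *\<^sub>R f z)"
| trig_poly_height: "trig_poly f \<Longrightarrow> trig_poly (\<lambda>z. snd z *\<^sub>R f z)"
| trig_poly_cos: "trig_poly f \<Longrightarrow> trig_poly (\<lambda>z. cos (2 * pi * fst z + a) *\<^sub>R f z)"

lemma trig_poly_derivative:
  "trig_poly f \<Longrightarrow> \<exists>D. (\<forall>z. (f has_derivative D z) (at z)) \<and> (\<forall>v. trig_poly (\<lambda>z. D z v))"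
proof (induction rule: trig_poly.induct)
  case (trig_poly_const u)
  show ?case by (intro exI[of _ "\<lambda>z v. 0"]) (auto intro: trig_poly.trig_poly_const)
next
  case (trig_poly_add f g)
  then obtain D D' where "\<forall>z. (f has_derivative D z) (at z)" "\<forall>v. trig_poly (\<lambda>z. D z v)"
    "\<forall>z. (g has_derivative D' z) (at z)" "\<forall>v. trig_poly (\<lambda>z. D' z v)" by blast
  then show ?case
    by (intro exI[of _ "\<lambda>z v. D z v + D' z v"]) (auto intro: trig_poly.trig_poly_add has_derivative_add)
next
  case (trig_poly_scale f a)
  then obtain D where "\<forall>z. (f has_derivative D z) (at z)" "\<forall>v. trig_poly (\<lambda>z. D z v)" by blast
  then show ?case
    by (intro exI[of _ "\<lambda>z v. a *\<^sub>R D z v"]) (auto intro: trig_poly.trig_poly_scale has_derivative_scaleR_right)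
next
  case (trig_poly_height f)
  then obtain D where D: "\<And>z. (f has_derivative D z) (at z)" "\<And>v. trig_poly (\<lambda>z. D z v)" by blast
  have "((\<lambda>z. snd z *\<^sub>R f z) has_derivative (\<lambda>v. snd z *\<^sub>R D z v + snd v *\<^sub>R f z)) (at z)" for z
    by (intro has_derivative_scaleR has_derivative_snd has_derivative_ident D)
  moreover have "trig_poly (\<lambda>z. snd z *\<^sub>R D z v + snd v *\<^sub>R f z)" for v
    by (intro trig_poly.intros D trig_poly_height)
  ultimately show ?case by (intro exI[of _ "\<lambda>z v. snd z *\<^sub>R D z v + snd v *\<^sub>R f z"]) blast
next
  case (trig_poly_cos f a)
  then obtain D where D: "\<And>z. (f has_derivative D z) (at z)" "\<And>v. trig_poly (\<lambda>z. D z v)" by blast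
  let ?D = "\<lambda>z v. cos (2 * pi * fst z + a) *\<^sub>R D z v
    + (2 * pi * fst v) *\<^sub>R (cos (2 * pi * fst z + (a + pi / 2)) *\<^sub>R f z)"
  have "cos (y + (a + pi / 2)) = - sin (y + a)" for y using minus_sin_cos_eq[of "y + a"] by (simp add: add.assoc)
  then have "((\<lambda>z. cos (2 * pi * fst z + a)) has_derivative
      (\<lambda>v. (2 * pi * fst v) * cos (2 * pi * fst z + (a + pi / 2)))) (at z)" for z
    by (auto intro!: derivative_eq_intros)
  from has_derivative_scaleR[OF this D(1)]
  have "((\<lambda>z. cos (2 * pi * fst z + a) *\<^sub>R f z) has_derivative ?D z) (at z)" for z by simp
  moreover have "trig_poly (\<lambda>z. ?D z v)" for v by (intro trig_poly.intros D trig_poly_cos)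
  ultimately show ?case by (intro exI[of _ ?D]) blast
qed

lemma trig_poly_bounded: "trig_poly f \<Longrightarrow> \<exists>C\<ge>0. \<forall>z\<in>strip. norm (f z) \<le> C"
proof (induction rule: trig_poly.induct)
  case (trig_poly_const u)
  show ?case by (intro exI[of _ "norm u"]) auto
next
  case (trig_poly_add f g)
  then obtain C C' where "0 \<le> C" "0 \<le> C'" "\<forall>z\<in>strip. norm (f z) \<le> C" "\<forall>z\<in>strip. norm (g z) \<le> C'" by blast
  then show ?case by (intro exI[of _ "C + C'"]) (auto intro!: norm_triangle_mono)
next
  case (trig_poly_scale f a)
  then obtain C where "0 \<le> C" "\<forall>z\<in>strip. norm (f z) \<le> C" by blast
  then show ?case by (intro exI[of _ "\<bar>a\<bar> * C"]) (auto intro!: mult_left_mono)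
next
  case (trig_poly_height f)
  then obtain C where C: "0 \<le> C" "\<forall>z\<in>strip. norm (f z) \<le> C" by blast
  have "norm (snd z *\<^sub>R f z) \<le> 1 * C" if "z \<in> strip" for z
    unfolding norm_scaleR using C that by (intro mult_mono) (auto simp: strip_def)
  then show ?case using C by auto
next
  case (trig_poly_cos f a)
  then obtain C where C: "0 \<le> C" "\<forall>z\<in>strip. norm (f z) \<le> C" by blast
  have "norm (cos (2 * pi * fst z + a) *\<^sub>R f z) \<le> 1 * C" if "z \<in> strip" for z
    unfolding norm_scaleR using C that by (intro mult_mono) auto
  then show ?case using C by auto
qed

lemma trig_poly_hoelder:
  assumes f: "trig_poly f" and b: "0 < b" "b \<le> 1"
  shows "hoelder_on b strip f"
proof -
  obtain D where D: "\<And>z. (f has_derivative D z) (at z)" "\<And>v. trig_poly (\<lambda>z. D z v)"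
    using trig_poly_derivative[OF f] by blast
  obtain C where C: "0 \<le> C" "\<And>z. z \<in> strip \<Longrightarrow> norm (f z) \<le> C" using trig_poly_bounded[OF f] by blast
  obtain C1 where C1: "0 \<le> C1" "\<And>z. z \<in> strip \<Longrightarrow> norm (D z (1, 0)) \<le> C1"
    using trig_poly_bounded[OF D(2)] by blast
  obtain C2 where C2: "0 \<le> C2" "\<And>z. z \<in> strip \<Longrightarrow> norm (D z (0, 1)) \<le> C2"
    using trig_poly_bounded[OF D(2)] by blast
  let ?M = "2 * (C1 + C2) + 2 * C"
  have "dist (f p) (f q) \<le> ?M * dist p q powr b" if pq: "p \<in> strip" "q \<in> strip" for p q
  proof (cases "dist p q \<le> 1")
    case True
    have "dist (f p) (f q) \<le> 2 * (C1 + C2) * dist p q"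
      by (rule lipschitz_on_strip[where D = D])
         (use C1 C2 D(1) pq in \<open>auto intro: has_derivative_at_withinI add_increasing add_increasing2\<close>)
    also have "\<dots> \<le> ?M * dist p q" using C by (intro mult_right_mono) auto
    also have "dist p q \<le> dist p q powr b"
      using powr_mono'[of b 1 "dist p q"] b True by (cases "p = q") auto
    finally show ?thesis using C C1 C2 by (simp add: mult_left_mono)
  next
    case False
    have "dist (f p) (f q) \<le> norm (f p) + norm (f q)" by (simp add: dist_norm norm_triangle_ineq4)
    also have "\<dots> \<le> ?M * 1" using C(2)[OF pq(1)] C(2)[OF pq(2)] C1 C2 by simp
    also have "\<dots> \<le> ?M * dist p q powr b"
      using False b C C1 C2 by (intro mult_left_mono ge_one_powr_ge_zero) auto
    finally show ?thesis .
  qed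
  then show ?thesis unfolding hoelder_on_def by blast
qed

lemma trig_poly_continuously_differentiable: "trig_poly f \<Longrightarrow> continuously_differentiable r strip f"
proof (induction r arbitrary: f)
  case 0
  then obtain D where D: "\<And>z. (f has_derivative D z) (at z)" using trig_poly_derivative by blast
  have "continuous_on strip f"
    by (rule has_derivative_continuous_on, rule has_derivative_at_withinI, rule D)
  then show ?case by simp
next
  case (Suc r)
  then obtain D where D: "\<And>z. (f has_derivative D z) (at z)" "\<And>v. trig_poly (\<lambda>z. D z v)"
    using trig_poly_derivative by blast
  have D': "(f has_derivative D z) (at z within strip)" for z by (rule has_derivative_at_withinI[OF D(1)])
  have "continuously_differentiable r strip (\<lambda>z. strip_derivative f z v)" for v
    by (subst continuously_differentiable_cong_on[where g = "\<lambda>z. D z v"])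
       (simp_all add: frechet_derivative_strip[OF _ D'] Suc.IH D(2))
  moreover have "f differentiable (at z within strip)" for z using D' by (rule differentiableI)
  ultimately show ?case by simp
qed

lemma trig_poly_iterated_derivative:
  "trig_poly f \<Longrightarrow> \<exists>f'. trig_poly f' \<and> (\<forall>z\<in>strip. iterated_derivative strip vs f z = f' z)"
proof (induction vs arbitrary: f)
  case Nil
  then show ?case by auto
next
  case (Cons v vs)
  then obtain D where D: "\<And>z. (f has_derivative D z) (at z)" "\<And>v. trig_poly (\<lambda>z. D z v)"
    using trig_poly_derivative by blast
  have D': "(f has_derivative D z) (at z within strip)" for z by (rule has_derivative_at_withinI[OF D(1)])
  obtain f' where f': "trig_poly f'" "\<forall>z\<in>strip. iterated_derivative strip vs (\<lambda>z. D z v) z = f' z"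
    using Cons.IH[OF D(2)] by blast
  have "iterated_derivative strip (v # vs) f z = f' z" if "z \<in> strip" for z
  proof -
    have "iterated_derivative strip vs (\<lambda>z. strip_derivative f z v) z
        = iterated_derivative strip vs (\<lambda>z. D z v) z"
      by (rule iterated_derivative_cong_on[OF _ that]) (simp add: frechet_derivative_strip[OF _ D'])
    then show ?thesis using f' that by simp
  qed
  then show ?case using f'(1) by blast
qed

definition kan_lift :: "nat \<Rightarrow> real \<times> real \<Rightarrow> real \<times> real" where
  "kan_lift N z = (real N * fst z, snd z + snd z * (1 - snd z) * cos (2 * pi * fst z) / 8)"

definition kan_map :: "nat \<Rightarrow> circle \<times> real \<Rightarrow> circle \<times> real" where
  "kan_map N = restrict (\<lambda>p. covering (kan_lift N (rep_circle (fst p), snd p))) annulus"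

text \<open>The lift itself is not bounded, owing to the term \<open>N x\<close>; only its derivatives are in the
  class.\<close>

lemma kan_lift_derivative_trig_poly:
  "\<exists>D. (\<forall>z. (kan_lift N has_derivative D z) (at z)) \<and> (\<forall>v. trig_poly (\<lambda>z. D z v))"
proof -
  define P where "P = (\<lambda>z :: real \<times> real. snd z *\<^sub>R (0 :: real, 1 :: real)
    + (1 / 8) *\<^sub>R (cos (2 * pi * fst z + 0) *\<^sub>R (snd z *\<^sub>R ((0, 1) + (- 1) *\<^sub>R (snd z *\<^sub>R (0, 1))))))"
  have "trig_poly P" unfolding P_def by (intro trig_poly.intros)
  then obtain D where D: "\<And>z. (P has_derivative D z) (at z)" "\<And>v. trig_poly (\<lambda>z. D z v)"
    using trig_poly_derivative by blast
  have eq: "kan_lift N = (\<lambda>z. (real N * fst z, 0) + P z)"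
    by (auto simp: kan_lift_def P_def fun_eq_iff field_simps)
  have "((\<lambda>z. (real N * fst z, 0)) has_derivative (\<lambda>v. (real N * fst v, 0))) (at z)" for z :: "real \<times> real"
    by (auto intro!: derivative_eq_intros)
  then have "(kan_lift N has_derivative (\<lambda>v. (real N * fst v, 0) + D z v)) (at z)" for z
    unfolding eq by (intro has_derivative_add D)
  moreover have "trig_poly (\<lambda>z. (real N * fst v, 0) + D z v)" for v by (intro trig_poly.intros D)
  ultimately show ?thesis by (intro exI[of _ "\<lambda>z v. (real N * fst v, 0) + D z v"]) blast
qed

lemma Ck_on_kan_lift:
  assumes "1 \<le> k"
  shows "Ck_on k strip (kan_lift N)"
proof -
  obtain D where D: "\<And>z. (kan_lift N has_derivative D z) (at z)" "\<And>v. trig_poly (\<lambda>z. D z v)"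
    using kan_lift_derivative_trig_poly by blast
  have D': "(kan_lift N has_derivative D z) (at z within strip)" for z
    by (rule has_derivative_at_withinI[OF D(1)])
  have fd: "strip_derivative (kan_lift N) z v = D z v" if "z \<in> strip" for z v
    by (simp add: frechet_derivative_strip[OF that D'])
  obtain r where r: "nat \<lfloor>k\<rfloor> = Suc r" using assms by (cases "nat \<lfloor>k\<rfloor>") linarith+
  have "continuously_differentiable r strip (\<lambda>z. strip_derivative (kan_lift N) z v)" for v
    by (subst continuously_differentiable_cong_on[where g = "\<lambda>z. D z v"])
       (simp_all add: fd trig_poly_continuously_differentiable D(2))
  moreover have "kan_lift N differentiable (at z within strip)" for z using D' by (rule differentiableI)
  moreover have "hoelder_on (frac k) strip (iterated_derivative strip vs (kan_lift N))"
    if vs: "vs \<in> partial_indices (Suc r)" and k: "k \<notin> \<int>" for vs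
  proof -
    obtain v ws where v: "vs = v # ws" using vs by (cases vs) (auto simp: partial_indices_def)
    obtain f' where f': "trig_poly f'" "\<And>z. z \<in> strip \<Longrightarrow> iterated_derivative strip ws (\<lambda>z. D z v) z = f' z"
      using trig_poly_iterated_derivative[OF D(2)] by blast
    have "iterated_derivative strip vs (kan_lift N) z = f' z" if "z \<in> strip" for z
      unfolding v iterated_derivative.simps f'(2)[OF that, symmetric]
      by (rule iterated_derivative_cong_on[OF _ that]) (simp add: fd)
    moreover have "hoelder_on (frac k) strip f'"
      using k frac_lt_1[of k] by (intro trig_poly_hoelder f') (auto simp: frac_gt_0_iff)
    ultimately show ?thesis by (simp add: hoelder_on_def)
  qed
  ultimately show ?thesis unfolding Ck_on_def r by simp
qed

lemma kan_height_in:
  fixes t x :: real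
  assumes "0 \<le> t" "t \<le> 1"
  shows "t + t * (1 - t) * cos x / 8 \<in> {0..1}"
proof -
  have "\<bar>t * (1 - t) * cos x\<bar> \<le> t * (1 - t) * 1"
    unfolding abs_mult using assms by (intro mult_mono) auto
  moreover have "t * (1 - t) \<le> t * 1" "t * (1 - t) \<le> 1 * (1 - t)"
    using assms by (intro mult_left_mono mult_right_mono; simp)+
  ultimately show ?thesis by (auto simp: abs_le_iff)
qed

lemma is_lift_kan: "is_lift (kan_lift N) (kan_map N)"
  unfolding is_lift_def
proof (intro conjI ballI)
  show "continuous_on strip (kan_lift N)" unfolding kan_lift_def by (intro continuous_intros) auto
  fix z assume z: "z \<in> strip"
  have "rep_circle (abs_circle (fst z)) - fst z \<in> \<int>"
    using Quotient_rep_abs[OF Quotient_circle, of "fst z"] by simp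
  then obtain j where j: "rep_circle (abs_circle (fst z)) = fst z + of_int j"
    by (metis Ints_cases add.commute diff_eq_eq)
  have "2 * pi * (fst z + of_int j) = 2 * pi * fst z + 2 * pi * of_int j" by (simp add: algebra_simps)
  then have "cos (2 * pi * (fst z + of_int j)) = cos (2 * pi * fst z)"
    by (simp only: cos_add cos_int_2pin sin_int_2pin mult_1_right mult_zero_right diff_zero)
  moreover have "abs_circle (real N * fst z) = abs_circle (real N * (fst z + of_int j))"
    by (simp add: abs_circle_eq_iff algebra_simps)
  ultimately have "covering (kan_lift N (fst z + of_int j, snd z)) = covering (kan_lift N z)"
    by (simp add: covering_def kan_lift_def)
  then show "covering (kan_lift N z) = kan_map N (covering z)"
    using z by (simp add: kan_map_def covering_in_annulus_iff) (simp add: covering_def j)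
qed

lemma kan_map_in_Ck_boundary_maps:
  assumes "1 \<le> k"
  shows "kan_map N \<in> Ck_boundary_maps k"
  unfolding Ck_boundary_maps_def
proof (intro CollectI conjI)
  show "kan_map N \<in> annulus \<rightarrow>\<^sub>E annulus"
    using kan_height_in by (auto simp: kan_map_def annulus_def covering_def kan_lift_def)
  show "kan_map N ` annulus_boundary \<subseteq> annulus_boundary"
    by (auto simp: kan_map_def annulus_boundary_def annulus_def covering_def kan_lift_def)
  show "\<exists>G. is_lift G (kan_map N) \<and> Ck_on k strip G"
    using is_lift_kan Ck_on_kan_lift[OF assms] by blast
qed

section \<open>A \<open>C\<^sup>k\<close> ball around Kan's map\<close>

lemma Ck_norm_ge_derivative:
  assumes "vs \<in> partial_indices i" "i \<le> nat \<lfloor>k\<rfloor>" "z \<in> strip"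
  shows "ennreal (norm (iterated_derivative strip vs f z)) \<le> Ck_norm k strip f"
proof -
  have "ennreal (norm (iterated_derivative strip vs f z))
    \<le> (SUP vs \<in> (\<Union>i\<in>{..nat \<lfloor>k\<rfloor>}. partial_indices i). SUP z\<in>strip. ennreal (norm (iterated_derivative strip vs f z)))"
    using assms by (intro SUP_upper2[of vs] SUP_upper2[of z]) auto
  also have "\<dots> \<le> Ck_norm k strip f" unfolding Ck_norm_def by simp
  finally show ?thesis .
qed

lemma Ck_norm_ge_hoelder:
  assumes "vs \<in> partial_indices (nat \<lfloor>k\<rfloor>)" "k \<notin> \<int>" "p \<in> strip" "q \<in> strip" "p \<noteq> q"
  shows "ennreal (dist (iterated_derivative strip vs f p) (iterated_derivative strip vs f q) / dist p q powr frac k)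
    \<le> Ck_norm k strip f"
proof -
  have "ennreal (dist (iterated_derivative strip vs f p) (iterated_derivative strip vs f q) / dist p q powr frac k)
    \<le> hoelder_seminorm (frac k) strip (iterated_derivative strip vs f)"
    unfolding hoelder_seminorm_def using assms by (intro SUP_upper2[of "(p, q)"]) auto
  also have "\<dots> \<le> (SUP vs \<in> partial_indices (nat \<lfloor>k\<rfloor>). hoelder_seminorm (frac k) strip (iterated_derivative strip vs f))"
    using assms by (intro SUP_upper)
  also have "\<dots> \<le> Ck_norm k strip f" unfolding Ck_norm_def using assms by simp
  finally show ?thesis .
qed

lemma Basis_plane: "(1, 0) \<in> (Basis :: (real \<times> real) set)" "(0, 1) \<in> (Basis :: (real \<times> real) set)"
  by (auto simp: Basis_prod_def)

text \<open>For \<open>k < 2\<close> the Hoelder condition with exponent \<open>k - 1\<close> is a part of the norm; for \<open>k \<ge> 2\<close> the second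
  derivatives are bounded, so that the first derivatives are Lipschitz.\<close>

lemma derivative_bounds_of_Ck_norm:
  fixes E :: "real \<times> real \<Rightarrow> real \<times> real"
  assumes k: "1 < k" and cd: "continuously_differentiable (nat \<lfloor>k\<rfloor>) strip E"
    and small: "Ck_norm k strip E < ennreal e"
  shows "z \<in> strip \<Longrightarrow> norm (E z) \<le> e"
    and "z \<in> strip \<Longrightarrow> v \<in> Basis \<Longrightarrow> norm (strip_derivative E z v) \<le> e"
    and "v \<in> Basis \<Longrightarrow> z \<in> strip \<Longrightarrow> z' \<in> strip \<Longrightarrow>
      dist (strip_derivative E z v) (strip_derivative E z' v)
        \<le> 2 * e * dist z z' powr min 1 (k - 1)"
proof -
  have r: "1 \<le> nat \<lfloor>k\<rfloor>" using k by linarith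
  have bound: "x \<le> e" if "ennreal x \<le> Ck_norm k strip E" "0 \<le> x" for x
  proof -
    have "ennreal x < ennreal e" using that(1) small by (rule le_less_trans)
    then show ?thesis using that(2) by (simp add: ennreal_less_iff)
  qed
  show "norm (E z) \<le> e" if "z \<in> strip"
    using bound[OF Ck_norm_ge_derivative[of "[]" 0 k z E]] that by (simp add: partial_indices_def)
  show deriv: "norm (strip_derivative E z v) \<le> e" if "z \<in> strip" "v \<in> Basis" for z v
    using bound[OF Ck_norm_ge_derivative[of "[v]" 1 k z E]] that r by (simp add: partial_indices_def)
  then have e: "0 \<le> e" using Basis_plane(1) norm_ge_zero order_trans[of 0] by (metis strip_def SigmaI UNIV_I atLeastAtMost_iff order_refl zero_le_one)
  show "dist (strip_derivative E z v) (strip_derivative E z' v)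
        \<le> 2 * e * dist z z' powr min 1 (k - 1)" if v: "v \<in> Basis" and z: "z \<in> strip" "z' \<in> strip"
  proof (cases "k < 2")
    case True
    have fl: "\<lfloor>k\<rfloor> = 1" using k True by linarith
    then have fr: "frac k = k - 1" by (simp add: frac_def)
    have nonint: "k \<notin> \<int>" using fr k True by (metis diff_gt_0_iff_gt frac_eq_0_iff less_irrefl)
    show ?thesis
    proof (cases "z = z'")
      case False
      have "dist (strip_derivative E z v) (strip_derivative E z' v)
        / dist z z' powr frac k \<le> e"
        using bound[OF Ck_norm_ge_hoelder[of "[v]" k z z' E]] v z nonint False fl by (simp add: partial_indices_def)
      then have "dist (strip_derivative E z v) (strip_derivative E z' v)
        \<le> e * dist z z' powr (k - 1)"
        using False by (simp add: fr divide_le_eq)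
      also have "\<dots> \<le> 2 * e * dist z z' powr (k - 1)" using e by (intro mult_right_mono) auto
      finally show ?thesis using True by (simp add: min_def)
    qed simp
  next
    case False
    then have r2: "2 \<le> nat \<lfloor>k\<rfloor>" by linarith
    let ?D = "\<lambda>z. strip_derivative E z v"
    define r' where "r' = nat \<lfloor>k\<rfloor> - 2"
    have r': "nat \<lfloor>k\<rfloor> = Suc (Suc r')" using r2 unfolding r'_def by linarith
    have "?D differentiable (at z within strip)" if "z \<in> strip" for z
      using cd that unfolding r' by (simp only: continuously_differentiable.simps)
    then have der: "(?D has_derivative strip_derivative ?D z) (at z within strip)" if "z \<in> strip" for z
      using that by (intro frechet_derivative_strip_works)
    have second: "norm (strip_derivative ?D z w) \<le> e" if "z \<in> strip" "w \<in> Basis" for z w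
      using bound[OF Ck_norm_ge_derivative[of "[v, w]" 2 k z E]] that r2 v by (simp add: partial_indices_def)
    have "dist (?D z) (?D z') \<le> 2 * e * dist z z'"
      by (rule lipschitz_on_strip[OF der second second z]) (use Basis_plane in auto)
    then show ?thesis using False by (cases "z = z'") (auto simp: min_def)
  qed
qed

lemma kan_partials_lipschitz:
  fixes x x' t t' :: real
  assumes t: "0 \<le> t" "t \<le> 1" "0 \<le> t'" "t' \<le> 1" and d: "\<bar>t - t'\<bar> \<le> \<bar>x - x'\<bar>"
  shows "\<bar>t * (1 - t) * sin (2 * pi * x) - t' * (1 - t') * sin (2 * pi * x')\<bar> \<le> 3 * \<bar>x - x'\<bar>"
    and "\<bar>(1 - 2 * t) * cos (2 * pi * x) - (1 - 2 * t') * cos (2 * pi * x')\<bar> \<le> 9 * \<bar>x - x'\<bar>"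
proof -
  let ?d = "\<bar>x - x'\<bar>"
  have pi: "2 * pi * ?d \<le> 7 * ?d" using pi_less_4 pi_approx by (intro mult_right_mono) auto
  have "2 * pi * x - 2 * pi * x' = 2 * pi * (x - x')" by (simp add: algebra_simps)
  then have "\<bar>2 * pi * x - 2 * pi * x'\<bar> = 2 * pi * ?d" by (simp add: abs_mult)
  then have s: "\<bar>sin (2 * pi * x) - sin (2 * pi * x')\<bar> \<le> 7 * ?d" and c: "\<bar>cos (2 * pi * x) - cos (2 * pi * x')\<bar> \<le> 7 * ?d"
    using sin_lipschitz[of "2 * pi * x" "2 * pi * x'"] cos_lipschitz[of "2 * pi * x" "2 * pi * x'"] pi by linarith+
  have q: "\<bar>t' * (1 - t')\<bar> \<le> 1 / 4"
  proof -
    have "1 / 4 - t' * (1 - t') = (t' - 1 / 2)\<^sup>2" by (simp add: power2_eq_square field_simps)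
    then have "t' * (1 - t') \<le> 1 / 4" using zero_le_power2[of "t' - 1 / 2"] by linarith
    then show ?thesis using t by simp
  qed
  have "\<bar>(t - t') * (1 - t - t')\<bar> \<le> ?d * 1" unfolding abs_mult using t d by (intro mult_mono) auto
  then have "\<bar>(t - t') * (1 - t - t')\<bar> * \<bar>sin (2 * pi * x)\<bar> \<le> ?d * 1" by (intro mult_mono) auto
  moreover have "\<bar>t' * (1 - t')\<bar> * \<bar>sin (2 * pi * x) - sin (2 * pi * x')\<bar> \<le> 1 / 4 * (7 * ?d)"
    using q s by (intro mult_mono) auto
  moreover have "t * (1 - t) * sin (2 * pi * x) - t' * (1 - t') * sin (2 * pi * x')
    = (t - t') * (1 - t - t') * sin (2 * pi * x) + t' * (1 - t') * (sin (2 * pi * x) - sin (2 * pi * x'))"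
    by (simp add: algebra_simps)
  ultimately show "\<bar>t * (1 - t) * sin (2 * pi * x) - t' * (1 - t') * sin (2 * pi * x')\<bar> \<le> 3 * ?d"
    unfolding abs_mult[symmetric] by linarith
  have "\<bar>2 * (t' - t)\<bar> \<le> 2 * ?d"
    using d by (simp only: abs_mult abs_numeral abs_minus_commute[of t' t]) simp
  then have "\<bar>2 * (t' - t)\<bar> * \<bar>cos (2 * pi * x)\<bar> \<le> (2 * ?d) * 1" by (intro mult_mono) auto
  moreover have "\<bar>1 - 2 * t'\<bar> * \<bar>cos (2 * pi * x) - cos (2 * pi * x')\<bar> \<le> 1 * (7 * ?d)"
    using t c by (intro mult_mono) auto
  moreover have "(1 - 2 * t) * cos (2 * pi * x) - (1 - 2 * t') * cos (2 * pi * x')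
    = 2 * (t' - t) * cos (2 * pi * x) + (1 - 2 * t') * (cos (2 * pi * x) - cos (2 * pi * x'))"
    by (simp add: algebra_simps)
  ultimately show "\<bar>(1 - 2 * t) * cos (2 * pi * x) - (1 - 2 * t') * cos (2 * pi * x')\<bar> \<le> 9 * ?d"
    unfolding abs_mult[symmetric] by linarith
qed

text \<open>\<open>E\<close> is the difference between the lift of Kan's map and a lift of the perturbed map. The partial
  derivatives of Kan's map are Lipschitz with moderate constants, those of \<open>E\<close> have small Hoelder
  constants by \<open>derivative_bounds_of_Ck_norm\<close>.\<close>

lemma near_kan_if_Ck_close:
  fixes E :: "real \<times> real \<Rightarrow> real \<times> real" and N k :: real
  defines "G \<equiv> \<lambda>x t. t + t * (1 - t) * cos (2 * pi * x) / 8 - snd (E (x, t))"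
  assumes k: "1 < k" and N: "0 < N" "10000000 \<le> (N / 2) powr min 1 (k - 1)"
    and cd: "continuously_differentiable (nat \<lfloor>k\<rfloor>) strip E"
    and small: "Ck_norm k strip E < ennreal (1 / 1000000)"
    and ends: "\<And>x. G x 0 = 0" "\<And>x. G x 1 = 1"
  shows "\<exists>Fx Ft Gx Gt. near_kan (\<lambda>x t. N * x - fst (E (x, t))) G Fx Ft Gx Gt N (min 1 (k - 1))"
proof -
  let ?\<beta> = "min 1 (k - 1)" and ?e = "1 / 1000000 :: real"
  define D where "D v z = strip_derivative E z v" for v z
  note bounds = derivative_bounds_of_Ck_norm[OF k cd small, folded D_def]
  have D_le: "norm (D v z) \<le> ?e" "\<bar>fst (D v z)\<bar> \<le> ?e" "\<bar>snd (D v z)\<bar> \<le> ?e" if "z \<in> strip" "v \<in> Basis" for v z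
  proof -
    show 1: "norm (D v z) \<le> ?e" using bounds(2)[OF that] .
    show "\<bar>fst (D v z)\<bar> \<le> ?e" using norm_fst_le[of "fst (D v z)" "snd (D v z)"] 1 by simp
    show "\<bar>snd (D v z)\<bar> \<le> ?e" using norm_snd_le[of "snd (D v z)" "fst (D v z)"] 1 by simp
  qed
  have beta: "0 < ?\<beta>" "?\<beta> \<le> 1" using k by auto
  have D_hoelder: "\<bar>fst (D v (x, t)) - fst (D v (x', t'))\<bar> \<le> 1 / 10 * \<bar>x - x'\<bar> powr ?\<beta>"
    "\<bar>snd (D v (x, t)) - snd (D v (x', t'))\<bar> \<le> 1 / 10 * \<bar>x - x'\<bar> powr ?\<beta>"
    if v: "v \<in> Basis" and t: "0 \<le> t" "t \<le> 1" "0 \<le> t'" "t' \<le> 1" and d: "\<bar>t - t'\<bar> \<le> \<bar>x - x'\<bar>" for v x t x' t'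
  proof -
    let ?z = "(x, t)" and ?z' = "(x', t')"
    have z: "?z \<in> strip" "?z' \<in> strip" using t by (auto simp: strip_def)
    have "dist ?z ?z' \<le> \<bar>x - x'\<bar> + \<bar>t - t'\<bar>"
      unfolding dist_Pair_Pair dist_real_def by (metis abs_abs sqrt_sum_squares_le_sum_abs)
    then have "dist ?z ?z' \<le> 2 * \<bar>x - x'\<bar>" using d by simp
    then have "dist ?z ?z' powr ?\<beta> \<le> (2 * \<bar>x - x'\<bar>) powr ?\<beta>" using beta by (intro powr_mono2) auto
    also have "\<dots> = 2 powr ?\<beta> * \<bar>x - x'\<bar> powr ?\<beta>" by (rule powr_mult)
    also have "\<dots> \<le> 2 powr 1 * \<bar>x - x'\<bar> powr ?\<beta>" using beta by (intro mult_right_mono powr_mono) auto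
    finally have "2 * ?e * dist ?z ?z' powr ?\<beta> \<le> 2 * ?e * (2 * \<bar>x - x'\<bar> powr ?\<beta>)"
      by (intro mult_left_mono) auto
    also have "\<dots> \<le> 1 / 10 * \<bar>x - x'\<bar> powr ?\<beta>" by simp
    finally have "dist (D v ?z) (D v ?z') \<le> 1 / 10 * \<bar>x - x'\<bar> powr ?\<beta>"
      using bounds(3)[OF v z] by (rule order_trans[rotated])
    then show "\<bar>fst (D v ?z) - fst (D v ?z')\<bar> \<le> 1 / 10 * \<bar>x - x'\<bar> powr ?\<beta>"
      "\<bar>snd (D v ?z) - snd (D v ?z')\<bar> \<le> 1 / 10 * \<bar>x - x'\<bar> powr ?\<beta>"
      using dist_fst_le[of "D v ?z" "D v ?z'"] dist_snd_le[of "D v ?z" "D v ?z'"] by (auto simp: dist_real_def)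
  qed
  have r: "nat \<lfloor>k\<rfloor> = Suc (nat \<lfloor>k\<rfloor> - 1)" using k by linarith
  have dE: "(E has_derivative (\<lambda>v. fst v *\<^sub>R D (1, 0) z + snd v *\<^sub>R D (0, 1) z)) (at z within strip)" if "z \<in> strip" for z
  proof -
    have "E differentiable (at z within strip)" using cd that by (subst (asm) r) simp
    then have *: "(E has_derivative strip_derivative E z) (at z within strip)"
      by (rule frechet_derivative_strip_works)
    have "strip_derivative E z = (\<lambda>v. fst v *\<^sub>R D (1, 0) z + snd v *\<^sub>R D (0, 1) z)"
      unfolding D_def by (rule ext) (rule linear_on_plane[OF has_derivative_bounded_linear[OF *]])
    then show ?thesis by (rule has_derivative_eq_rhs[OF *])
  qed
  define Fx Ft Gx Gt where "Fx x t = N - fst (D (1, 0) (x, t))" and "Ft x t = - fst (D (0, 1) (x, t))"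
    and "Gx x t = - (pi / 4) * (t * (1 - t) * sin (2 * pi * x)) - snd (D (1, 0) (x, t))"
    and "Gt x t = 1 + (1 - 2 * t) * cos (2 * pi * x) / 8 - snd (D (0, 1) (x, t))" for x t
  have hoelder: "\<bar>P x t - P x' t'\<bar> \<le> 3 * \<bar>x - x'\<bar> powr ?\<beta>"
    if P: "P \<in> {Fx, Ft, Gx, Gt}" and t: "0 \<le> t" "t \<le> 1" "0 \<le> t'" "t' \<le> 1"
      and d: "\<bar>t - t'\<bar> \<le> \<bar>x - x'\<bar>" "\<bar>x - x'\<bar> \<le> 1" for P x t x' t'
  proof -
    let ?p = "\<bar>x - x'\<bar> powr ?\<beta>"
    have p: "\<bar>x - x'\<bar> \<le> ?p"
      using powr_mono'[of ?\<beta> 1 "\<bar>x - x'\<bar>"] beta d(2) by (cases "x = x'") auto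
    note h1 = D_hoelder[OF Basis_plane(1) t d(1)] and h2 = D_hoelder[OF Basis_plane(2) t d(1)]
    note l = kan_partials_lipschitz[OF t d(1)]
    let ?s = "t * (1 - t) * sin (2 * pi * x) - t' * (1 - t') * sin (2 * pi * x')"
    have "pi / 4 * \<bar>?s\<bar> \<le> 4 / 5 * (3 * \<bar>x - x'\<bar>)" using l(1) pi_approx by (intro mult_mono) auto
    then have gx: "\<bar>pi / 4 * ?s\<bar> \<le> 12 / 5 * ?p" using p by (simp add: abs_mult)
    consider "P = Fx" | "P = Ft" | "P = Gx" | "P = Gt" using P by blast
    then show ?thesis
    proof cases
      case 1
      then have "\<bar>P x t - P x' t'\<bar> = \<bar>fst (D (1, 0) (x, t)) - fst (D (1, 0) (x', t'))\<bar>"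
        by (simp add: Fx_def abs_minus_commute)
      then show ?thesis using h1(1) powr_ge_zero[of "\<bar>x - x'\<bar>" ?\<beta>] by linarith
    next
      case 2
      then have "\<bar>P x t - P x' t'\<bar> = \<bar>fst (D (0, 1) (x, t)) - fst (D (0, 1) (x', t'))\<bar>"
        by (simp add: Ft_def abs_minus_commute)
      then show ?thesis using h2(1) powr_ge_zero[of "\<bar>x - x'\<bar>" ?\<beta>] by linarith
    next
      case 3
      have "Gx x t - Gx x' t' = - (pi / 4 * ?s) - (snd (D (1, 0) (x, t)) - snd (D (1, 0) (x', t')))"
        by (simp add: Gx_def algebra_simps)
      then show ?thesis
        unfolding 3 using gx h1(2) powr_ge_zero[of "\<bar>x - x'\<bar>" ?\<beta>] by linarith
    next
      case 4
      have eq: "Gt x t - Gt x' t' = ((1 - 2 * t) * cos (2 * pi * x) - (1 - 2 * t') * cos (2 * pi * x')) / 8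
          - (snd (D (0, 1) (x, t)) - snd (D (0, 1) (x', t')))"
        by (simp add: Gt_def diff_divide_distrib)
      have "\<bar>a / 8 - b\<bar> \<le> 3 * p" if "\<bar>a\<bar> \<le> 9 * d" "\<bar>b\<bar> \<le> 1 / 10 * p" "d \<le> p" for a b d p :: real
        using that by linarith
      from this[OF l(2) h2(2) p] show ?thesis unfolding 4 eq .
    qed
  qed
  have "near_kan (\<lambda>x t. N * x - fst (E (x, t))) G Fx Ft Gx Gt N ?\<beta>"
  proof
    show "0 < ?\<beta>" "?\<beta> \<le> 1" by (fact beta)+
    show "0 < N" "10000000 \<le> (N / 2) powr ?\<beta>" by (fact N)+
    show "G x 0 = 0" "G x 1 = 1" for x by (fact ends)+
    show "\<bar>P x t - P x' t'\<bar> \<le> 3 * \<bar>x - x'\<bar> powr ?\<beta>"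
      if "P \<in> {Fx, Ft, Gx, Gt}" "0 \<le> t" "t \<le> 1" "0 \<le> t'" "t' \<le> 1" "\<bar>t - t'\<bar> \<le> \<bar>x - x'\<bar>" "\<bar>x - x'\<bar> \<le> 1"
      for P x t x' t' by (rule hoelder[OF that])
  next
    fix x t :: real assume t: "0 \<le> t" "t \<le> 1"
    then have z: "(x, t) \<in> strip" by (simp add: strip_def)
    note D1 = D_le(2,3)[OF z Basis_plane(1)] and D2 = D_le(2,3)[OF z Basis_plane(2)]
    show "\<bar>Fx x t - N\<bar> \<le> 1" using D1 by (simp add: Fx_def)
    show "\<bar>Ft x t\<bar> \<le> 1" using D2 by (simp add: Ft_def)
    show "\<bar>Gt x t - (1 + (1 - 2 * t) * cos (2 * pi * x) / 8)\<bar> \<le> 1 / 200000" using D2 by (simp add: Gt_def)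
    show "\<bar>Gx x t\<bar> \<le> 1"
    proof -
      have "1 / 4 - t * (1 - t) = (t - 1 / 2)\<^sup>2" by (simp add: power2_eq_square field_simps)
      then have "t * (1 - t) \<le> 1 / 4" using zero_le_power2[of "t - 1 / 2"] by linarith
      then have "\<bar>pi / 4 * (t * (1 - t) * sin (2 * pi * x))\<bar> \<le> 1 * (1 / 4 * 1)"
        unfolding abs_mult using t pi_less_4 by (intro mult_mono) auto
      then show ?thesis using D1 unfolding Gx_def by linarith
    qed
    have dfst: "((\<lambda>z. fst (E z)) has_derivative (\<lambda>v. fst v * fst (D (1, 0) (x, t)) + snd v * fst (D (0, 1) (x, t))))
        (at (x, t) within strip)"
      using has_derivative_fst[OF dE[OF z]] by simp
    have dsnd: "((\<lambda>z. snd (E z)) has_derivative (\<lambda>v. fst v * snd (D (1, 0) (x, t)) + snd v * snd (D (0, 1) (x, t))))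
        (at (x, t) within strip)"
      using has_derivative_snd[OF dE[OF z]] by simp
    show "((\<lambda>z. N * fst z - fst (E (fst z, snd z))) has_derivative (\<lambda>v. Fx x t * fst v + Ft x t * snd v))
        (at (x, t) within strip)"
      unfolding prod.collapse
      by (rule has_derivative_eq_rhs, (rule derivative_eq_intros dfst refl)+)
         (simp add: fun_eq_iff Fx_def Ft_def algebra_simps)
    show "((\<lambda>z. G (fst z) (snd z)) has_derivative (\<lambda>v. Gx x t * fst v + Gt x t * snd v)) (at (x, t) within strip)"
      unfolding G_def prod.collapse
      by (rule has_derivative_eq_rhs, (rule derivative_eq_intros dsnd refl | simp)+)
         (simp add: fun_eq_iff Gx_def Gt_def field_simps)
  qed
  then show ?thesis by blast
qed

theorem theorem2:
  fixes \<alpha> k :: real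
  assumes "\<alpha> > 0" and "k \<ge> 1 + \<alpha>"
  shows "\<exists>U. U \<noteq> {} \<and> openin (Ck_topology k) U \<and>
    (\<forall>g\<in>U. \<exists>A B.
      attractor annulus_measure g A \<and> attractor annulus_measure g B \<and> A \<inter> B = {} \<and>
      intermingled annulus_measure {basin annulus_measure g A, basin annulus_measure g B} \<and>
      (AE x in annulus_measure. x \<in> basin annulus_measure g A \<union> basin annulus_measure g B))"
    (is "\<exists>U. _ \<and> _ \<and> (\<forall>g\<in>U. ?P g)")
proof -
  have k: "1 < k" using assms by simp
  define \<beta> where "\<beta> = min 1 (k - 1)"
  have \<beta>: "0 < \<beta>" using k by (simp add: \<beta>_def)
  obtain N :: nat where N: "2 * 10000000 powr (1 / \<beta>) \<le> real N" using real_arch_simple by blast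
  have "0 < 2 * 10000000 powr (1 / \<beta>)" by simp
  then have N_pos: "0 < real N" using N by (rule less_le_trans)
  have "10000000 = (10000000 powr (1 / \<beta>)) powr \<beta>" using \<beta> by (simp add: powr_powr)
  also have "\<dots> \<le> (real N / 2) powr \<beta>" using N \<beta> by (intro powr_mono2) auto
  finally have expansion: "10000000 \<le> (real N / 2) powr \<beta>" .
  define U where "U = {h \<in> Ck_boundary_maps k. Ck_dist k (kan_map N) h < ennreal (1 / 1000000)}"
  have kan: "kan_map N \<in> Ck_boundary_maps k" using k by (intro kan_map_in_Ck_boundary_maps) simp
  have "Ck_dist k (kan_map N) (kan_map N) \<le> Ck_norm k strip (\<lambda>z. kan_lift N z - kan_lift N z)"
    unfolding Ck_dist_def using is_lift_kan[of N] by (intro INF_lower2[of "(kan_lift N, kan_lift N)"]) auto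
  then have "Ck_dist k (kan_map N) (kan_map N) = 0" by (simp add: Ck_norm_zero)
  then have "kan_map N \<in> U" using kan by (simp add: U_def)
  moreover have "openin (Ck_topology k) U"
    unfolding openin_Ck_topology U_def by (rule Ck_ball_open[OF kan])
  moreover have "?P g" if "g \<in> U" for g
  proof -
    have g: "g \<in> Ck_boundary_maps k" and "Ck_dist k (kan_map N) g < ennreal (1 / 1000000)"
      using that by (auto simp: U_def)
    from Ck_dist_lessE[OF this(2)] obtain K H'
      where KH: "is_lift K (kan_map N)" "is_lift H' g" "Ck_norm k strip (\<lambda>z. K z - H' z) < ennreal (1 / 1000000)" .
    \<comment> \<open>The lifts that realise the distance may be translated; the same translation brings both back.\<close>
    obtain m :: int where m: "\<And>z. z \<in> strip \<Longrightarrow> K z = kan_lift N z + (of_int m, 0)"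
      using lifts_differ_by_integer[OF is_lift_kan KH(1)] by blast
    define H where "H z = H' z - (of_int m, 0)" for z
    have H: "is_lift H g" unfolding H_def by (rule lift_translate[OF KH(2)])
    define E where "E z = kan_lift N z - H z" for z
    have "Ck_norm k strip E = Ck_norm k strip (\<lambda>z. K z - H' z)"
      by (rule Ck_norm_cong_on) (simp add: E_def H_def m)
    then have small: "Ck_norm k strip E < ennreal (1 / 1000000)" using KH(3) by simp
    have cd: "continuously_differentiable (nat \<lfloor>k\<rfloor>) strip E"
      unfolding E_def by (rule lift_diff_continuously_differentiable[OF kan is_lift_kan g H])
    define F where "F x t = real N * x - fst (E (x, t))" for x t
    define G where "G x t = t + t * (1 - t) * cos (2 * pi * x) / 8 - snd (E (x, t))" for x t
    have FG: "(\<lambda>z. (F (fst z) (snd z), G (fst z) (snd z))) = H"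
      by (auto simp: F_def G_def E_def kan_lift_def prod_eq_iff fun_eq_iff)
    have boundary: "G x t = t" if t: "t = 0 \<or> t = 1" for x t
    proof -
      have z: "(x, t) \<in> strip" using t by (auto simp: strip_def)
      have "covering (x, t) \<in> annulus_boundary" using t by (auto simp: covering_def annulus_boundary_def)
      then have "covering (H (x, t)) \<in> annulus_boundary"
        using H z g unfolding is_lift_def Ck_boundary_maps_def by auto
      then have "G x t = 0 \<or> G x t = 1" by (auto simp: covering_def annulus_boundary_def simp flip: FG)
      moreover have "\<bar>snd (E (x, t))\<bar> \<le> 1 / 1000000"
        using derivative_bounds_of_Ck_norm(1)[OF k cd small z] norm_snd_le[of "snd (E (x, t))" "fst (E (x, t))"] by simp
      moreover have "G x t = t - snd (E (x, t))" using t by (auto simp: G_def)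
      ultimately show ?thesis using t by auto
    qed
    have "\<exists>Fx Ft Gx Gt. near_kan F G Fx Ft Gx Gt (real N) \<beta>"
      unfolding F_def[abs_def] G_def[abs_def] \<beta>_def
    proof (rule near_kan_if_Ck_close[OF k N_pos _ cd small])
      show "10000000 \<le> (real N / 2) powr min 1 (k - 1)" using expansion by (simp add: \<beta>_def)
      show "0 + 0 * (1 - 0) * cos (2 * pi * x) / 8 - snd (E (x, 0)) = 0"
        "1 + 1 * (1 - 1) * cos (2 * pi * x) / 8 - snd (E (x, 1)) = 1" for x
        using boundary[of 0 x] boundary[of 1 x] by (simp_all add: G_def)
    qed
    then obtain Fx Ft Gx Gt where "near_kan F G Fx Ft Gx Gt (real N) \<beta>" by blast
    then interpret near_kan F G Fx Ft Gx Gt "real N" \<beta> .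
    interpret annulus_map g
      using g lift_imp_continuous[OF H] by unfold_locales (auto simp: Ck_boundary_maps_def)
    interpret intermingling_map F G Fx Ft Gx Gt "real N" \<beta> g
      by unfold_locales (simp add: FG H)
    show ?thesis by (rule intermingled_boundary_circles)
  qed
  ultimately show ?thesis by blast
qed

end
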